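(* Let $\mathfrak g$ be a Lie algebra endowed with an invariant nondegenerate symmetric bilinear form $K$, let $G$ be the connected and simply connected Lie group with Lie algebra $\mathfrak g$, and let $\{e_i\}_{i=1}^n$ be an orthonormal basis of $\mathfrak g$ with respect to $K$. Let $G\times G\rightrightarrows G$ be the transformation groupoid of the action of $G$ on itself by conjugation. Define the bivector field on $G\times G$ $$\Pi(g,s)=\frac12\sum_{i=1}^n\Big(\overleftarrow{e_i^2}\wedge\overrightarrow{e_i^2}-\overleftarrow{e_i^2}\wedge\overleftarrow{e_i^1}-\overrightarrow{(\mathrm{Ad}_{g^{-1}}e_i)^2}\wedge\overrightarrow{e_i^1}\Big),$$ where the superscripts $1,2$ refer to the first and second $G$-component, and let $\Omega=\frac14K(\cdot,[\cdot,\cdot]_{\mathfrak g})\in\wedge^3\mathfrak g^*\cong\wedge^3\mathfrak g$ (identification by $K$), regarded as a constant section of the third exterior power of the Lie algebroid $\mathfrak g\times G$. Then $(G\times G\rightrightarrows G,\Pi,\Omega)$ is a quasi-Poisson groupoid.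
   Context: Conventions for the group $G$: for $\xi\in\mathfrak g=T_eG$, $\overrightarrow\xi(g)=(R_g)_*\xi$ and $\overleftarrow\xi(g)=(L_g)_*\xi$ are the right- and left-invariant vector fields on $G$; the Lie bracket of $\mathfrak g$ is taken from right-invariant vector fields, $[\overrightarrow\xi,\overrightarrow\eta]=\overrightarrow{[\xi,\eta]}$. Here $\Omega=\frac16\sum_{i,j,k}\frac14K(e_i,[e_j,e_k])\,e_i\wedge e_j\wedge e_k$. Groupoid conventions: for $\Gamma\rightrightarrows M$, $\alpha,\beta$ are source and target, $i$ is the inversion, and the product of two elements $a,b$ is defined iff $\beta(a)=\alpha(b)$. For $G\times G\rightrightarrows G$: $\alpha(g,s)=gsg^{-1}$, $\beta(g,s)=s$, $(g,hsh^{-1})(h,s)=(gh,s)$. The Lie algebroid is $A=\ker(d\beta)|_M$ with anchor $\rho=d\alpha|_A$; $X\in\Gamma(A)$ gives the right-invariant vector field $\overrightarrow X(g)=(R_g)_*X(\alpha(g))$ on $\Gamma$, with $\overrightarrow{[X,Y]}=[\overrightarrow X,\overrightarrow Y]$. For $P\in\Gamma(\wedge^pA)$, $\overrightarrow P$ is the right-invariant $p$-vector field on $\Gamma$ and $\overleftarrow P=(-1)^pi_*\overrightarrow P$. For $G\times G\rightrightarrows G$, $A=\mathfrak g\times G$. Schouten bracket convention: $[X,f]=X(f)$, $[P,Q]=-(-1)^{(p-1)(q-1)}[Q,P]$, $[P,Q\wedge R]=[P,Q]\wedge R+(-1)^{(p-1)q}Q\wedge[P,R]$. A bivector field $\Pi$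 on $\Gamma$ is multiplicative if the graph of the multiplication in $\Gamma^3$ is coisotropic for $\Pi\oplus\Pi\oplus(-\Pi)$ (which vanishes on pairs of conormal covectors to the graph). A quasi-Poisson groupoid is $(\Gamma\rightrightarrows M,\Pi,\Omega)$ with $\Pi$ a multiplicative bivector field on $\Gamma$ and $\Omega\in\Gamma(\wedge^3A)$ such that $\frac12[\Pi,\Pi]=\overrightarrow\Omega-\overleftarrow\Omega$ and $[\Pi,\overrightarrow\Omega]=0$. *)

theory Defs
  imports "HOL-Analysis.Analysis" "HOL-Algebra.Group"
begin

section \<open>Smooth manifolds\<close>

text \<open>
  A manifold is a topological space (the whole type) with an atlas. Charts take values in a
  finite-dimensional real inner product space; the class \<^class>\<open>euclidean_space\<close> is not
  used for the model space because it excludes dimension 0.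
\<close>

type_synonym ('a, 'e) atlas = "('a set \<times> ('a \<Rightarrow> 'e)) set"

primrec C_k_on :: "nat \<Rightarrow> 'e::real_normed_vector set \<Rightarrow> ('e \<Rightarrow> 'f::real_normed_vector) \<Rightarrow> bool" where
  "C_k_on 0 S f \<longleftrightarrow> continuous_on S f"
| "C_k_on (Suc k) S f \<longleftrightarrow> (\<forall>x\<in>S. f differentiable (at x)) \<and>
     (\<forall>v. C_k_on k S (\<lambda>x. frechet_derivative f (at x) v))"

text \<open>Only meaningful for open sets \<open>S\<close> of a finite-dimensional space.\<close>

definition smooth_on :: "'e::real_normed_vector set \<Rightarrow> ('e \<Rightarrow> 'f::real_normed_vector) \<Rightarrow> bool" where
  "smooth_on S f \<longleftrightarrow> (\<forall>k. C_k_on k S f)"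

definition smooth_manifold ::
    "('a::{second_countable_topology,t2_space}, 'e::real_inner) atlas \<Rightarrow> bool" where
  "smooth_manifold A \<longleftrightarrow>
     (\<exists>B::'e set. finite B \<and> span B = UNIV) \<and>
     (\<Union>(U, \<phi>)\<in>A. U) = UNIV \<and>
     (\<forall>(U, \<phi>)\<in>A. open U \<and> open (\<phi> ` U) \<and> homeomorphism U (\<phi> ` U) \<phi> (inv_into U \<phi>)) \<and>
     (\<forall>(U, \<phi>)\<in>A. \<forall>(V, \<psi>)\<in>A. smooth_on (\<phi> ` (U \<inter> V)) (\<psi> \<circ> inv_into U \<phi>))"

definition prod_atlas :: "('a, 'e) atlas \<Rightarrow> ('b, 'f) atlas \<Rightarrow> ('a \<times> 'b, 'e \<times> 'f) atlas" where
  "prod_atlas A B = {(U \<times> V, map_prod \<phi> \<psi>) | U \<phi> V \<psi>. (U, \<phi>) \<in> A \<and> (V, \<psi>) \<in> B}"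

definition real_atlas :: "(real, real) atlas" where
  "real_atlas = {(UNIV, \<lambda>x. x)}"

text \<open>Smoothness of a map on an open set \<open>W\<close>.\<close>

definition smooth_map_open ::
    "('a::topological_space, 'e::real_inner) atlas \<Rightarrow> ('b::topological_space, 'f::real_inner) atlas \<Rightarrow>
     'a set \<Rightarrow> ('a \<Rightarrow> 'b) \<Rightarrow> bool" where
  "smooth_map_open A B W f \<longleftrightarrow> continuous_on W f \<and>
     (\<forall>(U, \<phi>)\<in>A. \<forall>(V, \<psi>)\<in>B. smooth_on (\<phi> ` (U \<inter> W \<inter> f -` V)) (\<psi> \<circ> f \<circ> inv_into U \<phi>))"

definition smooth_map ::
    "('a::topological_space, 'e::real_inner) atlas \<Rightarrow> ('b::topological_space, 'f::real_inner) atlas \<Rightarrow>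
     ('a \<Rightarrow> 'b) \<Rightarrow> bool" where
  "smooth_map A B f \<longleftrightarrow> smooth_map_open A B UNIV f"

text \<open>
  Smoothness on an arbitrary subset \<open>S\<close> means having smooth local extensions; for an embedded
  submanifold this is smoothness in its own manifold structure.
\<close>

definition smooth_map_on_subset ::
    "('a::topological_space, 'e::real_inner) atlas \<Rightarrow> ('b::topological_space, 'f::real_inner) atlas \<Rightarrow>
     'a set \<Rightarrow> ('a \<Rightarrow> 'b) \<Rightarrow> bool" where
  "smooth_map_on_subset A B S f \<longleftrightarrow>
     (\<forall>p\<in>S. \<exists>W F. open W \<and> p \<in> W \<and> (\<forall>x\<in>S \<inter> W. F x = f x) \<and> smooth_map_open A B W F)"

definition smooth_fun :: "('a::topological_space, 'e::real_inner) atlas \<Rightarrow> ('a \<Rightarrow> real) \<Rightarrow> bool" where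
  "smooth_fun A f \<longleftrightarrow> smooth_map A real_atlas f"


section \<open>Tangent vectors\<close>

text \<open>
  A tangent vector at \<open>p\<close> is identified with its action \<open>f \<mapsto> v f\<close> on smooth functions, a
  directional derivative in a chart around \<open>p\<close>. It is set to 0 on functions that are not smooth,
  so that equality of tangent vectors is equality of functionals.
\<close>

type_synonym 'a tvec = "('a \<Rightarrow> real) \<Rightarrow> real"

definition tangent_space ::
    "('a::topological_space, 'e::real_inner) atlas \<Rightarrow> 'a \<Rightarrow> 'a tvec set" where
  "tangent_space A p =
     {v. \<exists>(U, \<phi>)\<in>A. \<exists>w. p \<in> U \<and>
        v = (\<lambda>f. if smooth_fun A f
                 then frechet_derivative (f \<circ> inv_into U \<phi>) (at (\<phi> p)) w else 0)}"

text \<open>Push-forward along \<open>\<phi>\<close>; the atlas \<open>B\<close> is that of the target of \<open>\<phi>\<close>.\<close>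

definition push ::
    "('b::topological_space, 'f::real_inner) atlas \<Rightarrow> ('a \<Rightarrow> 'b) \<Rightarrow> 'a tvec \<Rightarrow> 'b tvec" where
  "push B \<phi> v = (\<lambda>f. if smooth_fun B f then v (f \<circ> \<phi>) else 0)"

text \<open>The tangent space at \<open>p \<in> S\<close> of an embedded submanifold \<open>S\<close>, inside that of the ambient manifold.\<close>

definition sub_tangent_space ::
    "('a::topological_space, 'e::real_inner) atlas \<Rightarrow> 'a set \<Rightarrow> 'a \<Rightarrow> 'a tvec set" where
  "sub_tangent_space A S p =
     {v \<in> tangent_space A p. \<forall>f. smooth_fun A f \<and> (\<forall>x\<in>S. f x = 0) \<longrightarrow> v f = 0}"

definition submersion ::
    "('a::topological_space, 'e::real_inner) atlas \<Rightarrow> ('b::topological_space, 'f::real_inner) atlas \<Rightarrow>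
     ('a \<Rightarrow> 'b) \<Rightarrow> bool" where
  "submersion A B \<phi> \<longleftrightarrow> smooth_map A B \<phi> \<and>
     (\<forall>p. push B \<phi> ` tangent_space A p = tangent_space B (\<phi> p))"


section \<open>Multivector fields and the Schouten bracket\<close>

text \<open>
  An element \<open>P\<close> of the \<open>p\<close>-th exterior power of the tangent space at \<open>x\<close> is an alternating
  \<open>p\<close>-linear form on covectors at \<open>x\<close>; since every covector is the differential of a smooth
  function, \<open>P\<close> is given by \<open>P [f\<^sub>1, \<dots>, f\<^sub>p] = P(df\<^sub>1, \<dots>, df\<^sub>p)\<close>. The wedge product of
  tangent vectors is normalised as \<open>(v\<^sub>1 \<and> \<dots> \<and> v\<^sub>p)(df\<^sub>1, \<dots>, df\<^sub>p) = det (v\<^sub>i f\<^sub>j)\<close>.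
  Values on lists of another length or with non-smooth entries are irrelevant.
\<close>

type_synonym 'a mvec = "('a \<Rightarrow> real) list \<Rightarrow> real"

definition smooth_args ::
    "('a::topological_space, 'e::real_inner) atlas \<Rightarrow> nat \<Rightarrow> ('a \<Rightarrow> real) list set" where
  "smooth_args A p = {fs. length fs = p \<and> (\<forall>f\<in>set fs. smooth_fun A f)}"

definition wedge :: "'a tvec list \<Rightarrow> 'a mvec" where
  "wedge vs = (\<lambda>fs. \<Sum>\<sigma> | \<sigma> permutes {..<length vs}.
     of_int (sign \<sigma>) * (\<Prod>i<length vs. (vs ! i) (fs ! \<sigma> i)))"

text \<open>The exterior power of a space \<open>V\<close> of tangent vectors: linear combinations of wedge products.\<close>

definition ext_power ::
    "('a::topological_space, 'e::real_inner) atlas \<Rightarrow> nat \<Rightarrow> 'a tvec set \<Rightarrow> 'a mvec set" where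
  "ext_power A p V =
     {P. \<exists>(m::nat) (c::nat \<Rightarrow> real) (v::nat \<Rightarrow> nat \<Rightarrow> 'a tvec).
        (\<forall>k<m. \<forall>i<p. v k i \<in> V) \<and>
        (\<forall>fs\<in>smooth_args A p. P fs = (\<Sum>k<m. c k * wedge (map (v k) [0..<p]) fs))}"

definition multivector_field ::
    "('a::topological_space, 'e::real_inner) atlas \<Rightarrow> nat \<Rightarrow> ('a \<Rightarrow> 'a mvec) \<Rightarrow> bool" where
  "multivector_field A p P \<longleftrightarrow>
     (\<forall>x. P x \<in> ext_power A p (tangent_space A x)) \<and>
     (\<forall>fs\<in>smooth_args A p. smooth_fun A (\<lambda>x. P x fs))"

definition mv_eq ::
    "('a::topological_space, 'e::real_inner) atlas \<Rightarrow> nat \<Rightarrow> ('a \<Rightarrow> 'a mvec) \<Rightarrow> ('a \<Rightarrow> 'a mvec) \<Rightarrow> bool" where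
  "mv_eq A p P Q \<longleftrightarrow> (\<forall>x. \<forall>fs\<in>smooth_args A p. P x fs = Q x fs)"

text \<open>
  The Schouten bracket of a \<open>p\<close>- and a \<open>q\<close>-vector field as a multiderivation. The factorials
  turn the sum over all permutations into the sum over shuffles. Inserting the inner
  multivector in the \<^emph>\<open>last\<close> argument is what gives the conventions \<open>[X, f] = X(f)\<close>,
  \<open>[P, Q] = - (-1)\<^bsup>(p-1)(q-1)\<^esup> [Q, P]\<close> and
  \<open>[P, Q \<and> R] = [P, Q] \<and> R + (-1)\<^bsup>(p-1)q\<^esup> Q \<and> [P, R]\<close>; insertion in the first argument
  would change the bracket by \<open>(-1)\<^bsup>(p-1)(q-1)\<^esup>\<close>. In particular, for a bivector field with
  \<open>{f, g} = \<Pi>(df, dg)\<close>, half of \<open>[\<Pi>, \<Pi>]\<close> maps \<open>(df, dg, dh)\<close> to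
  \<open>{f, {g, h}} + {g, {h, f}} + {h, {f, g}}\<close>.
\<close>

definition mv_insert :: "nat \<Rightarrow> nat \<Rightarrow> ('a \<Rightarrow> 'a mvec) \<Rightarrow> ('a \<Rightarrow> 'a mvec) \<Rightarrow> 'a \<Rightarrow> 'a mvec" where
  "mv_insert p q P Q x fs =
     (if p = 0 then 0 else
       (\<Sum>\<sigma> | \<sigma> permutes {..<p + q - 1}.
          of_int (sign \<sigma>) *
          P x (map (\<lambda>i. fs ! \<sigma> i) [0..<p - 1] @
               [\<lambda>y. Q y (map (\<lambda>i. fs ! \<sigma> i) [p - 1..<p + q - 1])]))
       / (fact (p - 1) * fact q))"

definition schouten :: "nat \<Rightarrow> nat \<Rightarrow> ('a \<Rightarrow> 'a mvec) \<Rightarrow> ('a \<Rightarrow> 'a mvec) \<Rightarrow> 'a \<Rightarrow> 'a mvec" where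
  "schouten p q P Q x fs =
     mv_insert p q P Q x fs - (- 1) ^ ((p + 1) * (q + 1)) * mv_insert q p Q P x fs"


section \<open>Lie groupoids and quasi-Poisson groupoids\<close>

text \<open>The product \<open>gmul \<Gamma> a b\<close> is meaningful only if \<open>tgt \<Gamma> a = src \<Gamma> b\<close>.\<close>

record ('c, 'm, 'e, 'd) groupoid =
  arr_atlas :: "('c, 'e) atlas"
  obj_atlas :: "('m, 'd) atlas"
  src :: "'c \<Rightarrow> 'm"
  tgt :: "'c \<Rightarrow> 'm"
  ident :: "'m \<Rightarrow> 'c"
  ginv :: "'c \<Rightarrow> 'c"
  gmul :: "'c \<Rightarrow> 'c \<Rightarrow> 'c"

definition lie_groupoid ::
    "('c::{second_countable_topology,t2_space}, 'm::{second_countable_topology,t2_space},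
      'e::real_inner, 'd::real_inner) groupoid \<Rightarrow> bool" where
  "lie_groupoid \<Gamma> \<longleftrightarrow>
     smooth_manifold (arr_atlas \<Gamma>) \<and> smooth_manifold (obj_atlas \<Gamma>) \<and>
     (\<forall>a b. tgt \<Gamma> a = src \<Gamma> b \<longrightarrow>
        src \<Gamma> (gmul \<Gamma> a b) = src \<Gamma> a \<and> tgt \<Gamma> (gmul \<Gamma> a b) = tgt \<Gamma> b) \<and>
     (\<forall>a b c. tgt \<Gamma> a = src \<Gamma> b \<and> tgt \<Gamma> b = src \<Gamma> c \<longrightarrow>
        gmul \<Gamma> (gmul \<Gamma> a b) c = gmul \<Gamma> a (gmul \<Gamma> b c)) \<and>
     (\<forall>x. src \<Gamma> (ident \<Gamma> x) = x \<and> tgt \<Gamma> (ident \<Gamma> x) = x) \<and>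
     (\<forall>a. gmul \<Gamma> (ident \<Gamma> (src \<Gamma> a)) a = a \<and> gmul \<Gamma> a (ident \<Gamma> (tgt \<Gamma> a)) = a) \<and>
     (\<forall>a. src \<Gamma> (ginv \<Gamma> a) = tgt \<Gamma> a \<and> tgt \<Gamma> (ginv \<Gamma> a) = src \<Gamma> a \<and>
        gmul \<Gamma> a (ginv \<Gamma> a) = ident \<Gamma> (src \<Gamma> a) \<and>
        gmul \<Gamma> (ginv \<Gamma> a) a = ident \<Gamma> (tgt \<Gamma> a)) \<and>
     submersion (arr_atlas \<Gamma>) (obj_atlas \<Gamma>) (src \<Gamma>) \<and>
     submersion (arr_atlas \<Gamma>) (obj_atlas \<Gamma>) (tgt \<Gamma>) \<and>
     smooth_map (obj_atlas \<Gamma>) (arr_atlas \<Gamma>) (ident \<Gamma>) \<and>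
     smooth_map (arr_atlas \<Gamma>) (arr_atlas \<Gamma>) (ginv \<Gamma>) \<and>
     smooth_map_on_subset (prod_atlas (arr_atlas \<Gamma>) (arr_atlas \<Gamma>)) (arr_atlas \<Gamma>)
       {(a, b). tgt \<Gamma> a = src \<Gamma> b} (\<lambda>(a, b). gmul \<Gamma> a b)"

text \<open>The fibre at \<open>x\<close> of the Lie algebroid \<open>A = ker(d\<beta>)|\<^sub>M\<close>.\<close>

definition algebroid_fibre ::
    "('c::topological_space, 'm::topological_space, 'e::real_inner, 'd::real_inner) groupoid \<Rightarrow>
     'm \<Rightarrow> 'c tvec set" where
  "algebroid_fibre \<Gamma> x =
     {v \<in> tangent_space (arr_atlas \<Gamma>) (ident \<Gamma> x). push (obj_atlas \<Gamma>) (tgt \<Gamma>) v = (\<lambda>_. 0)}"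

definition algebroid_section ::
    "('c::topological_space, 'm::topological_space, 'e::real_inner, 'd::real_inner) groupoid \<Rightarrow>
     nat \<Rightarrow> ('m \<Rightarrow> 'c mvec) \<Rightarrow> bool" where
  "algebroid_section \<Gamma> p P \<longleftrightarrow>
     (\<forall>x. P x \<in> ext_power (arr_atlas \<Gamma>) p (algebroid_fibre \<Gamma> x)) \<and>
     (\<forall>fs\<in>smooth_args (arr_atlas \<Gamma>) p. smooth_fun (obj_atlas \<Gamma>) (\<lambda>x. P x fs))"

text \<open>
  Right translation \<open>R\<^sub>g h = h g\<close> is defined on the \<open>\<beta>\<close>-fibre over \<open>\<alpha>(g)\<close> only. To apply
  \<open>(R\<^sub>g)\<^sub>* P\<close> to \<open>f\<close>, the function \<open>f \<circ> R\<^sub>g\<close> on this fibre is extended smoothly from a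
  neighbourhood of the unit; as \<open>P(\<alpha>(g))\<close> is tangent to the fibre, the choice does not matter.
\<close>

definition fibre_pullback ::
    "('c::topological_space, 'm::topological_space, 'e::real_inner, 'd::real_inner) groupoid \<Rightarrow>
     'c \<Rightarrow> ('c \<Rightarrow> real) \<Rightarrow> ('c \<Rightarrow> real)" where
  "fibre_pullback \<Gamma> g f =
     (SOME F. smooth_fun (arr_atlas \<Gamma>) F \<and>
        (\<exists>W. open W \<and> ident \<Gamma> (src \<Gamma> g) \<in> W \<and>
           (\<forall>h\<in>W. tgt \<Gamma> h = src \<Gamma> g \<longrightarrow> F h = f (gmul \<Gamma> h g))))"

definition right_mv ::
    "('c::topological_space, 'm::topological_space, 'e::real_inner, 'd::real_inner) groupoid \<Rightarrow>
     ('m \<Rightarrow> 'c mvec) \<Rightarrow> 'c \<Rightarrow> 'c mvec" where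
  "right_mv \<Gamma> P g fs = P (src \<Gamma> g) (map (fibre_pullback \<Gamma> g) fs)"

text \<open>\<open>(-1)\<^sup>p i\<^sub>*\<close> of the right-invariant field, where \<open>i\<close> is its own inverse.\<close>

definition left_mv ::
    "('c::topological_space, 'm::topological_space, 'e::real_inner, 'd::real_inner) groupoid \<Rightarrow>
     nat \<Rightarrow> ('m \<Rightarrow> 'c mvec) \<Rightarrow> 'c \<Rightarrow> 'c mvec" where
  "left_mv \<Gamma> p P g fs =
     (- 1) ^ p * right_mv \<Gamma> P (ginv \<Gamma> g) (map (\<lambda>f. f \<circ> ginv \<Gamma>) fs)"

definition mul_graph :: "('c, 'm, 'e, 'd) groupoid \<Rightarrow> ('c \<times> 'c \<times> 'c) set" where
  "mul_graph \<Gamma> = {(a, b, gmul \<Gamma> a b) | a b. tgt \<Gamma> a = src \<Gamma> b}"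

text \<open>The value of \<open>\<Pi> \<oplus> \<Pi> \<oplus> (-\<Pi>)\<close> at a point of \<open>\<Gamma>\<^sup>3\<close>.\<close>

definition triple_bivector :: "('c \<Rightarrow> 'c mvec) \<Rightarrow> 'c \<times> 'c \<times> 'c \<Rightarrow> ('c \<times> 'c \<times> 'c) mvec" where
  "triple_bivector B = (\<lambda>(a, b, c) fs.
     B a (map (\<lambda>f x. f (x, b, c)) fs) + B b (map (\<lambda>f x. f (a, x, c)) fs)
     - B c (map (\<lambda>f x. f (a, b, x)) fs))"

text \<open>\<open>conormal A S p f\<close>: the covector \<open>df\<close> at \<open>p\<close> annihilates the tangent space of \<open>S\<close>.\<close>

definition conormal ::
    "('a::topological_space, 'e::real_inner) atlas \<Rightarrow> 'a set \<Rightarrow> 'a \<Rightarrow> ('a \<Rightarrow> real) \<Rightarrow> bool" where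
  "conormal A S p f \<longleftrightarrow> smooth_fun A f \<and> (\<forall>v\<in>sub_tangent_space A S p. v f = 0)"

definition coisotropic ::
    "('a::topological_space, 'e::real_inner) atlas \<Rightarrow> ('a \<Rightarrow> 'a mvec) \<Rightarrow> 'a set \<Rightarrow> bool" where
  "coisotropic A B S \<longleftrightarrow>
     (\<forall>p\<in>S. \<forall>f g. conormal A S p f \<and> conormal A S p g \<longrightarrow> B p [f, g] = 0)"

definition multiplicative ::
    "('c::topological_space, 'm, 'e::real_inner, 'd) groupoid \<Rightarrow> ('c \<Rightarrow> 'c mvec) \<Rightarrow> bool" where
  "multiplicative \<Gamma> B \<longleftrightarrow>
     coisotropic (prod_atlas (arr_atlas \<Gamma>) (prod_atlas (arr_atlas \<Gamma>) (arr_atlas \<Gamma>)))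
       (triple_bivector B) (mul_graph \<Gamma>)"

definition quasi_poisson_groupoid ::
    "('c::{second_countable_topology,t2_space}, 'm::{second_countable_topology,t2_space},
      'e::real_inner, 'd::real_inner) groupoid \<Rightarrow> ('c \<Rightarrow> 'c mvec) \<Rightarrow> ('m \<Rightarrow> 'c mvec) \<Rightarrow> bool" where
  "quasi_poisson_groupoid \<Gamma> B \<Omega> \<longleftrightarrow>
     lie_groupoid \<Gamma> \<and>
     multivector_field (arr_atlas \<Gamma>) 2 B \<and> multiplicative \<Gamma> B \<and>
     algebroid_section \<Gamma> 3 \<Omega> \<and>
     mv_eq (arr_atlas \<Gamma>) 3 (\<lambda>x fs. 1 / 2 * schouten 2 2 B B x fs)
       (\<lambda>x fs. right_mv \<Gamma> \<Omega> x fs - left_mv \<Gamma> 3 \<Omega> x fs) \<and>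
     mv_eq (arr_atlas \<Gamma>) 4 (schouten 2 3 B (right_mv \<Gamma> \<Omega>)) (\<lambda>x fs. 0)"


section \<open>Lie groups\<close>

definition lie_group ::
    "('a::{second_countable_topology,t2_space}, 'b) monoid_scheme \<Rightarrow> ('a, 'e::real_inner) atlas \<Rightarrow> bool" where
  "lie_group G A \<longleftrightarrow> group G \<and> carrier G = UNIV \<and> smooth_manifold A \<and>
     smooth_map (prod_atlas A A) A (\<lambda>(x, y). x \<otimes>\<^bsub>G\<^esub> y) \<and> smooth_map A A (\<lambda>x. inv\<^bsub>G\<^esub> x)"

definition right_field ::
    "('a::topological_space, 'b) monoid_scheme \<Rightarrow> ('a, 'e::real_inner) atlas \<Rightarrow> 'a tvec \<Rightarrow> 'a \<Rightarrow> 'a tvec" where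
  "right_field G A \<xi> g = push A (\<lambda>h. h \<otimes>\<^bsub>G\<^esub> g) \<xi>"

definition left_field ::
    "('a::topological_space, 'b) monoid_scheme \<Rightarrow> ('a, 'e::real_inner) atlas \<Rightarrow> 'a tvec \<Rightarrow> 'a \<Rightarrow> 'a tvec" where
  "left_field G A \<xi> g = push A (\<lambda>h. g \<otimes>\<^bsub>G\<^esub> h) \<xi>"

definition Ad ::
    "('a::topological_space, 'b) monoid_scheme \<Rightarrow> ('a, 'e::real_inner) atlas \<Rightarrow> 'a \<Rightarrow> 'a tvec \<Rightarrow> 'a tvec" where
  "Ad G A g \<xi> = push A (\<lambda>h. g \<otimes>\<^bsub>G\<^esub> h \<otimes>\<^bsub>G\<^esub> inv\<^bsub>G\<^esub> g) \<xi>"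

abbreviation lie_alg ::
    "('a::topological_space, 'b) monoid_scheme \<Rightarrow> ('a, 'e::real_inner) atlas \<Rightarrow> 'a tvec set" where
  "lie_alg G A \<equiv> tangent_space A \<one>\<^bsub>G\<^esub>"

text \<open>
  The value at the unit of the commutator of the right-invariant vector fields, so this is the
  negative of the bracket defined by left-invariant vector fields.
\<close>

definition lie_bracket ::
    "('a::topological_space, 'b) monoid_scheme \<Rightarrow> ('a, 'e::real_inner) atlas \<Rightarrow>
     'a tvec \<Rightarrow> 'a tvec \<Rightarrow> 'a tvec" where
  "lie_bracket G A \<xi> \<eta> = (\<lambda>f. if smooth_fun A f
     then right_field G A \<xi> \<one>\<^bsub>G\<^esub> (\<lambda>g. right_field G A \<eta> g f)
        - right_field G A \<eta> \<one>\<^bsub>G\<^esub> (\<lambda>g. right_field G A \<xi> g f)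
     else 0)"

definition sym_bilinear_form :: "'a tvec set \<Rightarrow> ('a tvec \<Rightarrow> 'a tvec \<Rightarrow> real) \<Rightarrow> bool" where
  "sym_bilinear_form V K \<longleftrightarrow>
     (\<forall>u\<in>V. \<forall>v\<in>V. K u v = K v u) \<and>
     (\<forall>u\<in>V. \<forall>v\<in>V. \<forall>w\<in>V. \<forall>a b. K (\<lambda>f. a * u f + b * v f) w = a * K u w + b * K v w)"

definition nondegenerate_form :: "'a tvec set \<Rightarrow> ('a tvec \<Rightarrow> 'a tvec \<Rightarrow> real) \<Rightarrow> bool" where
  "nondegenerate_form V K \<longleftrightarrow> (\<forall>u\<in>V. (\<forall>v\<in>V. K u v = 0) \<longrightarrow> u = (\<lambda>_. 0))"

definition invariant_form ::
    "('a::topological_space, 'b) monoid_scheme \<Rightarrow> ('a, 'e::real_inner) atlas \<Rightarrow>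
     ('a tvec \<Rightarrow> 'a tvec \<Rightarrow> real) \<Rightarrow> bool" where
  "invariant_form G A K \<longleftrightarrow>
     (\<forall>u\<in>lie_alg G A. \<forall>v\<in>lie_alg G A. \<forall>w\<in>lie_alg G A.
        K (lie_bracket G A u v) w = K u (lie_bracket G A v w))"

definition orthonormal_basis_of ::
    "'a tvec set \<Rightarrow> ('a tvec \<Rightarrow> 'a tvec \<Rightarrow> real) \<Rightarrow> nat \<Rightarrow> (nat \<Rightarrow> 'a tvec) \<Rightarrow> bool" where
  "orthonormal_basis_of V K n e \<longleftrightarrow>
     (\<forall>i\<in>{1..n}. e i \<in> V) \<and>
     (\<forall>v\<in>V. \<exists>c::nat \<Rightarrow> real. v = (\<lambda>f. \<Sum>i=1..n. c i * e i f)) \<and>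
     (\<forall>c::nat \<Rightarrow> real. (\<lambda>f. \<Sum>i=1..n. c i * e i f) = (\<lambda>_. 0) \<longrightarrow> (\<forall>i\<in>{1..n}. c i = 0)) \<and>
     (\<forall>i\<in>{1..n}. \<forall>j\<in>{1..n}. K (e i) (e j) = (if i = j then 1 else 0))"


section \<open>The transformation groupoid of the conjugation action\<close>

definition conj_groupoid ::
    "('a, 'b) monoid_scheme \<Rightarrow> ('a, 'e) atlas \<Rightarrow> ('a \<times> 'a, 'a, 'e \<times> 'e, 'e) groupoid" where
  "conj_groupoid G A = \<lparr>
     arr_atlas = prod_atlas A A,
     obj_atlas = A,
     src = (\<lambda>(g, s). g \<otimes>\<^bsub>G\<^esub> s \<otimes>\<^bsub>G\<^esub> inv\<^bsub>G\<^esub> g),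
     tgt = (\<lambda>(g, s). s),
     ident = (\<lambda>s. (\<one>\<^bsub>G\<^esub>, s)),
     ginv = (\<lambda>(g, s). (inv\<^bsub>G\<^esub> g, g \<otimes>\<^bsub>G\<^esub> s \<otimes>\<^bsub>G\<^esub> inv\<^bsub>G\<^esub> g)),
     gmul = (\<lambda>(g, t) (h, s). (g \<otimes>\<^bsub>G\<^esub> h, s)) \<rparr>"

text \<open>Tangent vectors of \<open>G\<close> at \<open>g\<close>, respectively \<open>s\<close>, as tangent vectors of \<open>G \<times> G\<close> at \<open>(g, s)\<close>.\<close>

definition comp1 ::
    "('a::topological_space, 'e::real_inner) atlas \<Rightarrow> 'a \<Rightarrow> 'a tvec \<Rightarrow> ('a \<times> 'a) tvec" where
  "comp1 A s v = push (prod_atlas A A) (\<lambda>h. (h, s)) v"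

definition comp2 ::
    "('a::topological_space, 'e::real_inner) atlas \<Rightarrow> 'a \<Rightarrow> 'a tvec \<Rightarrow> ('a \<times> 'a) tvec" where
  "comp2 A g v = push (prod_atlas A A) (\<lambda>h. (g, h)) v"

definition conj_bivector ::
    "('a::topological_space, 'b) monoid_scheme \<Rightarrow> ('a, 'e::real_inner) atlas \<Rightarrow>
     nat \<Rightarrow> (nat \<Rightarrow> 'a tvec) \<Rightarrow> 'a \<times> 'a \<Rightarrow> ('a \<times> 'a) mvec" where
  "conj_bivector G A n e = (\<lambda>(g, s) fs. 1 / 2 * (\<Sum>i=1..n.
     wedge [comp2 A g (left_field G A (e i) s), comp2 A g (right_field G A (e i) s)] fs
     - wedge [comp2 A g (left_field G A (e i) s), comp1 A s (left_field G A (e i) g)] fs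
     - wedge [comp2 A g (right_field G A (Ad G A (inv\<^bsub>G\<^esub> g) (e i)) s),
              comp1 A s (right_field G A (e i) g)] fs))"

text \<open>
  The constant section of the third exterior power of \<open>\<gg> \<times> G\<close>; the element \<open>(\<xi>, s)\<close> of
  \<open>\<gg> \<times> G\<close> is the tangent vector \<open>(\<xi>, 0)\<close> of \<open>G \<times> G\<close> at the unit \<open>(1, s)\<close>.
\<close>

definition cartan_section ::
    "('a::topological_space, 'b) monoid_scheme \<Rightarrow> ('a, 'e::real_inner) atlas \<Rightarrow>
     ('a tvec \<Rightarrow> 'a tvec \<Rightarrow> real) \<Rightarrow> nat \<Rightarrow> (nat \<Rightarrow> 'a tvec) \<Rightarrow> 'a \<Rightarrow> ('a \<times> 'a) mvec" where
  "cartan_section G A K n e s fs =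
     1 / 6 * (\<Sum>i=1..n. \<Sum>j=1..n. \<Sum>k=1..n.
       1 / 4 * K (e i) (lie_bracket G A (e j) (e k)) *
       wedge [comp1 A s (e i), comp1 A s (e j), comp1 A s (e k)] fs)"

end

theory Submission
  imports Defs
begin

text \<open>
  Write \<open>a i\<close> and \<open>b i\<close> for the left-invariant vector fields of \<open>e i\<close> on the first and second factor of
  \<open>G \<times> G\<close>, and \<open>r i\<close> for the right-invariant ones on the second factor. An invariant form on the Lie
  algebra of a connected group is \<open>Ad\<close>-invariant, so tensors built from \<open>\<Sum>i. e i \<otimes> e i\<close> and from the
  structure constants \<open>c\<close> do not change when all their entries are conjugated by a group element
  (\<open>Ad_invariant2\<close>, \<open>Ad_invariant3\<close>). This expresses the data of the theorem by these three frames: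

    \<^item> the bivector field is \<open>\<Pi> = 1/2 (\<Sum>i. a i \<and> b i + a i \<and> r i + b i \<and> r i)\<close>
      (\<open>conj_bivector_eq_br\<close>);
    \<^item> the right-invariant trivector is \<open>\<Omega>(a)\<close>, where
      \<open>\<Omega>(x) = 1/24 (\<Sum>i j k. c i j k * x i \<and> x j \<and> x k)\<close> (\<open>right_mv_eq_Q\<close>);
    \<^item> the inversion of the groupoid exchanges the right-invariant fields with \<open>- (a + b - r)\<close>, so the
      left-invariant trivector is \<open>\<Omega>(a + b - r)\<close> (\<open>left_mv_value\<close>).

  The three frames commute with each other, with \<open>[x i, x j] = \<plusminus> (\<Sum>k. c k i j * x k)\<close> within a frame, the sign
  being \<open>+\<close> for \<open>r\<close>. The Jacobiator of \<open>\<Pi>\<close> therefore involves only commutators and equals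
  \<open>\<Omega>(a) - \<Omega>(a + b - r) + \<Omega>(b) - \<Omega>(r)\<close> (\<open>jacobiator_value\<close>), and \<open>\<Omega>(b) = \<Omega>(r)\<close> by \<open>Ad\<close>-invariance.
  Every field of the frames preserves \<open>\<Omega>(a)\<close>, by the Jacobi identity for \<open>a\<close> and trivially for \<open>b\<close>
  and \<open>r\<close>, so \<open>[\<Pi>, \<Omega>(a)] = 0\<close> (\<open>invariant_trivector_commutes\<close>). For multiplicativity, moving the
  parameters of the graph of the multiplication gives four linear relations between the derivatives of a
  conormal function in the three slots (\<open>conormal_relations\<close>), and these make the three contributions
  of \<open>\<Pi>\<close> cancel (\<open>multiplicative_conj_bivector\<close>).

  All calculations are carried out with tangent vectors as derivations of functions. They rest on three
  facts about functions of two variables, proved once in charts: a partial derivative is again smooth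
  (\<open>smooth_fun_partial\<close>), partial derivatives commute (\<open>tangent_commute\<close>), and the derivative along the
  diagonal is the sum of the partial derivatives (\<open>tangent_diagonal\<close>).
\<close>

section \<open>Maps of class \<open>C\<^sup>k\<close>\<close>

lemma C_k_on_cong:
  assumes "open S" "\<And>x. x \<in> S \<Longrightarrow> f x = g x"
  shows "C_k_on k S f = C_k_on k S g"
  using assms
proof (induction k arbitrary: f g)
  case 0
  then show ?case by (simp cong: continuous_on_cong)
next
  case (Suc k)
  have D: "(f has_derivative d) (at x) \<longleftrightarrow> (g has_derivative d) (at x)" if "x \<in> S" for x d
    using has_derivative_transform_within_open[of f d x UNIV S g]
      has_derivative_transform_within_open[of g d x UNIV S f] Suc.prems that by auto
  then have "frechet_derivative f (at x) = frechet_derivative g (at x)" if "x \<in> S" for x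
    unfolding frechet_derivative_def using that by simp
  then have "C_k_on k S (\<lambda>x. frechet_derivative f (at x) v) = C_k_on k S (\<lambda>x. frechet_derivative g (at x) v)" for v
    using Suc.prems(1) by (intro Suc.IH) auto
  then show ?case using D by (simp add: differentiable_def)
qed

lemma C_k_on_subset: "C_k_on k S f \<Longrightarrow> T \<subseteq> S \<Longrightarrow> C_k_on k T f"
  by (induction k arbitrary: f) (auto intro: continuous_on_subset)

lemma C_k_on_local:
  assumes "\<And>x. x \<in> S \<Longrightarrow> \<exists>T. open T \<and> x \<in> T \<and> C_k_on k T f"
  shows "C_k_on k S f"
  using assms
proof (induction k arbitrary: f)
  case 0
  have "isCont f x" if "x \<in> S" for x
    using 0[OF that] by (auto simp: continuous_on_eq_continuous_at)
  then show ?case by (simp add: continuous_at_imp_continuous_on)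
next
  case (Suc k)
  have "f differentiable (at x)" if "x \<in> S" for x
    using Suc.prems[OF that] by auto
  moreover have "C_k_on k S (\<lambda>x. frechet_derivative f (at x) v)" for v
  proof (rule Suc.IH)
    fix x assume "x \<in> S"
    then show "\<exists>T. open T \<and> x \<in> T \<and> C_k_on k T (\<lambda>x. frechet_derivative f (at x) v)"
      using Suc.prems by fastforce
  qed
  ultimately show ?case by simp
qed

lemma C_k_on_Suc_imp: "C_k_on (Suc k) S f \<Longrightarrow> C_k_on k S f"
proof (induction k arbitrary: f)
  case 0
  then show ?case
    by (auto intro: continuous_at_imp_continuous_on differentiable_imp_continuous_within)
qed auto

lemma C_k_on_const: "C_k_on k S (\<lambda>x. c)"
  by (induction k arbitrary: c) (auto simp: frechet_derivative_const)

lemma C_k_on_bounded_linear: "bounded_linear f \<Longrightarrow> C_k_on k S f"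
proof (cases k)
  case (Suc j)
  assume f: "bounded_linear f"
  have D: "(f has_derivative f) (at x)" for x by (rule bounded_linear_imp_has_derivative[OF f])
  then have "frechet_derivative f (at x) = f" for x by (metis frechet_derivative_at)
  then show ?thesis using Suc D by (auto simp: C_k_on_const differentiable_def)
qed (simp add: linear_continuous_on)

lemma C_k_on_linear_comp:
  assumes L: "bounded_linear L" and "open S" "C_k_on k S f"
  shows "C_k_on k S (\<lambda>x. L (f x))"
  using assms(3)
proof (induction k arbitrary: f)
  case 0
  then show ?case by (auto intro: bounded_linear.continuous_on[OF L])
next
  case (Suc k)
  have D: "((\<lambda>x. L (f x)) has_derivative (\<lambda>h. L (frechet_derivative f (at x) h))) (at x)" if "x \<in> S" for x
    using Suc.prems that
    by (intro bounded_linear.has_derivative[OF L]) (auto simp: frechet_derivative_works[symmetric])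
  have "C_k_on k S (\<lambda>x. frechet_derivative (\<lambda>x. L (f x)) (at x) v)" for v
    using Suc
    by (subst C_k_on_cong[OF \<open>open S\<close>, where g = "\<lambda>x. L (frechet_derivative f (at x) v)"])
      (auto simp: frechet_derivative_at[OF D, symmetric])
  then show ?case using D by (auto simp: differentiable_def)
qed

lemma C_k_on_add:
  assumes "open S" "C_k_on k S f" "C_k_on k S g"
  shows "C_k_on k S (\<lambda>x. f x + g x)"
  using assms(2,3)
proof (induction k arbitrary: f g)
  case 0
  then show ?case by (auto intro: continuous_intros)
next
  case (Suc k)
  have D: "((\<lambda>x. f x + g x) has_derivative (\<lambda>h. frechet_derivative f (at x) h +
      frechet_derivative g (at x) h)) (at x)" if "x \<in> S" for x
    using Suc.prems that
    by (intro has_derivative_add) (auto simp: frechet_derivative_works[symmetric])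
  have "C_k_on k S (\<lambda>x. frechet_derivative (\<lambda>x. f x + g x) (at x) v)" for v
    using Suc by (subst C_k_on_cong[OF \<open>open S\<close>, where
          g = "\<lambda>x. frechet_derivative f (at x) v + frechet_derivative g (at x) v"])
      (auto simp: frechet_derivative_at[OF D, symmetric])
  then show ?case using D by (auto simp: differentiable_def)
qed

lemma C_k_on_sum:
  assumes "open S" "finite I" "\<And>i. i \<in> I \<Longrightarrow> C_k_on k S (f i)"
  shows "C_k_on k S (\<lambda>x. \<Sum>i\<in>I. f i x)"
  using assms(2,3) by (induction I) (simp_all add: C_k_on_const C_k_on_add[OF \<open>open S\<close>])

lemma C_k_on_scaleR:
  assumes "open S" "C_k_on k S f" "C_k_on k S g"
  shows "C_k_on k S (\<lambda>x. f x *\<^sub>R g x)"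
  using assms(2,3)
proof (induction k arbitrary: f g)
  case 0
  then show ?case by (auto intro: continuous_intros)
next
  case (Suc k)
  have "((\<lambda>x. f x *\<^sub>R g x) has_derivative (\<lambda>h. f x *\<^sub>R frechet_derivative g (at x) h +
      frechet_derivative f (at x) h *\<^sub>R g x)) (at x)" if "x \<in> S" for x
    using Suc.prems that
    by (intro has_derivative_scaleR) (auto simp: frechet_derivative_works[symmetric])
  note D = this
  have "C_k_on k S (\<lambda>x. frechet_derivative (\<lambda>x. f x *\<^sub>R g x) (at x) v)" for v
    using Suc C_k_on_Suc_imp[OF Suc.prems(1)] C_k_on_Suc_imp[OF Suc.prems(2)]
    by (subst C_k_on_cong[OF \<open>open S\<close>, where
          g = "\<lambda>x. f x *\<^sub>R frechet_derivative g (at x) v + frechet_derivative f (at x) v *\<^sub>R g x"])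
      (auto simp: frechet_derivative_at[OF D, symmetric] intro!: C_k_on_add[OF \<open>open S\<close>])
  then show ?case using D by (auto simp: differentiable_def)
qed

lemma C_k_on_Pair:
  assumes "open S" "C_k_on k S f" "C_k_on k S g"
  shows "C_k_on k S (\<lambda>x. (f x, g x))"
  using assms(2,3)
proof (induction k arbitrary: f g)
  case 0
  then show ?case by (auto intro: continuous_intros)
next
  case (Suc k)
  have D: "((\<lambda>x. (f x, g x)) has_derivative (\<lambda>h. (frechet_derivative f (at x) h,
      frechet_derivative g (at x) h))) (at x)" if "x \<in> S" for x
    using Suc.prems that
    by (intro has_derivative_Pair) (auto simp: frechet_derivative_works[symmetric])
  have "C_k_on k S (\<lambda>x. frechet_derivative (\<lambda>x. (f x, g x)) (at x) v)" for v
    using Suc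
    by (subst C_k_on_cong[OF \<open>open S\<close>, where
          g = "\<lambda>x. (frechet_derivative f (at x) v, frechet_derivative g (at x) v)"])
      (auto simp: frechet_derivative_at[OF D, symmetric])
  then show ?case using D by (auto simp: differentiable_def)
qed

definition finite_dim :: "'e::real_inner itself \<Rightarrow> bool" where
  "finite_dim _ \<longleftrightarrow> (\<exists>B::'e set. finite B \<and> span B = UNIV)"

text \<open>
  The set \<open>C\<close> may contain 0. This does no harm, since then the coefficient is multiplied by 0.
\<close>

lemma finite_dim_orthogonal_basis:
  assumes "finite_dim TYPE('e::real_inner)"
  obtains C :: "'e::real_inner set" where "finite C" "\<And>w. w = (\<Sum>c\<in>C. ((w \<bullet> c) / (c \<bullet> c)) *\<^sub>R c)"
proof -
  obtain B :: "'e set" where "finite B" "span B = UNIV"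
    using assms unfolding finite_dim_def by auto
  then obtain C :: "'e set" where C: "finite C" "span C = UNIV" "pairwise orthogonal C"
    using basis_orthogonal[OF \<open>finite B\<close>] by auto
  have "w - (\<Sum>c\<in>C. ((w \<bullet> c) / (c \<bullet> c)) *\<^sub>R c) = 0" for w
  proof -
    let ?u = "w - (\<Sum>c\<in>C. ((w \<bullet> c) / (c \<bullet> c)) *\<^sub>R c)"
    have "?u \<bullet> d = 0" if "d \<in> C" for d
    proof -
      have "(\<Sum>c\<in>C. ((w \<bullet> c) / (c \<bullet> c)) * (c \<bullet> d)) = (\<Sum>c\<in>C. if c = d then w \<bullet> d else 0)"
        using C(3) that by (intro sum.cong) (auto simp: pairwise_def orthogonal_def)
      also have "\<dots> = w \<bullet> d" using C(1) that by simp
      finally show ?thesis unfolding inner_diff_left inner_sum_left inner_scaleR_left by simp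
    qed
    then have "orthogonal ?u x" if "x \<in> span C" for x
      by (rule_tac orthogonal_to_span[OF that]) (simp only: orthogonal_def)
    then have "orthogonal ?u ?u" unfolding C(2) by blast
    then show ?thesis unfolding orthogonal_def inner_eq_zero_iff .
  qed
  note * = iffD1[OF right_minus_eq this]
  show thesis by (rule that[OF C(1) *])
qed

lemma finite_dim_prod:
  assumes "finite_dim TYPE('e::real_inner)" "finite_dim TYPE('f::real_inner)"
  shows "finite_dim TYPE('e::real_inner \<times> 'f::real_inner)"
proof -
  obtain B :: "'e set" and C :: "'f set" where B: "finite B" "span B = UNIV" "finite C" "span C = UNIV"
    using assms unfolding finite_dim_def by auto
  let ?D = "(\<lambda>b. (b, 0)) ` B \<union> (\<lambda>c. (0, c)) ` C"
  have 1: "(b, 0) \<in> span ?D" for b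
  proof -
    have "linear (\<lambda>b::'e. (b, 0::'f))" by (auto intro!: linearI)
    then have "(\<lambda>b. (b, 0)) ` span B = span ((\<lambda>b. (b, 0::'f)) ` B)" by (rule linear_span_image[symmetric])
    moreover have "span ((\<lambda>b. (b, 0::'f)) ` B) \<subseteq> span ?D" by (intro span_mono) auto
    ultimately show ?thesis using B by blast
  qed
  have 2: "(0, c) \<in> span ?D" for c
  proof -
    have "linear (\<lambda>c::'f. (0::'e, c))" by (auto intro!: linearI)
    then have "(\<lambda>c. (0, c)) ` span C = span ((\<lambda>c. (0::'e, c)) ` C)" by (rule linear_span_image[symmetric])
    moreover have "span ((\<lambda>c. (0::'e, c)) ` C) \<subseteq> span ?D" by (intro span_mono) auto
    ultimately show ?thesis using B by blast
  qed
  have "x \<in> span ?D" for x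
    using span_add[OF 1[of "fst x"] 2[of "snd x"]] by simp
  then show ?thesis using B unfolding finite_dim_def by (intro exI[of _ ?D]) auto
qed

text \<open>
  The chain rule gives \<open>D(g \<circ> f)(x) v = Dg(f x)(Df(x) v)\<close>, where the direction \<open>Df(x) v\<close> varies with
  \<open>x\<close>, whereas \<^const>\<open>C_k_on\<close> only controls derivatives in a fixed direction. Expanding the direction in
  an orthogonal basis of the middle space gives a finite sum of products to which the induction
  hypothesis applies; this is where finite dimension enters.
\<close>

lemma C_k_on_compose:
  fixes f :: "'d::real_normed_vector \<Rightarrow> 'e::real_inner" and g :: "'e \<Rightarrow> 'f::real_normed_vector"
  assumes "finite_dim TYPE('e)" "open S" "open T" "C_k_on k S f" "C_k_on k T g" "f ` S \<subseteq> T"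
  shows "C_k_on k S (\<lambda>x. g (f x))"
  using assms(4-6)
proof (induction k arbitrary: f g)
  case 0
  then show ?case by (auto intro: continuous_on_compose2)
next
  case (Suc k)
  obtain C :: "'e set" where C: "finite C" "\<And>w. w = (\<Sum>c\<in>C. ((w \<bullet> c) / (c \<bullet> c)) *\<^sub>R c)"
    using finite_dim_orthogonal_basis[OF assms(1)] by metis
  have D: "((\<lambda>x. g (f x)) has_derivative (\<lambda>h. frechet_derivative g (at (f x))
      (frechet_derivative f (at x) h))) (at x)" if "x \<in> S" for x
  proof -
    have "(f has_derivative frechet_derivative f (at x)) (at x)"
      using Suc.prems(1) that by (simp add: frechet_derivative_works[symmetric])
    moreover have "f x \<in> T" using Suc.prems(3) that by auto
    then have "(g has_derivative frechet_derivative g (at (f x))) (at (f x))"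
      using Suc.prems(2) by (simp add: frechet_derivative_works[symmetric])
    ultimately show ?thesis using diff_chain_at unfolding comp_def by blast
  qed
  have "frechet_derivative (\<lambda>x. g (f x)) (at x) v = (\<Sum>c\<in>C. ((frechet_derivative f (at x) v \<bullet> c) / (c \<bullet> c)) *\<^sub>R
     frechet_derivative g (at (f x)) c)" if "x \<in> S" for x v
  proof -
    have "g differentiable (at (f x))" using Suc.prems that by auto
    then have lin: "linear (frechet_derivative g (at (f x)))" by (rule linear_frechet_derivative)
    have "frechet_derivative (\<lambda>x. g (f x)) (at x) v
        = frechet_derivative g (at (f x)) (frechet_derivative f (at x) v)"
      using frechet_derivative_at[OF D[OF that], symmetric] by simp
    also have "\<dots> = frechet_derivative g (at (f x)) (\<Sum>c\<in>C. ((frechet_derivative f (at x) v \<bullet> c) / (c \<bullet> c)) *\<^sub>R c)"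
      by (rule arg_cong[OF C(2)])
    finally show ?thesis by (simp add: linear_sum[OF lin] linear_cmul[OF lin])
  qed
  note E = this
  have "C_k_on k S (\<lambda>x. frechet_derivative (\<lambda>x. g (f x)) (at x) v)" for v
  proof (subst C_k_on_cong[OF \<open>open S\<close> E], assumption)
    have "C_k_on k S (\<lambda>x. frechet_derivative g (at (f x)) c)" for c
      using Suc.prems C_k_on_Suc_imp[OF Suc.prems(1)] by (intro Suc.IH[where g="\<lambda>y. frechet_derivative g (at y) c"]) auto
    moreover have "C_k_on k S (\<lambda>x. (frechet_derivative f (at x) v \<bullet> c) / (c \<bullet> c))" for c
      using Suc.prems
      by (intro C_k_on_linear_comp[OF bounded_linear_compose[OF bounded_linear_divide bounded_linear_inner_left] \<open>open S\<close>]) auto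
    ultimately show "C_k_on k S (\<lambda>x. \<Sum>c\<in>C. ((frechet_derivative f (at x) v \<bullet> c) / (c \<bullet> c)) *\<^sub>R
     frechet_derivative g (at (f x)) c)"
      using C(1) by (intro C_k_on_sum C_k_on_scaleR \<open>open S\<close>)
  qed
  then show ?case using D by (auto simp: differentiable_def)
qed

lemma has_real_derivative_along_line:
  assumes "F differentiable (at (x + s *\<^sub>R u))"
  shows "((\<lambda>s. F (x + s *\<^sub>R u)) has_real_derivative frechet_derivative F (at (x + s *\<^sub>R u)) u) (at s)"
proof -
  let ?D = "frechet_derivative F (at (x + s *\<^sub>R u))"
  have F: "(F has_derivative ?D) (at (x + s *\<^sub>R u))"
    using assms by (simp add: frechet_derivative_works)
  have "((\<lambda>s. x + s *\<^sub>R u) has_derivative (\<lambda>h. h *\<^sub>R u)) (at s)"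
    by (auto intro!: derivative_eq_intros)
  from diff_chain_at[OF this F] have "((\<lambda>s. F (x + s *\<^sub>R u)) has_derivative (\<lambda>h. ?D (h *\<^sub>R u))) (at s)"
    by (simp add: comp_def)
  moreover have "?D (h *\<^sub>R u) = ?D u * h" for h
    using linear_frechet_derivative[OF assms] by (simp add: linear_cmul)
  ultimately show ?thesis by (simp add: has_field_derivative_def)
qed

text \<open>
  Two applications of the mean value theorem: along \<open>u\<close> to the increment of \<open>F\<close> in the direction \<open>h v\<close>,
  then along \<open>v\<close> to the derivative of \<open>F\<close> in the direction \<open>u\<close>.
\<close>

lemma second_difference_mean_value:
  fixes F :: "'e::real_normed_vector \<Rightarrow> real"
  assumes "h > 0"
    and "\<And>s t. 0 \<le> s \<Longrightarrow> s \<le> h \<Longrightarrow> 0 \<le> t \<Longrightarrow> t \<le> h \<Longrightarrow> F differentiable (at (x + s *\<^sub>R u + t *\<^sub>R v))"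
    and "\<And>s t. 0 \<le> s \<Longrightarrow> s \<le> h \<Longrightarrow> 0 \<le> t \<Longrightarrow> t \<le> h \<Longrightarrow>
      (\<lambda>y. frechet_derivative F (at y) u) differentiable (at (x + s *\<^sub>R u + t *\<^sub>R v))"
  obtains s t where "0 < s" "s < h" "0 < t" "t < h"
    "F (x + h *\<^sub>R u + h *\<^sub>R v) - F (x + h *\<^sub>R u) - F (x + h *\<^sub>R v) + F x
      = h * h * frechet_derivative (\<lambda>y. frechet_derivative F (at y) u) (at (x + s *\<^sub>R u + t *\<^sub>R v)) v"
proof -
  define G where "G s = F ((x + h *\<^sub>R v) + s *\<^sub>R u) - F (x + s *\<^sub>R u)" for s
  define DG where "DG s = frechet_derivative F (at ((x + h *\<^sub>R v) + s *\<^sub>R u)) u - frechet_derivative F (at (x + s *\<^sub>R u)) u" for s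
  have "(G has_real_derivative DG s) (at s)" if "0 \<le> s" "s \<le> h" for s
    unfolding G_def[abs_def] DG_def
    using assms(2)[OF that, of h] assms(2)[OF that, of 0] \<open>h > 0\<close>
    by (intro DERIV_diff has_real_derivative_along_line) (auto simp: algebra_simps)
  from MVT2[OF \<open>h > 0\<close> this] obtain s where s: "0 < s" "s < h" "G h - G 0 = h * DG s" by auto
  let ?E = "\<lambda>y. frechet_derivative F (at y) u"
  have "((\<lambda>t. ?E ((x + s *\<^sub>R u) + t *\<^sub>R v)) has_real_derivative
      frechet_derivative ?E (at ((x + s *\<^sub>R u) + t *\<^sub>R v)) v) (at t)" if "0 \<le> t" "t \<le> h" for t
    using assms(3)[of s t] that s by (intro has_real_derivative_along_line) auto
  from MVT2[OF \<open>h > 0\<close> this] obtain t where t: "0 < t" "t < h"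
    "?E (x + s *\<^sub>R u + h *\<^sub>R v) - ?E (x + s *\<^sub>R u + 0 *\<^sub>R v) = h * frechet_derivative ?E (at (x + s *\<^sub>R u + t *\<^sub>R v)) v"
    by auto
  have "DG s = ?E (x + s *\<^sub>R u + h *\<^sub>R v) - ?E (x + s *\<^sub>R u + 0 *\<^sub>R v)"
    unfolding DG_def by (simp add: algebra_simps)
  with s t show thesis
    by (intro that[of s t]) (auto simp: G_def algebra_simps)
qed

text \<open>
  The second difference is symmetric in \<open>u\<close> and \<open>v\<close>, so the two mixed derivatives agree up to moving the
  base points, which tend to \<open>x\<close> with the size of the parallelogram; continuity does the rest.
\<close>

lemma symmetric_second_derivative:
  fixes F :: "'e::real_normed_vector \<Rightarrow> real"
  assumes "open S" "C_k_on 2 S F" "x \<in> S"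
  shows "frechet_derivative (\<lambda>y. frechet_derivative F (at y) u) (at x) v
       = frechet_derivative (\<lambda>y. frechet_derivative F (at y) v) (at x) u"
proof -
  define H where "H u v y = frechet_derivative (\<lambda>y. frechet_derivative F (at y) u) (at y) v" for u v y
  have C: "continuous_on S (H u v)" "y \<in> S \<Longrightarrow> F differentiable (at y)"
    "y \<in> S \<Longrightarrow> (\<lambda>y. frechet_derivative F (at y) u) differentiable (at y)" for u v y
    using assms(2) by (auto simp: H_def[abs_def] numeral_2_eq_2)
  have "\<bar>H u v x - H v u x\<bar> < e" if "e > 0" for e
  proof -
    have "\<exists>d>0. \<forall>y. dist y x < d \<longrightarrow> \<bar>H u v y - H u v x\<bar> < e / 2" for u v
    proof -
      have "isCont (H u v) x"
        using C(1)[of u v] assms by (simp add: continuous_on_eq_continuous_at)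
      moreover have "e / 2 > 0" using that by simp
      ultimately show ?thesis unfolding continuous_at_eps_delta dist_real_def by blast
    qed
    then obtain d1 d2 where d: "d1 > 0" "\<And>y. dist y x < d1 \<Longrightarrow> \<bar>H u v y - H u v x\<bar> < e / 2"
      "d2 > 0" "\<And>y. dist y x < d2 \<Longrightarrow> \<bar>H v u y - H v u x\<bar> < e / 2" by metis
    obtain d3 where d3: "d3 > 0" "ball x d3 \<subseteq> S" using assms openE by blast
    define r where "r = min d1 (min d2 d3)"
    \<comment> \<open>so small that the parallelogram spanned by \<open>h u\<close> and \<open>h v\<close> at \<open>x\<close> lies in the ball of radius \<open>r\<close>\<close>
    define h where "h = r / (2 * (norm u + norm v + 1))"
    have r: "r > 0" using d d3 by (simp add: r_def)
    have pos: "norm u + norm v + 1 > 0" by (smt (verit) norm_ge_zero)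
    then have h: "h > 0" using r by (simp add: h_def)
    have near: "dist (x + s *\<^sub>R u + t *\<^sub>R v) x < r" if "0 \<le> s" "s \<le> h" "0 \<le> t" "t \<le> h" for s t
    proof -
      have "dist (x + s *\<^sub>R u + t *\<^sub>R v) x = norm (s *\<^sub>R u + t *\<^sub>R v)"
        by (simp add: dist_norm algebra_simps)
      also have "\<dots> \<le> norm (s *\<^sub>R u) + norm (t *\<^sub>R v)" by (rule norm_triangle_ineq)
      also have "\<dots> \<le> h * norm u + h * norm v" using that by (intro add_mono) (auto intro: mult_right_mono)
      also have "\<dots> \<le> h * (norm u + norm v + 1)" using h by (simp add: algebra_simps)
      also have "\<dots> = r / 2" using pos unfolding h_def by (simp add: divide_simps)
      finally show ?thesis using r by simp
    qed
    then have near': "x + s *\<^sub>R u + t *\<^sub>R v \<in> S" "x + t *\<^sub>R v + s *\<^sub>R u \<in> S"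
        if "0 \<le> s" "s \<le> h" "0 \<le> t" "t \<le> h" for s t
    proof -
      show "x + s *\<^sub>R u + t *\<^sub>R v \<in> S"
        using near[OF that] d3(2) by (auto simp: r_def dist_commute mem_ball subset_eq)
      then show "x + t *\<^sub>R v + s *\<^sub>R u \<in> S" by (simp add: add_ac)
    qed
    obtain s t where st: "0 < s" "s < h" "0 < t" "t < h" 
      "F (x + h *\<^sub>R u + h *\<^sub>R v) - F (x + h *\<^sub>R u) - F (x + h *\<^sub>R v) + F x = h * h * H u v (x + s *\<^sub>R u + t *\<^sub>R v)"
      unfolding H_def using C near' h by (rule_tac second_difference_mean_value[of h F x u v]) auto
    obtain s' t' where st': "0 < s'" "s' < h" "0 < t'" "t' < h" 
      "F (x + h *\<^sub>R v + h *\<^sub>R u) - F (x + h *\<^sub>R v) - F (x + h *\<^sub>R u) + F x = h * h * H v u (x + s' *\<^sub>R v + t' *\<^sub>R u)"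
      unfolding H_def using C near' h by (rule_tac second_difference_mean_value[of h F x v u]) auto
    have "x + h *\<^sub>R v + h *\<^sub>R u = x + h *\<^sub>R u + h *\<^sub>R v" by simp
    with st st' have "h * h * H u v (x + s *\<^sub>R u + t *\<^sub>R v) = h * h * H v u (x + s' *\<^sub>R v + t' *\<^sub>R u)"
      by (smt (verit))
    then have eq: "H u v (x + s *\<^sub>R u + t *\<^sub>R v) = H v u (x + t' *\<^sub>R u + s' *\<^sub>R v)"
      using h by (simp add: algebra_simps)
    have "\<bar>H u v (x + s *\<^sub>R u + t *\<^sub>R v) - H u v x\<bar> < e / 2"
      using near[of s t] st by (intro d) (auto simp: r_def)
    moreover have "\<bar>H v u (x + t' *\<^sub>R u + s' *\<^sub>R v) - H v u x\<bar> < e / 2"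
      using near[of t' s'] st' by (intro d) (auto simp: r_def)
    ultimately show ?thesis using eq by linarith
  qed
  then have "\<bar>H u v x - H v u x\<bar> \<le> 0" by (meson less_irrefl not_le)
  then show ?thesis by (simp add: H_def)
qed

section \<open>Manifolds and smooth maps\<close>

lemma smooth_on_cong:
  "open S \<Longrightarrow> (\<And>x. x \<in> S \<Longrightarrow> f x = g x) \<Longrightarrow> smooth_on S f = smooth_on S g"
  unfolding smooth_on_def using C_k_on_cong by blast

lemma smooth_on_subset: "smooth_on S f \<Longrightarrow> T \<subseteq> S \<Longrightarrow> smooth_on T f"
  unfolding smooth_on_def using C_k_on_subset by blast

lemma smooth_on_local:
  "(\<And>x. x \<in> S \<Longrightarrow> \<exists>T. open T \<and> x \<in> T \<and> smooth_on T f) \<Longrightarrow> smooth_on S f"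
  unfolding smooth_on_def by (intro allI C_k_on_local) blast

lemma smooth_on_const: "smooth_on S (\<lambda>x. c)"
  by (simp add: smooth_on_def C_k_on_const)

lemma smooth_on_bounded_linear: "bounded_linear f \<Longrightarrow> smooth_on S f"
  by (simp add: smooth_on_def C_k_on_bounded_linear)

lemma smooth_on_add: "open S \<Longrightarrow> smooth_on S f \<Longrightarrow> smooth_on S g \<Longrightarrow> smooth_on S (\<lambda>x. f x + g x)"
  by (simp add: smooth_on_def C_k_on_add)

lemma smooth_on_mult:
  fixes f g :: "'e::real_normed_vector \<Rightarrow> real"
  shows "open S \<Longrightarrow> smooth_on S f \<Longrightarrow> smooth_on S g \<Longrightarrow> smooth_on S (\<lambda>x. f x * g x)"
  using C_k_on_scaleR[of S _ f g] by (simp add: smooth_on_def)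

lemma smooth_on_Pair: "open S \<Longrightarrow> smooth_on S f \<Longrightarrow> smooth_on S g \<Longrightarrow> smooth_on S (\<lambda>x. (f x, g x))"
  by (simp add: smooth_on_def C_k_on_Pair)

lemma smooth_on_compose:
  fixes f :: "'d::real_normed_vector \<Rightarrow> 'e::real_inner" and g :: "'e \<Rightarrow> 'f::real_normed_vector"
  assumes "finite_dim TYPE('e)" "open S" "open T" "smooth_on S f" "smooth_on T g" "f ` S \<subseteq> T"
  shows "smooth_on S (\<lambda>x. g (f x))"
  using assms(4,5) C_k_on_compose[OF assms(1-3) _ _ assms(6)] unfolding smooth_on_def by blast

lemma smooth_on_imp_differentiable: "smooth_on S f \<Longrightarrow> x \<in> S \<Longrightarrow> f differentiable (at x)"
  unfolding smooth_on_def by (metis C_k_on.simps(2))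

lemma smooth_on_imp_continuous: "smooth_on S f \<Longrightarrow> continuous_on S f"
  unfolding smooth_on_def by (metis C_k_on.simps(1))

lemma smooth_on_frechet_derivative: "smooth_on S f \<Longrightarrow> smooth_on S (\<lambda>x. frechet_derivative f (at x) v)"
  unfolding smooth_on_def by (metis C_k_on.simps(2))

lemma smooth_manifold_finite_dim:
  fixes A :: "('a::{second_countable_topology,t2_space}, 'e::real_inner) atlas"
  shows "smooth_manifold A \<Longrightarrow> finite_dim TYPE('e)"
  by (simp add: smooth_manifold_def finite_dim_def)

lemma chartD:
  assumes "smooth_manifold A" "(U, \<phi>) \<in> A"
  shows "open U" "open (\<phi> ` U)" "inj_on \<phi> U" "continuous_on U \<phi>"
    "continuous_on (\<phi> ` U) (inv_into U \<phi>)"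
    "\<And>x. x \<in> U \<Longrightarrow> inv_into U \<phi> (\<phi> x) = x"
    "\<And>y. y \<in> \<phi> ` U \<Longrightarrow> inv_into U \<phi> y \<in> U"
    "\<And>y. y \<in> \<phi> ` U \<Longrightarrow> \<phi> (inv_into U \<phi> y) = y"
proof -
  have *: "open U" "open (\<phi> ` U)" "homeomorphism U (\<phi> ` U) \<phi> (inv_into U \<phi>)"
    using assms unfolding smooth_manifold_def by auto
  then show "open U" "open (\<phi> ` U)" "continuous_on U \<phi>" "continuous_on (\<phi> ` U) (inv_into U \<phi>)"
    by (auto simp: homeomorphism_def)
  show inv: "inv_into U \<phi> (\<phi> x) = x" if "x \<in> U" for x
    using *(3) that by (auto simp: homeomorphism_def)
  then show "inj_on \<phi> U" by (metis inj_onI)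
  show "inv_into U \<phi> y \<in> U" "\<phi> (inv_into U \<phi> y) = y" if "y \<in> \<phi> ` U" for y
    using that by (auto simp: inv_into_into f_inv_into_f)
qed

lemma chart_at:
  assumes "smooth_manifold A"
  obtains U \<phi> where "(U, \<phi>) \<in> A" "p \<in> U"
proof -
  have "p \<in> (\<Union>(U, \<phi>)\<in>A. U)" using assms by (simp add: smooth_manifold_def)
  then show thesis using that by auto
qed

lemma open_chart_image:
  assumes "smooth_manifold A" "(U, \<phi>) \<in> A" "open W"
  shows "open (\<phi> ` (U \<inter> W))"
proof -
  have "\<phi> ` (U \<inter> W) = \<phi> ` U \<inter> inv_into U \<phi> -` W"
    using chartD[OF assms(1,2)] by force
  then show ?thesis
    using continuous_on_open_vimage[OF chartD(2)[OF assms(1,2)]] chartD(5)[OF assms(1,2)] assms(3)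
    by (metis Int_commute)
qed

lemma chart_transition_smooth:
  assumes "smooth_manifold A" "(U, \<phi>) \<in> A" "(V, \<psi>) \<in> A"
  shows "smooth_on (\<phi> ` (U \<inter> V)) (\<lambda>x. \<psi> (inv_into U \<phi> x))"
proof -
  have "\<forall>(U, \<phi>)\<in>A. \<forall>(V, \<psi>)\<in>A. smooth_on (\<phi> ` (U \<inter> V)) (\<psi> \<circ> inv_into U \<phi>)"
    using assms(1) unfolding smooth_manifold_def by (elim conjE)
  from bspec[OF this assms(2)] have "\<forall>(V, \<psi>)\<in>A. smooth_on (\<phi> ` (U \<inter> V)) (\<psi> \<circ> inv_into U \<phi>)" by simp
  from bspec[OF this assms(3)] show ?thesis by (simp add: comp_def)
qed

lemma smooth_mapD:
  assumes "smooth_map A B f" "(U, \<phi>) \<in> A" "(V, \<psi>) \<in> B"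
  shows "smooth_on (\<phi> ` (U \<inter> f -` V)) (\<lambda>x. \<psi> (f (inv_into U \<phi> x)))"
proof -
  have "\<forall>(U, \<phi>)\<in>A. \<forall>(V, \<psi>)\<in>B. smooth_on (\<phi> ` (U \<inter> UNIV \<inter> f -` V)) (\<psi> \<circ> f \<circ> inv_into U \<phi>)"
    using assms(1) unfolding smooth_map_def smooth_map_open_def by (elim conjE)
  from bspec[OF this assms(2)] have "\<forall>(V, \<psi>)\<in>B. smooth_on (\<phi> ` (U \<inter> f -` V)) (\<psi> \<circ> f \<circ> inv_into U \<phi>)" by simp
  from bspec[OF this assms(3)] show ?thesis by (simp add: comp_def)
qed

lemma smooth_map_continuous: "smooth_map A B f \<Longrightarrow> continuous_on UNIV f"
  by (simp add: smooth_map_def smooth_map_open_def)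

lemma smooth_map_open_vimage: "smooth_map A B f \<Longrightarrow> open V \<Longrightarrow> open (f -` V)"
  by (rule open_vimage[OF _ smooth_map_continuous])

text \<open>
  Smoothness is a condition on all pairs of charts, but one pair around each point suffices: near the
  point any other coordinate expression is obtained by composing the given one with chart transitions.
  Continuity of \<open>f\<close> comes for free, because \<open>f\<close> is locally the coordinate expression conjugated by charts.
\<close>

lemma smooth_mapI:
  assumes A: "smooth_manifold A" and B: "smooth_manifold B"
    and loc: "\<And>p. \<exists>U \<phi> V \<psi> W. (U, \<phi>) \<in> A \<and> (V, \<psi>) \<in> B \<and> open W \<and> p \<in> W \<and> W \<subseteq> U \<and> f ` W \<subseteq> V \<and>
       smooth_on (\<phi> ` W) (\<lambda>x. \<psi> (f (inv_into U \<phi> x)))"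
  shows "smooth_map A B f"
proof -
  have "isCont f p" for p
  proof -
    obtain U \<phi> V \<psi> W where *: "(U, \<phi>) \<in> A" "(V, \<psi>) \<in> B" "open W" "p \<in> W" "W \<subseteq> U" "f ` W \<subseteq> V"
      "smooth_on (\<phi> ` W) (\<lambda>x. \<psi> (f (inv_into U \<phi> x)))"
      using loc[of p] by (elim exE conjE) (rule that; assumption)
    note cU = chartD[OF A *(1)] and cV = chartD[OF B *(2)]
    have "continuous_on W (\<lambda>x. inv_into V \<psi> ((\<lambda>x. \<psi> (f (inv_into U \<phi> x))) (\<phi> x)))"
    proof (rule continuous_on_compose2[OF cV(5)])
      show "continuous_on W (\<lambda>x. (\<lambda>x. \<psi> (f (inv_into U \<phi> x))) (\<phi> x))"
        using *(5) by (intro continuous_on_compose2[OF smooth_on_imp_continuous[OF *(7)]]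
            continuous_on_subset[OF cU(4)]) auto
      show "(\<lambda>x. \<psi> (f (inv_into U \<phi> (\<phi> x)))) ` W \<subseteq> \<psi> ` V"
        using *(6) by (auto simp: cU(6)[OF subsetD[OF *(5)]])
    qed
    moreover have "inv_into V \<psi> (\<psi> (f (inv_into U \<phi> (\<phi> x)))) = f x" if "x \<in> W" for x
      using *(6) that by (subst cU(6)[OF subsetD[OF *(5) that]], intro cV(6)) auto
    ultimately have "continuous_on W f"
      by (simp cong: continuous_on_cong)
    then show ?thesis using *(3,4) by (simp add: continuous_on_eq_continuous_at)
  qed
  then have cont: "continuous_on UNIV f" by (simp add: continuous_at_imp_continuous_on)
  have "smooth_on (\<phi> ` (U \<inter> f -` V)) (\<psi> \<circ> f \<circ> inv_into U \<phi>)" if UV: "(U, \<phi>) \<in> A" "(V, \<psi>) \<in> B" for U \<phi> V \<psi>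
  proof (rule smooth_on_local)
    fix y assume "y \<in> \<phi> ` (U \<inter> f -` V)"
    then obtain p where p: "p \<in> U" "f p \<in> V" "y = \<phi> p" by auto
    obtain U' \<phi>' V' \<psi>' W where *: "(U', \<phi>') \<in> A" "(V', \<psi>') \<in> B" "open W" "p \<in> W" "W \<subseteq> U'" "f ` W \<subseteq> V'"
      "smooth_on (\<phi>' ` W) (\<lambda>x. \<psi>' (f (inv_into U' \<phi>' x)))"
      using loc[of p] by (elim exE conjE) (rule that; assumption)
    note cU = chartD[OF A UV(1)] and cV = chartD[OF B UV(2)]
      and cU' = chartD[OF A *(1)] and cV' = chartD[OF B *(2)]
    define N where "N = U \<inter> f -` V \<inter> W"
    have "open (f -` V)" using open_vimage[OF cV(1) cont] .
    then have N: "open N" "N \<subseteq> U" "N \<subseteq> W" "f ` N \<subseteq> V" "p \<in> N" using *(3,4) cU(1) p by (auto simp: N_def)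
    have inv: "inv_into U \<phi> (\<phi> x) = x" "inv_into U' \<phi>' (\<phi>' x) = x"
      "inv_into V' \<psi>' (\<psi>' (f x)) = f x" "f x \<in> V" "f x \<in> V'" "x \<in> W" if "x \<in> N" for x
    proof -
      show xV: "f x \<in> V" "f x \<in> V'" "x \<in> W" using that N(3,4) *(6) by blast+
      have "x \<in> U" "x \<in> U'" using that N(2,3) *(5) by blast+
      then show "inv_into U \<phi> (\<phi> x) = x" "inv_into U' \<phi>' (\<phi>' x) = x" "inv_into V' \<psi>' (\<psi>' (f x)) = f x"
        using xV(2) cU(6) cU'(6) cV'(6) by simp_all
    qed
    have oN: "open (\<phi> ` N)" using open_chart_image[OF A UV(1) N(1)] N(2) by (simp add: inf.absorb2)
    have oW: "open (\<phi>' ` W)" using open_chart_image[OF A *(1,3)] *(5) by (simp add: inf.absorb2)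
    have sm: "smooth_on (\<phi> ` N) (\<lambda>x. (\<lambda>z. \<psi> (inv_into V' \<psi>' z)) ((\<lambda>w. \<psi>' (f (inv_into U' \<phi>' w))) (\<phi>' (inv_into U \<phi> x))))"
    proof (rule smooth_on_compose[OF smooth_manifold_finite_dim[OF B] oN _ _ chart_transition_smooth[OF B *(2) UV(2)]])
      show "open (\<psi>' ` (V' \<inter> V))" using open_chart_image[OF B *(2) cV(1)] .
      show "smooth_on (\<phi> ` N) (\<lambda>x. \<psi>' (f (inv_into U' \<phi>' (\<phi>' (inv_into U \<phi> x)))))"
      proof (rule smooth_on_compose[OF smooth_manifold_finite_dim[OF A] oN oW _ *(7)])
        show "smooth_on (\<phi> ` N) (\<lambda>x. \<phi>' (inv_into U \<phi> x))"
          using N(2,3) *(5)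
          by (intro smooth_on_subset[OF chart_transition_smooth[OF A UV(1) *(1)] image_mono]) auto
      qed (auto simp: inv)
      show "(\<lambda>x. \<psi>' (f (inv_into U' \<phi>' (\<phi>' (inv_into U \<phi> x))))) ` \<phi> ` N \<subseteq> \<psi>' ` (V' \<inter> V)"
        by (auto simp: inv)
    qed
    have eq: "\<psi> (inv_into V' \<psi>' (\<psi>' (f (inv_into U' \<phi>' (\<phi>' (inv_into U \<phi> x)))))) = (\<psi> \<circ> f \<circ> inv_into U \<phi>) x"
      if "x \<in> \<phi> ` N" for x
      using that by (auto simp: inv)
    have "smooth_on (\<phi> ` N) (\<psi> \<circ> f \<circ> inv_into U \<phi>)"
      by (rule iffD1[OF smooth_on_cong[OF oN eq] sm])
    then show "\<exists>T. open T \<and> y \<in> T \<and> smooth_on T (\<psi> \<circ> f \<circ> inv_into U \<phi>)"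
      by (intro exI[of _ "\<phi> ` N"] conjI oN) (use N(5) p(3) in auto)
  qed
  then show ?thesis using cont by (auto simp: smooth_map_def smooth_map_open_def)
qed

lemma smooth_map_compose:
  assumes A: "smooth_manifold A" and B: "smooth_manifold B" and C: "smooth_manifold C"
    and g: "smooth_map B C g" and f: "smooth_map A B f"
  shows "smooth_map A C (\<lambda>x. g (f x))"
proof (rule smooth_mapI[OF A C])
  fix p
  obtain U \<phi> where U: "(U, \<phi>) \<in> A" "p \<in> U" using chart_at[OF A] .
  obtain V \<psi> where V: "(V, \<psi>) \<in> B" "f p \<in> V" using chart_at[OF B] .
  obtain W \<theta> where W: "(W, \<theta>) \<in> C" "g (f p) \<in> W" using chart_at[OF C] .
  note cU = chartD[OF A U(1)] and cV = chartD[OF B V(1)] and cW = chartD[OF C W(1)]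
  define N where "N = U \<inter> f -` (V \<inter> g -` W)"
  have ogW: "open (g -` W)" using smooth_map_open_vimage[OF g cW(1)] .
  then have o: "open (f -` (V \<inter> g -` W))" using smooth_map_open_vimage[OF f open_Int[OF cV(1)]] by blast
  have N: "open N" "N \<subseteq> U" "p \<in> N" using o cU(1) U V W by (auto simp: N_def)
  have oN: "open (\<phi> ` N)" using open_chart_image[OF A U(1) o] by (simp add: N_def)
  have sm0: "smooth_on (\<phi> ` N) (\<lambda>x. (\<lambda>z. \<theta> (g (inv_into V \<psi> z))) (\<psi> (f (inv_into U \<phi> x))))"
    using open_chart_image[OF B V(1) ogW]
  proof (rule smooth_on_compose[OF smooth_manifold_finite_dim[OF B] oN _ _ smooth_mapD[OF g V(1) W(1)]])
    show "smooth_on (\<phi> ` N) (\<lambda>x. \<psi> (f (inv_into U \<phi> x)))"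
      by (rule smooth_on_subset[OF smooth_mapD[OF f U(1) V(1)]]) (auto simp: N_def)
    show "(\<lambda>x. \<psi> (f (inv_into U \<phi> x))) ` \<phi> ` N \<subseteq> \<psi> ` (V \<inter> g -` W)"
      using cU(6) by (auto simp: N_def)
  qed
  have eq: "\<theta> (g (inv_into V \<psi> (\<psi> (f (inv_into U \<phi> x))))) = \<theta> (g (f (inv_into U \<phi> x)))" if "x \<in> \<phi> ` N" for x
    using that by (auto simp: N_def cU(6) cV(6))
  have "smooth_on (\<phi> ` N) (\<lambda>x. \<theta> (g (f (inv_into U \<phi> x))))"
    by (rule iffD1[OF smooth_on_cong[OF oN eq] sm0])
  note sm = this
  have im: "(\<lambda>x. g (f x)) ` N \<subseteq> W" by (auto simp: N_def)
  show "\<exists>U \<phi> V \<psi> W. (U, \<phi>) \<in> A \<and> (V, \<psi>) \<in> C \<and> open W \<and> p \<in> W \<and> W \<subseteq> U \<and>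
      (\<lambda>x. g (f x)) ` W \<subseteq> V \<and> smooth_on (\<phi> ` W) (\<lambda>x. \<psi> (g (f (inv_into U \<phi> x))))"
    by (rule exI conjI U(1) W(1) N(1) N(3) N(2) im sm)+
qed

lemma smooth_map_id: "smooth_manifold A \<Longrightarrow> smooth_map A A (\<lambda>x. x)"
  by (auto simp: smooth_map_def smooth_map_open_def comp_def intro: chart_transition_smooth)

lemma smooth_map_const:
  shows "smooth_map A B (\<lambda>x. c)"
  by (auto simp: smooth_map_def smooth_map_open_def comp_def smooth_on_const)

lemma inv_into_map_prod:
  assumes "inj_on \<phi> U" "inj_on \<psi> V" "x \<in> \<phi> ` U" "y \<in> \<psi> ` V"
  shows "inv_into (U \<times> V) (map_prod \<phi> \<psi>) (x, y) = (inv_into U \<phi> x, inv_into V \<psi> y)"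
proof -
  have "map_prod \<phi> \<psi> (inv_into U \<phi> x, inv_into V \<psi> y) = (x, y)"
    using assms by (simp add: f_inv_into_f)
  moreover have "(inv_into U \<phi> x, inv_into V \<psi> y) \<in> U \<times> V"
    using assms by (simp add: inv_into_into)
  moreover have "inj_on (map_prod \<phi> \<psi>) (U \<times> V)" using assms(1,2) by (auto simp: inj_on_def)
  ultimately show ?thesis by (metis inv_into_f_f)
qed

lemma map_prod_image_Times: "map_prod f g ` (S \<times> T) = f ` S \<times> g ` T"
  by auto

lemma prod_atlasI: "(U, \<phi>) \<in> A \<Longrightarrow> (V, \<psi>) \<in> B \<Longrightarrow> (U \<times> V, map_prod \<phi> \<psi>) \<in> prod_atlas A B"
  unfolding prod_atlas_def by blast

lemma prod_atlasE:
  assumes "(W, \<theta>) \<in> prod_atlas A B"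
  obtains U \<phi> V \<psi> where "(U, \<phi>) \<in> A" "(V, \<psi>) \<in> B" "W = U \<times> V" "\<theta> = map_prod \<phi> \<psi>"
  using assms unfolding prod_atlas_def by blast

lemma smooth_manifold_prod:
  fixes A :: "('a::{second_countable_topology,t2_space}, 'e::real_inner) atlas"
    and B :: "('b::{second_countable_topology,t2_space}, 'f::real_inner) atlas"
  assumes A: "smooth_manifold A" and B: "smooth_manifold B"
  shows "smooth_manifold (prod_atlas A B)"
proof -
  have "\<exists>D::('e \<times> 'f) set. finite D \<and> span D = UNIV"
    using finite_dim_prod[OF smooth_manifold_finite_dim[OF A] smooth_manifold_finite_dim[OF B]]
    by (simp add: finite_dim_def)
  moreover have "(\<Union>(U, \<phi>)\<in>prod_atlas A B. U) = UNIV"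
  proof -
    have "(p, q) \<in> (\<Union>(U, \<phi>)\<in>prod_atlas A B. U)" for p q
    proof -
      obtain U \<phi> where U: "(U, \<phi>) \<in> A" "p \<in> U" using chart_at[OF A] .
      obtain V \<psi> where V: "(V, \<psi>) \<in> B" "q \<in> V" using chart_at[OF B] .
      show ?thesis using U V by (intro UN_I[OF prod_atlasI[OF U(1) V(1)]]) auto
    qed
    then show ?thesis by auto
  qed
  moreover have "open W \<and> open (\<theta> ` W) \<and> homeomorphism W (\<theta> ` W) \<theta> (inv_into W \<theta>)"
    if "(W, \<theta>) \<in> prod_atlas A B" for W \<theta>
  proof -
    from that obtain U \<phi> V \<psi> where *: "(U, \<phi>) \<in> A" "(V, \<psi>) \<in> B" "W = U \<times> V" "\<theta> = map_prod \<phi> \<psi>"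
      by (rule prod_atlasE)
    note cU = chartD[OF A *(1)] and cV = chartD[OF B *(2)]
    have inv: "inv_into W \<theta> (x, y) = (inv_into U \<phi> x, inv_into V \<psi> y)" if "x \<in> \<phi> ` U" "y \<in> \<psi> ` V" for x y
      using inv_into_map_prod[OF cU(3) cV(3) that] * by simp
    have "continuous_on (\<phi> ` U \<times> \<psi> ` V) (\<lambda>z. (inv_into U \<phi> (fst z), inv_into V \<psi> (snd z)))"
      by (intro continuous_on_Pair continuous_on_compose2[OF cU(5)] continuous_on_compose2[OF cV(5)]
          continuous_on_fst continuous_on_snd continuous_on_id) auto
    then have "continuous_on (\<phi> ` U \<times> \<psi> ` V) (inv_into W \<theta>)"
      using inv by (subst continuous_on_cong[OF refl]) auto
    then have c1: "continuous_on (\<theta> ` W) (inv_into W \<theta>)" using * by (simp add: map_prod_image_Times)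
    have "continuous_on (U \<times> V) (\<lambda>z. (\<phi> (fst z), \<psi> (snd z)))"
      by (intro continuous_on_Pair continuous_on_compose2[OF cU(4)] continuous_on_compose2[OF cV(4)]
          continuous_on_fst continuous_on_snd continuous_on_id) auto
    moreover have "map_prod \<phi> \<psi> = (\<lambda>z. (\<phi> (fst z), \<psi> (snd z)))" by auto
    ultimately have c2: "continuous_on W \<theta>" using * by simp
    have inj: "inj_on \<theta> W" using cU(3) cV(3) * by (auto simp: inj_on_def)
    have "homeomorphism W (\<theta> ` W) \<theta> (inv_into W \<theta>)"
      unfolding homeomorphism_def
      using c1 c2 inv_into_image_cancel[OF inj order_refl] inv_into_f_f[OF inj] by (auto simp: f_inv_into_f)
    then show ?thesis using * cU(1,2) cV(1,2) by (simp add: map_prod_image_Times open_Times)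
  qed
  moreover have "smooth_on (\<theta> ` (W \<inter> W')) (\<theta>' \<circ> inv_into W \<theta>)"
    if W: "(W, \<theta>) \<in> prod_atlas A B" and W': "(W', \<theta>') \<in> prod_atlas A B" for W \<theta> W' \<theta>'
  proof -
    from W obtain U \<phi> V \<psi> where *: "(U, \<phi>) \<in> A" "(V, \<psi>) \<in> B" "W = U \<times> V" "\<theta> = map_prod \<phi> \<psi>"
      by (rule prod_atlasE)
    from W' obtain U' \<phi>' V' \<psi>' where st: "(U', \<phi>') \<in> A" "(V', \<psi>') \<in> B" "W' = U' \<times> V'" "\<theta>' = map_prod \<phi>' \<psi>'"
      by (rule prod_atlasE)
    note cU = chartD[OF A *(1)] and cV = chartD[OF B *(2)] and cU' = chartD[OF A st(1)] and cV' = chartD[OF B st(2)]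
    have im: "\<theta> ` (W \<inter> W') = \<phi> ` (U \<inter> U') \<times> \<psi> ` (V \<inter> V')"
      using * st by (simp add: Times_Int_Times map_prod_image_Times)
    have o1: "open (\<phi> ` (U \<inter> U'))" using open_chart_image[OF A *(1) cU'(1)] .
    have o2: "open (\<psi> ` (V \<inter> V'))" using open_chart_image[OF B *(2) cV'(1)] .
    have o: "open (\<theta> ` (W \<inter> W'))" using o1 o2 im by (simp add: open_Times)
    have sm: "smooth_on (\<theta> ` (W \<inter> W')) (\<lambda>z. (\<phi>' (inv_into U \<phi> (fst z)), \<psi>' (inv_into V \<psi> (snd z))))"
    proof (intro smooth_on_Pair[OF o])
      show "smooth_on (\<theta> ` (W \<inter> W')) (\<lambda>z. \<phi>' (inv_into U \<phi> (fst z)))"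
        by (rule smooth_on_compose[OF smooth_manifold_finite_dim[OF A] o o1 _ chart_transition_smooth[OF A *(1) st(1)]])
          (auto simp: im intro: smooth_on_bounded_linear bounded_linear_fst)
      show "smooth_on (\<theta> ` (W \<inter> W')) (\<lambda>z. \<psi>' (inv_into V \<psi> (snd z)))"
        by (rule smooth_on_compose[OF smooth_manifold_finite_dim[OF B] o o2 _ chart_transition_smooth[OF B *(2) st(2)]])
          (auto simp: im intro: smooth_on_bounded_linear bounded_linear_snd)
    qed
    have eq: "(\<phi>' (inv_into U \<phi> (fst z)), \<psi>' (inv_into V \<psi> (snd z))) = (\<theta>' \<circ> inv_into W \<theta>) z"
      if "z \<in> \<theta> ` (W \<inter> W')" for z
    proof -
      have "fst z \<in> \<phi> ` U" "snd z \<in> \<psi> ` V" using that im by auto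
      then show ?thesis using inv_into_map_prod[OF cU(3) cV(3), of "fst z" "snd z"] * st by simp
    qed
    show ?thesis by (rule iffD1[OF smooth_on_cong[OF o eq] sm])
  qed
  ultimately show ?thesis unfolding smooth_manifold_def by (auto simp only: split: prod.splits)
qed

lemma smooth_map_Pair:
  assumes A: "smooth_manifold A" and B: "smooth_manifold B" and C: "smooth_manifold C"
    and f: "smooth_map A B f" and g: "smooth_map A C g"
  shows "smooth_map A (prod_atlas B C) (\<lambda>x. (f x, g x))"
proof (rule smooth_mapI[OF A smooth_manifold_prod[OF B C]])
  fix p
  obtain U \<phi> where U: "(U, \<phi>) \<in> A" "p \<in> U" using chart_at[OF A] .
  obtain V \<psi> where V: "(V, \<psi>) \<in> B" "f p \<in> V" using chart_at[OF B] .
  obtain W \<theta> where W: "(W, \<theta>) \<in> C" "g p \<in> W" using chart_at[OF C] .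
  define N where "N = U \<inter> (f -` V \<inter> g -` W)"
  have o: "open (f -` V \<inter> g -` W)"
    using smooth_map_open_vimage[OF f chartD(1)[OF B V(1)]] smooth_map_open_vimage[OF g chartD(1)[OF C W(1)]] by blast
  have N: "open N" "N \<subseteq> U" "p \<in> N" using o chartD(1)[OF A U(1)] U V W by (auto simp: N_def)
  have oN: "open (\<phi> ` N)" using open_chart_image[OF A U(1) o] by (simp add: N_def)
  have "smooth_on (\<phi> ` N) (\<lambda>x. (\<psi> (f (inv_into U \<phi> x)), \<theta> (g (inv_into U \<phi> x))))"
    using smooth_on_subset[OF smooth_mapD[OF f U(1) V(1)], of "\<phi> ` N"]
      smooth_on_subset[OF smooth_mapD[OF g U(1) W(1)], of "\<phi> ` N"]
    by (intro smooth_on_Pair[OF oN]) (auto simp: N_def)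
  then have "smooth_on (\<phi> ` N) (\<lambda>x. map_prod \<psi> \<theta> (f (inv_into U \<phi> x), g (inv_into U \<phi> x)))" by simp
  note sm = this
  have im: "(\<lambda>x. (f x, g x)) ` N \<subseteq> V \<times> W" by (auto simp: N_def)
  show "\<exists>U \<phi> V \<psi> W. (U, \<phi>) \<in> A \<and> (V, \<psi>) \<in> prod_atlas B C \<and> open W \<and> p \<in> W \<and> W \<subseteq> U \<and>
      (\<lambda>x. (f x, g x)) ` W \<subseteq> V \<and> smooth_on (\<phi> ` W) (\<lambda>x. \<psi> (f (inv_into U \<phi> x), g (inv_into U \<phi> x)))"
    by (rule exI conjI U(1) prod_atlasI[OF V(1) W(1)] N(1) N(3) N(2) im sm)+
qed

lemma smooth_map_fst':
  fixes A :: "('a::{second_countable_topology,t2_space}, 'e::real_inner) atlas"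
    and B :: "('b::{second_countable_topology,t2_space}, 'f::real_inner) atlas"
  assumes A: "smooth_manifold A" and B: "smooth_manifold B"
  shows "smooth_map (prod_atlas A B) A fst"
proof (rule smooth_mapI[OF smooth_manifold_prod[OF A B] A])
  fix p :: "'a \<times> 'b"
  obtain U \<phi> where U: "(U, \<phi>) \<in> A" "fst p \<in> U" using chart_at[OF A] .
  obtain V \<psi> where V: "(V, \<psi>) \<in> B" "snd p \<in> V" using chart_at[OF B] .
  note cU = chartD[OF A U(1)] and cV = chartD[OF B V(1)]
  have o: "open (map_prod \<phi> \<psi> ` (U \<times> V))" using cU(2) cV(2) by (simp add: map_prod_image_Times open_Times)
  have eq: "\<phi> (fst (inv_into (U \<times> V) (map_prod \<phi> \<psi>) z)) = fst z" if "z \<in> map_prod \<phi> \<psi> ` (U \<times> V)" for z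
    using that cU(3,6) cV(3,6) by (auto simp: inv_into_map_prod)
  have "smooth_on (map_prod \<phi> \<psi> ` (U \<times> V)) (\<lambda>z. \<phi> (fst (inv_into (U \<times> V) (map_prod \<phi> \<psi>) z)))"
    by (subst smooth_on_cong[OF o eq]) (auto intro: smooth_on_bounded_linear bounded_linear_fst)
  note sm = this
  have N: "open (U \<times> V)" "p \<in> U \<times> V" "fst ` (U \<times> V) \<subseteq> U" using cU(1) cV(1) U V by (auto simp: open_Times mem_Times_iff)
  show "\<exists>Ua \<phi> V \<psi> W. (Ua, \<phi>) \<in> prod_atlas A B \<and> (V, \<psi>) \<in> A \<and> open W \<and> p \<in> W \<and> W \<subseteq> Ua \<and>
      fst ` W \<subseteq> V \<and> smooth_on (\<phi> ` W) (\<lambda>x. \<psi> (fst (inv_into Ua \<phi> x)))"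
    by (rule exI conjI prod_atlasI[OF U(1) V(1)] U(1) N order_refl sm)+
qed

lemma smooth_map_snd':
  fixes A :: "('a::{second_countable_topology,t2_space}, 'e::real_inner) atlas"
    and B :: "('b::{second_countable_topology,t2_space}, 'f::real_inner) atlas"
  assumes A: "smooth_manifold A" and B: "smooth_manifold B"
  shows "smooth_map (prod_atlas A B) B snd"
proof (rule smooth_mapI[OF smooth_manifold_prod[OF A B] B])
  fix p :: "'a \<times> 'b"
  obtain U \<phi> where U: "(U, \<phi>) \<in> A" "fst p \<in> U" using chart_at[OF A] .
  obtain V \<psi> where V: "(V, \<psi>) \<in> B" "snd p \<in> V" using chart_at[OF B] .
  note cU = chartD[OF A U(1)] and cV = chartD[OF B V(1)]
  have o: "open (map_prod \<phi> \<psi> ` (U \<times> V))" using cU(2) cV(2) by (simp add: map_prod_image_Times open_Times)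
  have eq: "\<psi> (snd (inv_into (U \<times> V) (map_prod \<phi> \<psi>) z)) = snd z" if "z \<in> map_prod \<phi> \<psi> ` (U \<times> V)" for z
    using that cU(3,6) cV(3,6) by (auto simp: inv_into_map_prod)
  have "smooth_on (map_prod \<phi> \<psi> ` (U \<times> V)) (\<lambda>z. \<psi> (snd (inv_into (U \<times> V) (map_prod \<phi> \<psi>) z)))"
    by (subst smooth_on_cong[OF o eq]) (auto intro: smooth_on_bounded_linear bounded_linear_snd)
  note sm = this
  have N: "open (U \<times> V)" "p \<in> U \<times> V" "snd ` (U \<times> V) \<subseteq> V" using cU(1) cV(1) U V by (auto simp: open_Times mem_Times_iff)
  show "\<exists>Ua \<phi> Va \<psi> W. (Ua, \<phi>) \<in> prod_atlas A B \<and> (Va, \<psi>) \<in> B \<and> open W \<and> p \<in> W \<and> W \<subseteq> Ua \<and>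
      snd ` W \<subseteq> Va \<and> smooth_on (\<phi> ` W) (\<lambda>x. \<psi> (snd (inv_into Ua \<phi> x)))"
    by (rule exI conjI prod_atlasI[OF U(1) V(1)] V(1) N order_refl sm)+
qed

lemmas smooth_map_fst = smooth_map_compose[OF _ smooth_manifold_prod _ smooth_map_fst']
lemmas smooth_map_snd = smooth_map_compose[OF _ smooth_manifold_prod _ smooth_map_snd']

lemma smooth_manifold_real: "smooth_manifold real_atlas"
proof -
  have "homeomorphism UNIV UNIV (\<lambda>x::real. x) (inv_into UNIV (\<lambda>x. x))"
    unfolding homeomorphism_def by (auto simp: inv_def intro: continuous_on_id)
  moreover have "\<exists>B::real set. finite B \<and> span B = UNIV"
    using span_Basis[where 'a=real] by (metis finite_Basis)
  moreover have "inv_into UNIV (\<lambda>x::real. x) = (\<lambda>x. x)" by (auto simp: inv_def)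
  ultimately show ?thesis
    unfolding smooth_manifold_def real_atlas_def
    by (simp add: comp_def smooth_on_bounded_linear bounded_linear_ident)
qed

lemma smooth_fun_iff:
  assumes A: "smooth_manifold A"
  shows "smooth_fun A f \<longleftrightarrow> (\<forall>(U, \<phi>)\<in>A. smooth_on (\<phi> ` U) (\<lambda>x. f (inv_into U \<phi> x)))"
proof
  assume f: "smooth_fun A f"
  have R: "(UNIV, \<lambda>x. x) \<in> real_atlas" by (simp add: real_atlas_def)
  show "\<forall>(U, \<phi>)\<in>A. smooth_on (\<phi> ` U) (\<lambda>x. f (inv_into U \<phi> x))"
  proof clarify
    fix U \<phi> assume "(U, \<phi>) \<in> A"
    from smooth_mapD[OF f[unfolded smooth_fun_def] this R]
    show "smooth_on (\<phi> ` U) (\<lambda>x. f (inv_into U \<phi> x))" by simp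
  qed
next
  assume f: "\<forall>(U, \<phi>)\<in>A. smooth_on (\<phi> ` U) (\<lambda>x. f (inv_into U \<phi> x))"
  show "smooth_fun A f" unfolding smooth_fun_def
  proof (rule smooth_mapI[OF A smooth_manifold_real])
    fix p
    obtain U \<phi> where U: "(U, \<phi>) \<in> A" "p \<in> U" using chart_at[OF A] .
    have o: "open U" using chartD(1)[OF A U(1)] .
    have R: "(UNIV, \<lambda>x. x) \<in> real_atlas" by (simp add: real_atlas_def)
    have sm: "smooth_on (\<phi> ` U) (\<lambda>x. (\<lambda>x. x) (f (inv_into U \<phi> x)))" using f U by auto
    show "\<exists>U \<phi> V \<psi> W. (U, \<phi>) \<in> A \<and> (V, \<psi>) \<in> real_atlas \<and> open W \<and> p \<in> W \<and> W \<subseteq> U \<and>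
        f ` W \<subseteq> V \<and> smooth_on (\<phi> ` W) (\<lambda>x. \<psi> (f (inv_into U \<phi> x)))"
      by (rule exI conjI U(1) R o U(2) order_refl subset_UNIV sm)+
  qed
qed

lemma smooth_fun_chart:
  assumes "smooth_manifold A" "smooth_fun A f" "(U, \<phi>) \<in> A"
  shows "smooth_on (\<phi> ` U) (\<lambda>x. f (inv_into U \<phi> x))"
  using assms(2,3) smooth_fun_iff[OF assms(1)] by blast

lemma smooth_fun_const: "smooth_manifold A \<Longrightarrow> smooth_fun A (\<lambda>x. c)"
  by (auto simp: smooth_fun_iff smooth_on_const)

lemma smooth_fun_add:
  "smooth_manifold A \<Longrightarrow> smooth_fun A f \<Longrightarrow> smooth_fun A g \<Longrightarrow> smooth_fun A (\<lambda>x. f x + g x)"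
  by (auto simp: smooth_fun_iff intro!: smooth_on_add dest: chartD(2))

lemma smooth_fun_mult:
  "smooth_manifold A \<Longrightarrow> smooth_fun A f \<Longrightarrow> smooth_fun A g \<Longrightarrow> smooth_fun A (\<lambda>x. f x * g x)"
  by (auto simp: smooth_fun_iff intro!: smooth_on_mult dest: chartD(2))

lemma smooth_fun_cmult:
  assumes "smooth_manifold A" "smooth_fun A f"
  shows "smooth_fun A (\<lambda>x. c * f x)"
  by (rule smooth_fun_mult[OF assms(1) smooth_fun_const[OF assms(1)] assms(2)])

lemma smooth_fun_sum:
  assumes "smooth_manifold A" "\<And>i. i \<in> I \<Longrightarrow> smooth_fun A (f i)"
  shows "smooth_fun A (\<lambda>x. \<Sum>i\<in>I. f i x)"
  using assms(2) by (induction I rule: infinite_finite_induct)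
    (auto intro: smooth_fun_const smooth_fun_add assms(1))

lemma smooth_fun_compose:
  assumes A: "smooth_manifold A" and B: "smooth_manifold B"
    and g: "smooth_fun B g" and f: "smooth_map A B f"
  shows "smooth_fun A (\<lambda>x. g (f x))"
  using smooth_map_compose[OF A B smooth_manifold_real g[unfolded smooth_fun_def] f]
  by (simp add: smooth_fun_def)

section \<open>Tangent vectors as derivations\<close>

abbreviation chart_derivative :: "'a set \<Rightarrow> ('a \<Rightarrow> 'e::real_inner) \<Rightarrow> 'a \<Rightarrow> 'e \<Rightarrow> 'a tvec" where
  "chart_derivative U \<phi> p w f \<equiv> frechet_derivative (\<lambda>x. f (inv_into U \<phi> x)) (at (\<phi> p)) w"

lemma tangent_spaceE:
  assumes "v \<in> tangent_space A p"
  obtains U \<phi> w where "(U, \<phi>) \<in> A" "p \<in> U"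
    "\<And>f. smooth_fun A f \<Longrightarrow> v f = chart_derivative U \<phi> p w f"
    "\<And>f. \<not> smooth_fun A f \<Longrightarrow> v f = 0"
  using assms unfolding tangent_space_def comp_def by fastforce

lemma tangent_spaceI:
  assumes "(U, \<phi>) \<in> A" "p \<in> U"
    "\<And>f. smooth_fun A f \<Longrightarrow> v f = chart_derivative U \<phi> p w f"
    "\<And>f. \<not> smooth_fun A f \<Longrightarrow> v f = 0"
  shows "v \<in> tangent_space A p"
proof -
  have "v = (\<lambda>f. if smooth_fun A f then frechet_derivative (f \<circ> inv_into U \<phi>) (at (\<phi> p)) w else 0)"
    using assms(3,4) by (auto simp: comp_def)
  then show ?thesis using assms(1,2) unfolding tangent_space_def by blast
qed

lemma tangent_not_smooth: "v \<in> tangent_space A p \<Longrightarrow> \<not> smooth_fun A f \<Longrightarrow> v f = 0"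
  by (erule tangent_spaceE) simp

lemma smooth_fun_chart_differentiable:
  assumes "smooth_manifold A" "smooth_fun A f" "(U, \<phi>) \<in> A" "p \<in> U"
  shows "(\<lambda>x. f (inv_into U \<phi> x)) differentiable (at (\<phi> p))"
  using smooth_on_imp_differentiable[OF smooth_fun_chart[OF assms(1-3)]] assms(4) by simp

lemma frechet_derivative_chain:
  assumes "g differentiable (at (f a))" "f differentiable (at a)"
  shows "frechet_derivative (\<lambda>x. g (f x)) (at a) w
       = frechet_derivative g (at (f a)) (frechet_derivative f (at a) w)"
  using frechet_derivative_compose[of f a g] assms by (simp add: comp_def)

lemma frechet_derivative_local:
  assumes "open S" "a \<in> S" "\<And>x. x \<in> S \<Longrightarrow> f x = g x"
  shows "frechet_derivative f (at a) = frechet_derivative g (at a)"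
proof -
  have "(f has_derivative d) (at a) \<longleftrightarrow> (g has_derivative d) (at a)" for d
    using has_derivative_transform_within_open[of f d a UNIV S g]
      has_derivative_transform_within_open[of g d a UNIV S f] assms by auto
  then show ?thesis unfolding frechet_derivative_def by simp
qed

lemma has_derivative_frechet: "f differentiable (at a) \<Longrightarrow> (f has_derivative frechet_derivative f (at a)) (at a)"
  by (simp add: frechet_derivative_works[symmetric])

lemma tangent_const:
  assumes "smooth_manifold A" "v \<in> tangent_space A p"
  shows "v (\<lambda>x. c) = 0"
  using assms(2) by (rule tangent_spaceE) (simp add: smooth_fun_const[OF assms(1)] frechet_derivative_const)

lemma tangent_add:
  assumes A: "smooth_manifold A" and v: "v \<in> tangent_space A p" and f: "smooth_fun A f" and g: "smooth_fun A g"
  shows "v (\<lambda>x. f x + g x) = v f + v g"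
proof -
  obtain U \<phi> w where *: "(U, \<phi>) \<in> A" "p \<in> U"
    "\<And>f. smooth_fun A f \<Longrightarrow> v f = chart_derivative U \<phi> p w f"
    using tangent_spaceE[OF v] by metis
  have "((\<lambda>x. f (inv_into U \<phi> x) + g (inv_into U \<phi> x)) has_derivative
     (\<lambda>h. frechet_derivative (\<lambda>x. f (inv_into U \<phi> x)) (at (\<phi> p)) h +
       frechet_derivative (\<lambda>x. g (inv_into U \<phi> x)) (at (\<phi> p)) h)) (at (\<phi> p))"
    by (intro has_derivative_add has_derivative_frechet smooth_fun_chart_differentiable[OF A f *(1,2)]
        smooth_fun_chart_differentiable[OF A g *(1,2)])
  from fun_cong[OF frechet_derivative_at[OF this], of w] show ?thesis
    using *(3)[OF smooth_fun_add[OF A f g]] *(3)[OF f] *(3)[OF g] by simp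
qed

lemma tangent_mult:
  assumes A: "smooth_manifold A" and v: "v \<in> tangent_space A p" and f: "smooth_fun A f" and g: "smooth_fun A g"
  shows "v (\<lambda>x. f x * g x) = f p * v g + v f * g p"
proof -
  obtain U \<phi> w where *: "(U, \<phi>) \<in> A" "p \<in> U"
    "\<And>f. smooth_fun A f \<Longrightarrow> v f = chart_derivative U \<phi> p w f"
    using tangent_spaceE[OF v] by metis
  have p: "inv_into U \<phi> (\<phi> p) = p" using chartD(6)[OF A *(1,2)] .
  have "((\<lambda>x. f (inv_into U \<phi> x) * g (inv_into U \<phi> x)) has_derivative
     (\<lambda>h. f (inv_into U \<phi> (\<phi> p)) * frechet_derivative (\<lambda>x. g (inv_into U \<phi> x)) (at (\<phi> p)) h +
       frechet_derivative (\<lambda>x. f (inv_into U \<phi> x)) (at (\<phi> p)) h * g (inv_into U \<phi> (\<phi> p)))) (at (\<phi> p))"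
    by (intro has_derivative_mult has_derivative_frechet smooth_fun_chart_differentiable[OF A f *(1,2)]
        smooth_fun_chart_differentiable[OF A g *(1,2)])
  from fun_cong[OF frechet_derivative_at[OF this], of w] show ?thesis
    unfolding p using *(3)[OF smooth_fun_mult[OF A f g]] *(3)[OF f] *(3)[OF g] by simp
qed

lemma tangent_cmult:
  assumes A: "smooth_manifold A" and v: "v \<in> tangent_space A p" and f: "smooth_fun A f"
  shows "v (\<lambda>x. c * f x) = c * v f"
  using tangent_mult[OF A v smooth_fun_const[OF A, of c] f] tangent_const[OF A v, of c] by simp

lemma tangent_sum:
  assumes A: "smooth_manifold A" and v: "v \<in> tangent_space A p" and f: "\<And>i. i \<in> I \<Longrightarrow> smooth_fun A (f i)"
  shows "v (\<lambda>x. \<Sum>i\<in>I. f i x) = (\<Sum>i\<in>I. v (f i))"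
  using f
proof (induction I rule: infinite_finite_induct)
  case (insert i I)
  then show ?case
    using tangent_add[OF A v, of "f i" "\<lambda>x. \<Sum>i\<in>I. f i x"] smooth_fun_sum[OF A, of I f] by simp
qed (simp_all add: tangent_const[OF A v])

lemma tangent_local:
  assumes A: "smooth_manifold A" and v: "v \<in> tangent_space A p" and f: "smooth_fun A f" and g: "smooth_fun A g"
    and W: "open W" "p \<in> W" "\<And>x. x \<in> W \<Longrightarrow> f x = g x"
  shows "v f = v g"
proof -
  obtain U \<phi> w where *: "(U, \<phi>) \<in> A" "p \<in> U"
    "\<And>f. smooth_fun A f \<Longrightarrow> v f = chart_derivative U \<phi> p w f"
    using tangent_spaceE[OF v] by metis
  have "frechet_derivative (\<lambda>x. f (inv_into U \<phi> x)) (at (\<phi> p)) = frechet_derivative (\<lambda>x. g (inv_into U \<phi> x)) (at (\<phi> p))"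
    using *(2) W(2,3) by (intro frechet_derivative_local[OF open_chart_image[OF A *(1) W(1)]])
      (auto simp: chartD(6)[OF A *(1)])
  then show ?thesis using *(3)[OF f] *(3)[OF g] by simp
qed

text \<open>
  This is the chain rule, \<open>w\<close> being the image of the coordinate vector of \<open>v\<close> under the derivative of
  the coordinate expression of \<open>\<Phi>\<close>. The chart at the image is arbitrary, so that \<open>\<Phi> = id\<close> yields the
  change of charts.
\<close>

lemma push_in_chart:
  assumes A: "smooth_manifold A" and B: "smooth_manifold B" and \<Phi>: "smooth_map A B \<Phi>"
    and v: "v \<in> tangent_space A p" and V: "(V, \<psi>) \<in> B" "\<Phi> p \<in> V"
  obtains w where "\<And>f. smooth_fun B f \<Longrightarrow> push B \<Phi> v f = chart_derivative V \<psi> (\<Phi> p) w f"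
proof -
  obtain U \<phi> w where *: "(U, \<phi>) \<in> A" "p \<in> U"
    "\<And>f. smooth_fun A f \<Longrightarrow> v f = chart_derivative U \<phi> p w f"
    using tangent_spaceE[OF v] by metis
  let ?T = "\<lambda>x. \<psi> (\<Phi> (inv_into U \<phi> x))"
  have o: "open (\<phi> ` (U \<inter> \<Phi> -` V))"
    using open_chart_image[OF A *(1) smooth_map_open_vimage[OF \<Phi> chartD(1)[OF B V(1)]]] .
  have T: "?T differentiable (at (\<phi> p))"
    using smooth_on_imp_differentiable[OF smooth_mapD[OF \<Phi> *(1) V(1)]] *(2) V(2) by simp
  have p: "inv_into U \<phi> (\<phi> p) = p" using chartD(6)[OF A *(1,2)] .
  have "push B \<Phi> v f = frechet_derivative (\<lambda>x. f (inv_into V \<psi> x)) (at (\<psi> (\<Phi> p))) (frechet_derivative ?T (at (\<phi> p)) w)"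
    if f: "smooth_fun B f" for f
  proof -
    have "push B \<Phi> v f = frechet_derivative (\<lambda>x. f (\<Phi> (inv_into U \<phi> x))) (at (\<phi> p)) w"
      using f *(3)[OF smooth_fun_compose[OF A B f \<Phi>]] by (simp add: push_def comp_def)
    also have "frechet_derivative (\<lambda>x. f (\<Phi> (inv_into U \<phi> x))) (at (\<phi> p))
        = frechet_derivative (\<lambda>x. (\<lambda>y. f (inv_into V \<psi> y)) (?T x)) (at (\<phi> p))"
      using *(2) V(2) by (intro frechet_derivative_local[OF o]) (auto simp: chartD(6)[OF A *(1)] chartD(6)[OF B V(1)])
    also have "\<dots> w = frechet_derivative (\<lambda>y. f (inv_into V \<psi> y)) (at (?T (\<phi> p))) (frechet_derivative ?T (at (\<phi> p)) w)"
      by (rule frechet_derivative_chain[OF _ T])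
        (use smooth_fun_chart_differentiable[OF B f V] p in simp)
    finally show ?thesis by (simp add: p)
  qed
  then show thesis by (rule that)
qed

lemma push_tangent:
  assumes A: "smooth_manifold A" and B: "smooth_manifold B" and \<Phi>: "smooth_map A B \<Phi>"
    and v: "v \<in> tangent_space A p" and q: "\<Phi> p = q"
  shows "push B \<Phi> v \<in> tangent_space B q"
proof -
  obtain V \<psi> where V: "(V, \<psi>) \<in> B" "\<Phi> p \<in> V" using chart_at[OF B] .
  obtain w where "\<And>f. smooth_fun B f \<Longrightarrow> push B \<Phi> v f = chart_derivative V \<psi> (\<Phi> p) w f"
    using push_in_chart[OF A B \<Phi> v V] by metis
  then show ?thesis using V q by (intro tangent_spaceI[of V \<psi>]) (auto simp: push_def)
qed

lemma tangent_in_chart: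
  assumes A: "smooth_manifold A" and v: "v \<in> tangent_space A p" and V: "(V, \<psi>) \<in> A" "p \<in> V"
  obtains w where "\<And>f. smooth_fun A f \<Longrightarrow> v f = chart_derivative V \<psi> p w f"
proof -
  obtain w where "\<And>f. smooth_fun A f \<Longrightarrow> push A (\<lambda>x. x) v f = chart_derivative V \<psi> p w f"
    using push_in_chart[OF A A smooth_map_id[OF A] v V] by metis
  then show thesis by (intro that[of w]) (simp add: push_def comp_def)
qed

lemma tangent_space_comb:
  assumes A: "smooth_manifold A" and u: "u \<in> tangent_space A p" and v: "v \<in> tangent_space A p"
  shows "(\<lambda>f. a * u f + b * v f) \<in> tangent_space A p"
proof -
  obtain U \<phi> where U: "(U, \<phi>) \<in> A" "p \<in> U" using chart_at[OF A] .
  obtain w where w: "\<And>f. smooth_fun A f \<Longrightarrow> u f = chart_derivative U \<phi> p w f"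
    using tangent_in_chart[OF A u U] by metis
  obtain w' where w': "\<And>f. smooth_fun A f \<Longrightarrow> v f = chart_derivative U \<phi> p w' f"
    using tangent_in_chart[OF A v U] by metis
  show ?thesis
  proof (rule tangent_spaceI[OF U, where w = "a *\<^sub>R w + b *\<^sub>R w'"])
    fix f assume f: "smooth_fun A f"
    have "linear (frechet_derivative (\<lambda>x. f (inv_into U \<phi> x)) (at (\<phi> p)))"
      by (rule linear_frechet_derivative[OF smooth_fun_chart_differentiable[OF A f U]])
    then show "a * u f + b * v f = chart_derivative U \<phi> p (a *\<^sub>R w + b *\<^sub>R w') f"
      using w[OF f] w'[OF f] by (simp add: linear_add linear_cmul)
  next
    fix f assume "\<not> smooth_fun A f"
    then show "a * u f + b * v f = 0" using tangent_not_smooth[OF u] tangent_not_smooth[OF v] by simp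
  qed
qed

lemma tangent_space_zero:
  assumes A: "smooth_manifold A"
  shows "(\<lambda>f. 0) \<in> tangent_space A p"
proof -
  obtain U \<phi> where U: "(U, \<phi>) \<in> A" "p \<in> U" using chart_at[OF A] .
  show ?thesis
  proof (rule tangent_spaceI[OF U, where w = 0])
    fix f assume f: "smooth_fun A f"
    show "0 = chart_derivative U \<phi> p 0 f"
      using linear_frechet_derivative[OF smooth_fun_chart_differentiable[OF A f U]] by (simp add: linear_0)
  qed simp
qed

lemma tangent_space_sum:
  assumes A: "smooth_manifold A" and "finite I" "\<And>i. i \<in> I \<Longrightarrow> v i \<in> tangent_space A p"
  shows "(\<lambda>f. \<Sum>i\<in>I. c i * v i f) \<in> tangent_space A p"
  using assms(2,3)
proof (induction I)
  case empty
  then show ?case by (simp add: tangent_space_zero[OF A])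
next
  case (insert i I)
  then have "(\<lambda>f. c i * v i f + 1 * (\<Sum>i\<in>I. c i * v i f)) \<in> tangent_space A p"
    by (intro tangent_space_comb[OF A]) auto
  then show ?case using insert by simp
qed

lemma smooth_fun_slice1:
  assumes A: "smooth_manifold A" and B: "smooth_manifold B" and F: "smooth_fun (prod_atlas A B) F"
  shows "smooth_fun A (\<lambda>x. F (x, y))"
  by (rule smooth_fun_compose[OF A smooth_manifold_prod[OF A B] F])
    (intro smooth_map_Pair A B smooth_map_id smooth_map_const)

lemma smooth_fun_slice2:
  assumes A: "smooth_manifold A" and B: "smooth_manifold B" and F: "smooth_fun (prod_atlas A B) F"
  shows "smooth_fun B (\<lambda>y. F (x, y))"
  by (rule smooth_fun_compose[OF B smooth_manifold_prod[OF A B] F])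
    (intro smooth_map_Pair A B smooth_map_id smooth_map_const)

lemma smooth_fun_prod_chart:
  assumes A: "smooth_manifold A" and B: "smooth_manifold B" and F: "smooth_fun (prod_atlas A B) F"
    and U: "(U, \<phi>) \<in> A" and V: "(V, \<psi>) \<in> B"
  shows "smooth_on (\<phi> ` U \<times> \<psi> ` V) (\<lambda>z. F (inv_into U \<phi> (fst z), inv_into V \<psi> (snd z)))"
proof -
  have o: "open (\<phi> ` U \<times> \<psi> ` V)" using chartD(2)[OF A U] chartD(2)[OF B V] by (rule open_Times)
  have sm: "smooth_on (\<phi> ` U \<times> \<psi> ` V) (\<lambda>z. F (inv_into (U \<times> V) (map_prod \<phi> \<psi>) z))"
    using smooth_fun_chart[OF smooth_manifold_prod[OF A B] F prod_atlasI[OF U V]]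
    by (simp only: map_prod_image_Times)
  have eq: "F (inv_into (U \<times> V) (map_prod \<phi> \<psi>) z) = F (inv_into U \<phi> (fst z), inv_into V \<psi> (snd z))"
    if "z \<in> \<phi> ` U \<times> \<psi> ` V" for z
    using inv_into_map_prod[OF chartD(3)[OF A U] chartD(3)[OF B V], of "fst z" "snd z"] that by auto
  show ?thesis by (rule iffD1[OF smooth_on_cong[OF o eq] sm])
qed

lemma frechet_derivative_slice:
  assumes "g differentiable (at (a, b))"
  shows "frechet_derivative (\<lambda>x. g (x, b)) (at a) w = frechet_derivative g (at (a, b)) (w, 0)"
    "frechet_derivative (\<lambda>y. g (a, y)) (at b) u = frechet_derivative g (at (a, b)) (0, u)"
proof -
  have "((\<lambda>x. (x, b)) has_derivative (\<lambda>h. (h, 0))) (at a)"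
    by (intro derivative_eq_intros) auto
  from diff_chain_at[OF this has_derivative_frechet[OF assms]]
  show "frechet_derivative (\<lambda>x. g (x, b)) (at a) w = frechet_derivative g (at (a, b)) (w, 0)"
    by (simp add: comp_def frechet_derivative_at[symmetric])
  have "((\<lambda>y. (a, y)) has_derivative (\<lambda>h. (0, h))) (at b)"
    by (intro derivative_eq_intros) auto
  from diff_chain_at[OF this has_derivative_frechet[OF assms]]
  show "frechet_derivative (\<lambda>y. g (a, y)) (at b) u = frechet_derivative g (at (a, b)) (0, u)"
    by (simp add: comp_def frechet_derivative_at[symmetric])
qed

lemma tangent_slice_chart:
  assumes A: "smooth_manifold A" and B: "smooth_manifold B" and F: "smooth_fun (prod_atlas A B) F"
    and U: "(U, \<phi>) \<in> A" "p \<in> U" and V: "(V, \<psi>) \<in> B" "q \<in> V"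
  defines "H \<equiv> \<lambda>z. F (inv_into U \<phi> (fst z), inv_into V \<psi> (snd z))"
  shows "frechet_derivative (\<lambda>x. F (inv_into U \<phi> x, q)) (at (\<phi> p)) w = frechet_derivative H (at (\<phi> p, \<psi> q)) (w, 0)"
    "frechet_derivative (\<lambda>y. F (p, inv_into V \<psi> y)) (at (\<psi> q)) u = frechet_derivative H (at (\<phi> p, \<psi> q)) (0, u)"
proof -
  have "H differentiable (at (\<phi> p, \<psi> q))"
    unfolding H_def using U V
    by (intro smooth_on_imp_differentiable[OF smooth_fun_prod_chart[OF A B F U(1) V(1)]]) auto
  note * = frechet_derivative_slice[OF this]
  show "frechet_derivative (\<lambda>x. F (inv_into U \<phi> x, q)) (at (\<phi> p)) w = frechet_derivative H (at (\<phi> p, \<psi> q)) (w, 0)"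
    using *(1)[of w] chartD(6)[OF B V] by (simp add: H_def)
  show "frechet_derivative (\<lambda>y. F (p, inv_into V \<psi> y)) (at (\<psi> q)) u = frechet_derivative H (at (\<phi> p, \<psi> q)) (0, u)"
    using *(2)[of u] chartD(6)[OF A U] by (simp add: H_def)
qed

text \<open>
  In charts, differentiating the first variable in the direction \<open>w\<close> is differentiating \<open>F\<close> in the constant
  direction \<open>(w, 0)\<close>.
\<close>

lemma smooth_fun_partial:
  assumes A: "smooth_manifold A" and B: "smooth_manifold B" and F: "smooth_fun (prod_atlas A B) F"
    and v: "v \<in> tangent_space A p"
  shows "smooth_fun B (\<lambda>y. v (\<lambda>x. F (x, y)))"
  unfolding smooth_fun_iff[OF B]
proof clarify
  fix V \<psi> assume V: "(V, \<psi>) \<in> B"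
  obtain U \<phi> w where U: "(U, \<phi>) \<in> A" "p \<in> U"
    "\<And>f. smooth_fun A f \<Longrightarrow> v f = chart_derivative U \<phi> p w f"
    using tangent_spaceE[OF v] by metis
  let ?H = "\<lambda>z. F (inv_into U \<phi> (fst z), inv_into V \<psi> (snd z))"
  have o: "open (\<psi> ` V)" "open (\<phi> ` U \<times> \<psi> ` V)"
    using chartD(2)[OF A U(1)] chartD(2)[OF B V] by (auto intro: open_Times)
  have "smooth_on (\<psi> ` V) (\<lambda>y. (\<phi> p, y))"
    by (rule smooth_on_Pair[OF o(1) smooth_on_const smooth_on_bounded_linear[OF bounded_linear_ident]])
  then have "smooth_on (\<psi> ` V) (\<lambda>y. (\<lambda>z. frechet_derivative ?H (at z) (w, 0)) (\<phi> p, y))"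
    by (rule smooth_on_compose[OF finite_dim_prod[OF smooth_manifold_finite_dim[OF A] smooth_manifold_finite_dim[OF B]]
          o _ smooth_on_frechet_derivative[OF smooth_fun_prod_chart[OF A B F U(1) V]]])
      (use U(2) in auto)
  note sm = this
  have eq: "frechet_derivative ?H (at (\<phi> p, y)) (w, 0) = v (\<lambda>x. F (x, inv_into V \<psi> y))" if y: "y \<in> \<psi> ` V" for y
    using tangent_slice_chart(1)[OF A B F U(1,2) V chartD(7)[OF B V y], of w] U(3)[OF smooth_fun_slice1[OF A B F]]
      chartD(8)[OF B V y] by simp
  show "smooth_on (\<psi> ` V) (\<lambda>y. v (\<lambda>x. F (x, inv_into V \<psi> y)))"
    by (rule iffD1[OF smooth_on_cong[OF o(1) eq] sm])
qed

text \<open>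
  In charts both sides are second derivatives of \<open>F\<close> in the directions \<open>(w, 0)\<close> and \<open>(0, t)\<close>.
\<close>

lemma tangent_commute:
  assumes A: "smooth_manifold A" and B: "smooth_manifold B" and F: "smooth_fun (prod_atlas A B) F"
    and v: "v \<in> tangent_space A p" and u: "u \<in> tangent_space B q"
  shows "v (\<lambda>x. u (\<lambda>y. F (x, y))) = u (\<lambda>y. v (\<lambda>x. F (x, y)))"
proof -
  obtain U \<phi> w where U: "(U, \<phi>) \<in> A" "p \<in> U"
    "\<And>f. smooth_fun A f \<Longrightarrow> v f = chart_derivative U \<phi> p w f"
    using tangent_spaceE[OF v] by metis
  obtain V \<psi> t where V: "(V, \<psi>) \<in> B" "q \<in> V"
    "\<And>f. smooth_fun B f \<Longrightarrow> u f = chart_derivative V \<psi> q t f"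
    using tangent_spaceE[OF u] by metis
  have swap: "smooth_fun (prod_atlas B A) (\<lambda>z. F (snd z, fst z))"
    by (rule smooth_fun_compose[OF smooth_manifold_prod[OF B A] smooth_manifold_prod[OF A B] F])
      (intro smooth_map_Pair smooth_manifold_prod A B smooth_map_fst' smooth_map_snd')
  have sv: "smooth_fun B (\<lambda>y. v (\<lambda>x. F (x, y)))" by (rule smooth_fun_partial[OF A B F v])
  have su: "smooth_fun A (\<lambda>x. u (\<lambda>y. F (x, y)))" using smooth_fun_partial[OF B A swap u] by simp
  let ?H = "\<lambda>z. F (inv_into U \<phi> (fst z), inv_into V \<psi> (snd z))"
  have smH: "smooth_on (\<phi> ` U \<times> \<psi> ` V) ?H" by (rule smooth_fun_prod_chart[OF A B F U(1) V(1)])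
  have oU: "open (\<phi> ` U)" and oV: "open (\<psi> ` V)" using chartD(2)[OF A U(1)] chartD(2)[OF B V(1)] .
  have D: "(\<lambda>z. frechet_derivative ?H (at z) s) differentiable (at (\<phi> p, \<psi> q))" for s
    using U(2) V(2) by (intro smooth_on_imp_differentiable[OF smooth_on_frechet_derivative[OF smH]]) auto
  have "v (\<lambda>x. u (\<lambda>y. F (x, y))) = frechet_derivative (\<lambda>x. u (\<lambda>y. F (inv_into U \<phi> x, y))) (at (\<phi> p)) w"
    by (rule U(3)[OF su])
  also have "frechet_derivative (\<lambda>x. u (\<lambda>y. F (inv_into U \<phi> x, y))) (at (\<phi> p))
      = frechet_derivative (\<lambda>x. frechet_derivative ?H (at (x, \<psi> q)) (0, t)) (at (\<phi> p))"
  proof (rule frechet_derivative_local[OF oU])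
    fix x assume x: "x \<in> \<phi> ` U"
    show "u (\<lambda>y. F (inv_into U \<phi> x, y)) = frechet_derivative ?H (at (x, \<psi> q)) (0, t)"
      using tangent_slice_chart(2)[OF A B F U(1) chartD(7)[OF A U(1) x] V(1,2), of t] V(3)[OF smooth_fun_slice2[OF A B F]]
        chartD(8)[OF A U(1) x] by simp
  qed (use U(2) in auto)
  also have "\<dots> w = frechet_derivative (\<lambda>z. frechet_derivative ?H (at z) (0, t)) (at (\<phi> p, \<psi> q)) (w, 0)"
    by (rule frechet_derivative_slice(1)[OF D])
  also have "\<dots> = frechet_derivative (\<lambda>z. frechet_derivative ?H (at z) (w, 0)) (at (\<phi> p, \<psi> q)) (0, t)"
    using U(2) V(2) smH by (intro symmetric_second_derivative[OF open_Times[OF oU oV]]) (auto simp: smooth_on_def)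
  also have "\<dots> = frechet_derivative (\<lambda>y. frechet_derivative ?H (at (\<phi> p, y)) (w, 0)) (at (\<psi> q)) t"
    by (rule frechet_derivative_slice(2)[OF D, symmetric])
  also have "frechet_derivative (\<lambda>y. frechet_derivative ?H (at (\<phi> p, y)) (w, 0)) (at (\<psi> q))
      = frechet_derivative (\<lambda>y. v (\<lambda>x. F (x, inv_into V \<psi> y))) (at (\<psi> q))"
  proof (rule frechet_derivative_local[OF oV])
    fix y assume y: "y \<in> \<psi> ` V"
    show "frechet_derivative ?H (at (\<phi> p, y)) (w, 0) = v (\<lambda>x. F (x, inv_into V \<psi> y))"
      using tangent_slice_chart(1)[OF A B F U(1,2) V(1) chartD(7)[OF B V(1) y], of w] U(3)[OF smooth_fun_slice1[OF A B F]]
        chartD(8)[OF B V(1) y] by simp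
  qed (use V(2) in auto)
  also have "\<dots> t = u (\<lambda>y. v (\<lambda>x. F (x, y)))" by (rule V(3)[OF sv, symmetric])
  finally show ?thesis .
qed

text \<open>
  The chain rule along the diagonal, from \<open>(w, w) = (w, 0) + (0, w)\<close>. For group-valued expressions it plays
  the role of the product rule: the occurrences of the variable are differentiated one at a time.
\<close>

lemma tangent_diagonal:
  assumes A: "smooth_manifold A" and F: "smooth_fun (prod_atlas A A) F" and v: "v \<in> tangent_space A p"
  shows "v (\<lambda>x. F (x, x)) = v (\<lambda>x. F (x, p)) + v (\<lambda>x. F (p, x))"
proof -
  obtain U \<phi> w where U: "(U, \<phi>) \<in> A" "p \<in> U"
    "\<And>f. smooth_fun A f \<Longrightarrow> v f = chart_derivative U \<phi> p w f"
    using tangent_spaceE[OF v] by metis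
  let ?H = "\<lambda>z. F (inv_into U \<phi> (fst z), inv_into U \<phi> (snd z))"
  have D: "?H differentiable (at (\<phi> p, \<phi> p))"
    using U by (intro smooth_on_imp_differentiable[OF smooth_fun_prod_chart[OF A A F U(1) U(1)]]) auto
  have dg: "smooth_fun A (\<lambda>x. F (x, x))"
    by (rule smooth_fun_compose[OF A smooth_manifold_prod[OF A A] F])
      (intro smooth_map_Pair A smooth_map_id)
  have "((\<lambda>x. (x, x)) has_derivative (\<lambda>h. (h, h))) (at (\<phi> p))"
    by (intro derivative_eq_intros) auto
  from diff_chain_at[OF this has_derivative_frechet[OF D]]
  have "v (\<lambda>x. F (x, x)) = frechet_derivative ?H (at (\<phi> p, \<phi> p)) (w, w)"
    using U(3)[OF dg] by (simp add: comp_def frechet_derivative_at[symmetric])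
  also have "(w, w) = (w, 0) + (0, w)" by simp
  also have "frechet_derivative ?H (at (\<phi> p, \<phi> p)) \<dots>
      = frechet_derivative ?H (at (\<phi> p, \<phi> p)) (w, 0) + frechet_derivative ?H (at (\<phi> p, \<phi> p)) (0, w)"
    by (rule linear_add[OF linear_frechet_derivative[OF D]])
  finally show ?thesis
    using tangent_slice_chart[OF A A F U(1,2) U(1,2)] U(3)[OF smooth_fun_slice1[OF A A F]]
      U(3)[OF smooth_fun_slice2[OF A A F]] by simp
qed

text \<open>
  In a chart the total derivative vanishes on a ball, so \<open>f\<close> is locally constant.
\<close>

lemma constant_if_tangent_zero:
  fixes A :: "('a::{second_countable_topology,t2_space}, 'e::real_inner) atlas"
  assumes A: "smooth_manifold A" and conn: "connected (UNIV :: 'a set)" and f: "smooth_fun A f"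
    and zero: "\<And>p v. v \<in> tangent_space A p \<Longrightarrow> v f = 0"
  shows "f p = f q"
proof (rule connected_local_const[OF conn UNIV_I UNIV_I], clarify)
  fix a :: 'a
  obtain U \<phi> where U: "(U, \<phi>) \<in> A" "a \<in> U" using chart_at[OF A] .
  let ?f = "\<lambda>x. f (inv_into U \<phi> x)"
  have "open (\<phi> ` U)" "\<phi> a \<in> \<phi> ` U" using chartD(2)[OF A U(1)] U(2) by auto
  then obtain r where r: "r > 0" "ball (\<phi> a) r \<subseteq> \<phi> ` U" using openE by blast
  have "(?f has_derivative (\<lambda>h. 0)) (at x)" if x: "x \<in> \<phi> ` U" for x
  proof -
    have xU: "inv_into U \<phi> x \<in> U" "\<phi> (inv_into U \<phi> x) = x" using chartD(7,8)[OF A U(1) x] .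
    have d: "?f differentiable (at x)" using smooth_fun_chart_differentiable[OF A f U(1) xU(1)] xU(2) by simp
    have "frechet_derivative ?f (at x) w = 0" for w
    proof -
      have "(\<lambda>g. if smooth_fun A g then frechet_derivative (\<lambda>x. g (inv_into U \<phi> x)) (at (\<phi> (inv_into U \<phi> x))) w else 0)
          \<in> tangent_space A (inv_into U \<phi> x)"
        using U(1) xU(1) by (rule tangent_spaceI[where w = w]) auto
      from zero[OF this] show ?thesis using f xU(2) by simp
    qed
    then have "frechet_derivative ?f (at x) = (\<lambda>h. 0)" by (rule ext)
    then show ?thesis using has_derivative_frechet[OF d] by simp
  qed
  then have "\<And>x. x \<in> ball (\<phi> a) r \<Longrightarrow> (?f has_derivative (\<lambda>h. 0)) (at x within ball (\<phi> a) r)"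
    using r(2) has_derivative_at_withinI by blast
  then have "\<exists>c. \<forall>x\<in>ball (\<phi> a) r. ?f x = c"
    by (intro has_derivative_zero_constant convex_ball) auto
  then obtain c where c: "\<And>x. x \<in> ball (\<phi> a) r \<Longrightarrow> ?f x = c" by blast
  define W where "W = U \<inter> \<phi> -` ball (\<phi> a) r"
  have oW: "open W"
    unfolding W_def using continuous_on_open_vimage[OF chartD(1)[OF A U(1)]] chartD(4)[OF A U(1)]
    by (metis Int_commute open_ball)
  have "f b = c" if "b \<in> W" for b
    using that c[of "\<phi> b"] chartD(6)[OF A U(1)] by (auto simp: W_def)
  moreover have "a \<in> W" using U(2) r(1) by (simp add: W_def)
  ultimately show "eventually (\<lambda>b. f a = f b) (at a)"
    unfolding eventually_at_topological using oW by (intro exI[of _ W]) auto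
qed

section \<open>The Lie algebra and its invariant form\<close>

text \<open>
  Induction on \<open>I\<close>. Some \<open>f\<close> must violate \<open>e k f = (\<Sum>j\<in>I. e k (g j) * e j f)\<close>, for otherwise \<open>e k\<close> would
  depend on the other functionals. Subtracting its components leaves a function that is killed by the old
  functionals but not by \<open>e k\<close>; normalised, it is the new dual function and corrects the old ones.
\<close>

lemma dual_functions_exist:
  fixes e :: "'i \<Rightarrow> ('x \<Rightarrow> real) \<Rightarrow> real" and S :: "('x \<Rightarrow> real) set"
  assumes "finite I"
    and S_add: "\<And>f g. f \<in> S \<Longrightarrow> g \<in> S \<Longrightarrow> (\<lambda>x. f x + g x) \<in> S"
    and S_cmult: "\<And>c f. f \<in> S \<Longrightarrow> (\<lambda>x. c * f x) \<in> S"
    and e_add: "\<And>i f g. i \<in> I \<Longrightarrow> f \<in> S \<Longrightarrow> g \<in> S \<Longrightarrow> e i (\<lambda>x. f x + g x) = e i f + e i g"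
    and e_cmult: "\<And>i c f. i \<in> I \<Longrightarrow> f \<in> S \<Longrightarrow> e i (\<lambda>x. c * f x) = c * e i f"
    and indep: "\<And>c. (\<And>f. f \<in> S \<Longrightarrow> (\<Sum>i\<in>I. c i * e i f) = 0) \<Longrightarrow> (\<And>i. i \<in> I \<Longrightarrow> c i = 0)"
  shows "\<exists>g. \<forall>i\<in>I. g i \<in> S \<and> (\<forall>j\<in>I. e j (g i) = (if i = j then 1 else 0))"
  using assms(1) e_add e_cmult indep
proof (induction I)
  case empty
  then show ?case by simp
next
  case (insert k I)
  have "\<exists>g. \<forall>i\<in>I. g i \<in> S \<and> (\<forall>j\<in>I. e j (g i) = (if i = j then 1 else 0))"
  proof (rule insert.IH)
    fix c i assume c: "\<And>f. f \<in> S \<Longrightarrow> (\<Sum>i\<in>I. c i * e i f) = 0" and i: "i \<in> I"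
    have "(if i = k then 0 else c i) = 0"
    proof (rule insert.prems(3))
      fix f assume "f \<in> S"
      have "(\<Sum>i\<in>insert k I. (if i = k then 0 else c i) * e i f) = (\<Sum>i\<in>I. c i * e i f)"
        using insert.hyps by (simp add: sum.insert) (rule sum.cong, auto)
      then show "(\<Sum>i\<in>insert k I. (if i = k then 0 else c i) * e i f) = 0" using c[OF \<open>f \<in> S\<close>] by simp
    qed (use i in simp)
    then show "c i = 0" using insert.hyps i by (auto split: if_splits)
  qed (use insert.prems in auto)
  then obtain g where g: "\<And>i. i \<in> I \<Longrightarrow> g i \<in> S" "\<And>i j. i \<in> I \<Longrightarrow> j \<in> I \<Longrightarrow> e j (g i) = (if i = j then 1 else 0)"
    by blast
  have "\<exists>f\<in>S. e k f \<noteq> (\<Sum>j\<in>I. e k (g j) * e j f)"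
  proof (rule ccontr)
    assume "\<not> ?thesis"
    then have *: "e k f = (\<Sum>j\<in>I. e k (g j) * e j f)" if "f \<in> S" for f using that by blast
    define c where "c j = (if j = k then 1 else - e k (g j))" for j
    have "c k = 0"
    proof (rule insert.prems(3))
      fix f assume "f \<in> S"
      have "(\<Sum>i\<in>insert k I. c i * e i f) = e k f + (\<Sum>i\<in>I. c i * e i f)"
        using insert.hyps by (simp add: c_def)
      also have "(\<Sum>i\<in>I. c i * e i f) = - (\<Sum>j\<in>I. e k (g j) * e j f)"
        unfolding sum_negf[symmetric] using insert.hyps by (intro sum.cong) (auto simp: c_def)
      finally show "(\<Sum>i\<in>insert k I. c i * e i f) = 0" using *[OF \<open>f \<in> S\<close>] by simp
    qed simp
    then show False by (simp add: c_def)
  qed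
  then obtain f where f: "f \<in> S" "e k f \<noteq> (\<Sum>j\<in>I. e k (g j) * e j f)" by blast
  have S0: "(\<lambda>x. 0) \<in> S" using S_cmult[OF f(1), of 0] by simp
  have lin: "(\<lambda>x. \<Sum>j\<in>J. d j * g j x) \<in> S \<and>
      (\<forall>i\<in>insert k I. e i (\<lambda>x. \<Sum>j\<in>J. d j * g j x) = (\<Sum>j\<in>J. d j * e i (g j)))"
    if "finite J" "J \<subseteq> I" for J d
    using that
  proof (induction J)
    case empty
    then show ?case using S0 insert.prems(2)[OF _ S0, of _ 0] by auto
  next
    case (insert j J)
    then have gj: "g j \<in> S" using g by auto
    show ?case using insert gj S_add[OF S_cmult[OF gj, of "d j"]]
        \<open>\<And>i f g. i \<in> insert k I \<Longrightarrow> f \<in> S \<Longrightarrow> g \<in> S \<Longrightarrow> e i (\<lambda>x. f x + g x) = e i f + e i g\<close>[OF _ S_cmult[OF gj, of "d j"]]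
        \<open>\<And>i c f. i \<in> insert k I \<Longrightarrow> f \<in> S \<Longrightarrow> e i (\<lambda>x. c * f x) = c * e i f\<close>[OF _ gj] by auto
  qed
  define h where "h = (\<lambda>x. f x + (\<Sum>j\<in>I. - e j f * g j x))"
  have hS: "h \<in> S" unfolding h_def by (rule S_add[OF f(1) conjunct1[OF lin[OF insert.hyps(1) order_refl]]])
  have eh: "e i h = e i f - (\<Sum>j\<in>I. e j f * e i (g j))" if "i \<in> insert k I" for i
  proof -
    note l = lin[OF insert.hyps(1) order_refl, of "\<lambda>j. - e j f"]
    show ?thesis unfolding h_def insert.prems(1)[OF that f(1) conjunct1[OF l]]
      using bspec[OF conjunct2[OF l] that] by (simp add: sum_negf)
  qed
  have eh0: "e i h = 0" if "i \<in> I" for i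
  proof -
    have "(\<Sum>j\<in>I. e j f * e i (g j)) = (\<Sum>j\<in>I. if j = i then e i f else 0)"
      using that g(2) by (intro sum.cong) auto
    then show ?thesis using eh that insert.hyps(1) by simp
  qed
  have ehk: "e k h \<noteq> 0" using f(2) eh[of k] by (simp add: mult.commute)
  define gk where "gk = (\<lambda>x. (1 / e k h) * h x)"
  have gkS: "gk \<in> S" unfolding gk_def by (rule S_cmult[OF hS])
  have egk: "e i gk = (if i = k then 1 else 0)" if "i \<in> insert k I" for i
    unfolding gk_def using insert.prems(2)[OF that hS, of "1 / e k h"] that eh0 ehk by auto
  define g' where "g' i = (if i = k then gk else (\<lambda>x. g i x + (- e k (g i)) * gk x))" for i
  have "g' i \<in> S" if "i \<in> insert k I" for i
    using that gkS S_add[OF g(1) S_cmult[OF gkS], of i "- e k (g i)"] by (cases "i = k") (simp_all add: g'_def)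
  moreover have "e j (g' i) = (if i = j then 1 else 0)" if ij: "i \<in> insert k I" "j \<in> insert k I" for i j
  proof (cases "i = k")
    case True
    then show ?thesis using egk[OF ij(2)] by (auto simp: g'_def)
  next
    case False
    then have i: "i \<in> I" using ij by simp
    have "e j (g' i) = e j (g i) + (- e k (g i)) * e j gk"
      unfolding g'_def if_not_P[OF False] insert.prems(1)[OF ij(2) g(1)[OF i] S_cmult[OF gkS, of "- e k (g i)"]]
        insert.prems(2)[OF ij(2) gkS, of "- e k (g i)"] by (rule refl)
    then show ?thesis using egk[OF ij(2)] g(2)[OF i, of j] ij False by auto
  qed
  ultimately show ?case by (intro exI[of _ g'] ballI conjI) auto
qed

text \<open>
  Exchanging any two summation indices, here the last one with each of the others.
\<close>

lemma sum4_reorder: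
  fixes I :: "'i set" and F :: "'i \<Rightarrow> 'i \<Rightarrow> 'i \<Rightarrow> 'i \<Rightarrow> real"
  defines "\<S> \<equiv> \<lambda>F. \<Sum>i\<in>I. \<Sum>j\<in>I. \<Sum>k\<in>I. \<Sum>l\<in>I. (F i j k l :: real)"
  shows "\<S> F = \<S> (\<lambda>i j k l. F l j k i)" "\<S> F = \<S> (\<lambda>i j k l. F i l k j)" "\<S> F = \<S> (\<lambda>i j k l. F i j l k)"
proof -
  have s34: "\<S> F = \<S> (\<lambda>i j k l. F i j l k)" and s23: "\<S> F = \<S> (\<lambda>i j k l. F i k j l)" for F
    unfolding \<S>_def by (intro sum.cong refl sum.swap)+
  have s12: "\<S> F = \<S> (\<lambda>i j k l. F j i k l)" for F
    unfolding \<S>_def by (rule sum.swap)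
  have s24: "\<S> F = \<S> (\<lambda>i j k l. F i l k j)" for F
    by (subst s23, subst s34, subst s23) (rule refl)
  show "\<S> F = \<S> (\<lambda>i j k l. F l j k i)"
    by (subst s12, subst s24, subst s12) (rule refl)
  show "\<S> F = \<S> (\<lambda>i j k l. F i l k j)" "\<S> F = \<S> (\<lambda>i j k l. F i j l k)"
    by (rule s24, rule s34)
qed

text \<open>
  The connectedness of the group is what turns infinitesimal invariance into \<open>Ad\<close>-invariance.
\<close>

locale orthonormal_lie_group =
  fixes G :: "('a::{second_countable_topology,t2_space}, 'b) monoid_scheme" (structure)
    and A :: "('a, 'e::real_inner) atlas"
    and K :: "'a tvec \<Rightarrow> 'a tvec \<Rightarrow> real"
    and n :: nat
    and e :: "nat \<Rightarrow> 'a tvec"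
  assumes lie: "lie_group G A"
    and conn: "connected (UNIV :: 'a set)"
    and K_form: "sym_bilinear_form (lie_alg G A) K"
    and K_inv: "invariant_form G A K"
    and basis: "orthonormal_basis_of (lie_alg G A) K n e"
begin

abbreviation "I \<equiv> {1..n}"

lemma grp: "group G" and carrier [simp]: "carrier G = UNIV" and A: "smooth_manifold A"
  using lie by (simp_all add: lie_group_def)

sublocale group G by (rule grp)

abbreviation "A2 \<equiv> prod_atlas A A"

lemma A2: "smooth_manifold A2"
  by (rule smooth_manifold_prod[OF A A])

lemma inv_mult [simp]: "inv (x \<otimes> y) = inv y \<otimes> inv x"
  by (simp add: inv_mult_group)

lemma cancel [simp]: "inv x \<otimes> (x \<otimes> y) = y" "x \<otimes> (inv x \<otimes> y) = y"
  by (simp_all add: m_assoc[symmetric])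

lemma assoc: "x \<otimes> y \<otimes> z = x \<otimes> (y \<otimes> z)"
  by (simp add: m_assoc)

lemma smooth_map_mult:
  assumes "smooth_manifold B" "smooth_map B A u" "smooth_map B A v"
  shows "smooth_map B A (\<lambda>x. u x \<otimes> v x)"
proof -
  have "smooth_map A2 A (\<lambda>x. fst x \<otimes> snd x)"
    using lie by (simp add: lie_group_def case_prod_unfold)
  from smooth_map_compose[OF assms(1) A2 A this smooth_map_Pair[OF assms(1) A A assms(2,3)]]
  show ?thesis by simp
qed

lemma smooth_map_inv:
  assumes "smooth_manifold B" "smooth_map B A u"
  shows "smooth_map B A (\<lambda>x. inv (u x))"
  using smooth_map_compose[OF assms(1) A A _ assms(2)] lie by (simp add: lie_group_def)

text \<open>
  The premises are rotated so that the component maps are treated first: they determine the atlas of an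
  intermediate product before it has to be shown to be a manifold.
\<close>

lemmas smooth_maps = smooth_map_Pair[rotated 3] smooth_map_mult[rotated 1] smooth_map_inv[rotated 1]
  smooth_map_fst[rotated 6] smooth_map_snd[rotated 6] smooth_map_id smooth_map_const A smooth_manifold_prod

lemmas smooth_pull = smooth_fun_compose[rotated 2]

lemma e_in: "i \<in> I \<Longrightarrow> e i \<in> lie_alg G A"
  using basis by (simp add: orthonormal_basis_of_def)

lemma lie_alg_expand:
  assumes "v \<in> lie_alg G A"
  obtains c where "\<And>f. v f = (\<Sum>i\<in>I. c i * e i f)"
  using basis assms unfolding orthonormal_basis_of_def by metis

lemma basis_independent:
  assumes "\<And>f. smooth_fun A f \<Longrightarrow> (\<Sum>i\<in>I. c i * e i f) = 0" "i \<in> I"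
  shows "c i = 0"
proof -
  have "(\<Sum>i\<in>I. c i * e i f) = 0" for f
    using assms(1) tangent_not_smooth[OF e_in] by (cases "smooth_fun A f") auto
  then have "(\<lambda>f. \<Sum>i\<in>I. c i * e i f) = (\<lambda>_. 0)" by auto
  then show ?thesis using basis assms(2) unfolding orthonormal_basis_of_def by blast
qed

text \<open>
  Dual functions replace coordinates on the Lie algebra: a vector is determined, linearly, by its values on
  finitely many fixed smooth functions, so derivatives of families of vectors can be computed without charts.
\<close>

lemma dual_functions:
  obtains g where "\<And>j. j \<in> I \<Longrightarrow> smooth_fun A (g j)"
    "\<And>v f. v \<in> lie_alg G A \<Longrightarrow> v f = (\<Sum>j\<in>I. v (g j) * e j f)"
proof -
  have "\<exists>g. \<forall>i\<in>I. g i \<in> {f. smooth_fun A f} \<and> (\<forall>j\<in>I. e j (g i) = (if i = j then 1 else 0))"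
  proof (rule dual_functions_exist)
    fix c i assume "\<And>f. f \<in> {f. smooth_fun A f} \<Longrightarrow> (\<Sum>i\<in>I. c i * e i f) = 0" "i \<in> I"
    then show "c i = 0" using basis_independent[of c i] by simp
  qed (auto intro: smooth_fun_add[OF A] smooth_fun_cmult[OF A] tangent_add[OF A e_in] tangent_cmult[OF A e_in])
  then obtain g where g: "\<And>i. i \<in> I \<Longrightarrow> smooth_fun A (g i)"
    "\<And>i j. i \<in> I \<Longrightarrow> j \<in> I \<Longrightarrow> e j (g i) = (if i = j then 1 else 0)" by blast
  have "v f = (\<Sum>j\<in>I. v (g j) * e j f)" if v: "v \<in> lie_alg G A" for v f
  proof -
    obtain c where c: "\<And>f. v f = (\<Sum>i\<in>I. c i * e i f)" using lie_alg_expand[OF v] by metis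
    have "v (g j) = c j" if "j \<in> I" for j
    proof -
      have "v (g j) = (\<Sum>i\<in>I. if i = j then c j else 0)"
        unfolding c using g(2)[OF that] by (intro sum.cong) auto
      then show ?thesis using that by simp
    qed
    then show ?thesis unfolding c by (intro sum.cong) auto
  qed
  from that[OF g(1) this] show thesis .
qed

lemma tangent_inverse:
  assumes u: "u \<in> lie_alg G A" and f: "smooth_fun A f"
  shows "u (\<lambda>g. f (inv g)) = - u f"
proof -
  have "smooth_fun A2 (\<lambda>x. f (fst x \<otimes> inv (snd x)))"
    by (rule smooth_pull[OF f]) (rule smooth_maps)+
  from tangent_diagonal[OF A this u] show ?thesis
    by (simp add: tangent_const[OF A u])
qed

text \<open>
  The commutator of right-invariant fields differentiates \<open>f (h \<otimes> g)\<close> in both orders; exchanging the two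
  derivatives in the second term gives a formula in which \<open>u\<close> always differentiates \<open>g\<close>.
\<close>

lemma lie_bracket_smooth:
  assumes u: "u \<in> lie_alg G A" and v: "v \<in> lie_alg G A" and f: "smooth_fun A f"
  shows "lie_bracket G A u v f = u (\<lambda>g. v (\<lambda>h. f (h \<otimes> g))) - u (\<lambda>g. v (\<lambda>h. f (g \<otimes> h)))"
proof -
  have s: "smooth_fun A2 (\<lambda>x. f (fst x \<otimes> snd x))"
    by (rule smooth_pull[OF f]) (rule smooth_maps)+
  have s1: "smooth_fun A (\<lambda>g. w (\<lambda>h. f (h \<otimes> g)))" if "w \<in> lie_alg G A" for w
    using smooth_fun_partial[OF A A s that] by simp
  have "lie_bracket G A u v f = u (\<lambda>g. v (\<lambda>h. f (h \<otimes> g))) - v (\<lambda>g. u (\<lambda>h. f (h \<otimes> g)))"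
    using f s1[OF u] s1[OF v] by (simp add: lie_bracket_def right_field_def push_def comp_def)
  also have "v (\<lambda>g. u (\<lambda>h. f (h \<otimes> g))) = u (\<lambda>g. v (\<lambda>h. f (g \<otimes> h)))"
    using tangent_commute[OF A A s u v] by simp
  finally show ?thesis .
qed

lemma smooth_Ad:
  assumes v: "v \<in> lie_alg G A" and f: "smooth_fun A f"
  shows "smooth_fun A (\<lambda>g. v (\<lambda>h. f (g \<otimes> h \<otimes> inv g)))"
proof -
  have "smooth_fun A2 (\<lambda>x. f (snd x \<otimes> fst x \<otimes> inv (snd x)))"
    by (rule smooth_pull[OF f]) (rule smooth_maps)+
  from smooth_fun_partial[OF A A this v] show ?thesis by simp
qed

text \<open>
  Product rule for the two occurrences of \<open>g\<close> in \<open>g \<otimes> h \<otimes> inv g\<close>. The sign reflects that the bracket comes from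
  right-invariant fields.
\<close>

lemma derivative_Ad:
  assumes u: "u \<in> lie_alg G A" and v: "v \<in> lie_alg G A" and f: "smooth_fun A f"
  shows "u (\<lambda>g. v (\<lambda>h. f (g \<otimes> h \<otimes> inv g))) = - lie_bracket G A u v f"
proof -
  have "smooth_fun (prod_atlas A A2) (\<lambda>x. f (fst (snd x) \<otimes> fst x \<otimes> inv (snd (snd x))))"
    by (rule smooth_pull[OF f]) (rule smooth_maps)+
  from smooth_fun_partial[OF A A2 this v]
  have "smooth_fun A2 (\<lambda>y. v (\<lambda>h. f (fst y \<otimes> h \<otimes> inv (snd y))))" by simp
  from tangent_diagonal[OF A this u]
  have "u (\<lambda>g. v (\<lambda>h. f (g \<otimes> h \<otimes> inv g))) = u (\<lambda>g. v (\<lambda>h. f (g \<otimes> h))) + u (\<lambda>g. v (\<lambda>h. f (h \<otimes> inv g)))"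
    by simp
  also have "u (\<lambda>g. v (\<lambda>h. f (h \<otimes> inv g))) = - u (\<lambda>g. v (\<lambda>h. f (h \<otimes> g)))"
  proof -
    have "smooth_fun A2 (\<lambda>x. f (fst x \<otimes> snd x))"
      by (rule smooth_pull[OF f]) (rule smooth_maps)+
    from smooth_fun_partial[OF A A this v] have "smooth_fun A (\<lambda>g. v (\<lambda>h. f (h \<otimes> g)))" by simp
    from tangent_inverse[OF u this] show ?thesis by simp
  qed
  finally show ?thesis using lie_bracket_smooth[OF u v f] by simp
qed

lemma Ad_in:
  assumes v: "v \<in> lie_alg G A"
  shows "push A (\<lambda>h. g \<otimes> h \<otimes> inv g) v \<in> lie_alg G A"
  by (rule push_tangent[OF A A _ v]) ((rule smooth_maps)+, simp)

text \<open>
  Up to sign, \<open>[u, v]\<close> is the derivative of \<open>Ad g v\<close> at the unit along \<open>u\<close>. All \<open>Ad g v\<close> lie in the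
  finite-dimensional Lie algebra; expanding them by dual functions before differentiating shows that the
  derivative is again a combination of the \<open>e j\<close>.
\<close>

lemma lie_bracket_in:
  assumes u: "u \<in> lie_alg G A" and v: "v \<in> lie_alg G A"
  shows "lie_bracket G A u v \<in> lie_alg G A"
proof -
  obtain g where g: "\<And>j. j \<in> I \<Longrightarrow> smooth_fun A (g j)"
    "\<And>v f. v \<in> lie_alg G A \<Longrightarrow> v f = (\<Sum>j\<in>I. v (g j) * e j f)" using dual_functions by metis
  have "lie_bracket G A u v f = (\<Sum>j\<in>I. lie_bracket G A u v (g j) * e j f)" for f
  proof (cases "smooth_fun A f")
    case True
    have "v (\<lambda>h. f (x \<otimes> h \<otimes> inv x)) = (\<Sum>j\<in>I. e j f * v (\<lambda>h. g j (x \<otimes> h \<otimes> inv x)))" for x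
      using g(2)[OF Ad_in[OF v, of x], of f] True g(1) by (simp add: push_def comp_def mult.commute)
    then have "u (\<lambda>x. v (\<lambda>h. f (x \<otimes> h \<otimes> inv x))) = u (\<lambda>x. \<Sum>j\<in>I. e j f * v (\<lambda>h. g j (x \<otimes> h \<otimes> inv x)))" by simp
    also have "\<dots> = (\<Sum>j\<in>I. e j f * u (\<lambda>x. v (\<lambda>h. g j (x \<otimes> h \<otimes> inv x))))"
      using g(1) by (subst tangent_sum[OF A u])
        (auto intro!: sum.cong tangent_cmult[OF A u] smooth_fun_cmult[OF A] smooth_Ad[OF v])
    finally have "- lie_bracket G A u v f = (\<Sum>j\<in>I. e j f * - lie_bracket G A u v (g j))"
      using derivative_Ad[OF u v True] derivative_Ad[OF u v g(1)] by simp
    then show ?thesis by (simp add: sum_negf mult.commute)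
  next
    case False
    then show ?thesis using tangent_not_smooth[OF e_in False] by (simp add: lie_bracket_def)
  qed
  then have "lie_bracket G A u v = (\<lambda>f. \<Sum>j\<in>I. lie_bracket G A u v (g j) * e j f)" by (rule ext)
  moreover have "(\<lambda>f. \<Sum>j\<in>I. lie_bracket G A u v (g j) * e j f) \<in> lie_alg G A"
    by (rule tangent_space_sum[OF A]) (auto intro: e_in)
  ultimately show ?thesis by metis
qed

text \<open>
  The structure constants, \<open>[e j, e k] = (\<Sum>i\<in>I. c i j k * e i)\<close>; invariance of \<open>K\<close> makes them totally
  antisymmetric.
\<close>

definition c where "c i j k = K (e i) (lie_bracket G A (e j) (e k))"

abbreviation "cubic x y z \<equiv> \<Sum>i\<in>I. \<Sum>j\<in>I. \<Sum>k\<in>I. c i j k * (x i * y j * z k)"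

lemma K_sym: "u \<in> lie_alg G A \<Longrightarrow> v \<in> lie_alg G A \<Longrightarrow> K u v = K v u"
  using K_form by (simp add: sym_bilinear_form_def)

lemma K_lin: "u \<in> lie_alg G A \<Longrightarrow> v \<in> lie_alg G A \<Longrightarrow> w \<in> lie_alg G A \<Longrightarrow>
    K (\<lambda>f. a * u f + b * v f) w = a * K u w + b * K v w"
  using K_form by (simp add: sym_bilinear_form_def)

lemma K_sum:
  assumes "finite J" "J \<subseteq> I" "w \<in> lie_alg G A"
  shows "K (\<lambda>f. \<Sum>j\<in>J. d j * e j f) w = (\<Sum>j\<in>J. d j * K (e j) w)"
  using assms(1,2)
proof (induction J)
  case empty
  then show ?case using K_lin[OF assms(3,3,3), of 0 0] by simp
next
  case (insert j J)
  have "(\<lambda>f. \<Sum>j\<in>J. d j * e j f) \<in> lie_alg G A"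
    using insert by (intro tangent_space_sum[OF A] e_in) auto
  then show ?case
    using K_lin[OF e_in _ assms(3), of j "\<lambda>f. \<Sum>j\<in>J. d j * e j f" "d j" 1] insert by auto
qed

lemma expand_orthonormal:
  assumes v: "v \<in> lie_alg G A"
  shows "v f = (\<Sum>i\<in>I. K (e i) v * e i f)"
proof -
  obtain d where d: "\<And>f. v f = (\<Sum>i\<in>I. d i * e i f)" using lie_alg_expand[OF v] by metis
  have "K (e i) v = d i" if i: "i \<in> I" for i
  proof -
    have "v = (\<lambda>f. \<Sum>i\<in>I. d i * e i f)" using d by (rule ext)
    then have "K (e i) v = (\<Sum>j\<in>I. d j * K (e j) (e i))"
      using K_sym[OF e_in[OF i] v] K_sum[OF _ order_refl e_in[OF i], of d] by simp
    also have "\<dots> = (\<Sum>j\<in>I. if j = i then d i else 0)"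
      using basis i by (intro sum.cong) (auto simp: orthonormal_basis_of_def)
    finally show ?thesis using i by simp
  qed
  then show ?thesis unfolding d by (intro sum.cong) auto
qed

lemma lie_bracket_basis:
  assumes "j \<in> I" "k \<in> I"
  shows "lie_bracket G A (e j) (e k) f = (\<Sum>i\<in>I. c i j k * e i f)"
  unfolding c_def using assms by (intro expand_orthonormal lie_bracket_in e_in)

lemma c_cyclic: "i \<in> I \<Longrightarrow> j \<in> I \<Longrightarrow> k \<in> I \<Longrightarrow> c i j k = c k i j"
  unfolding c_def using K_inv[unfolded invariant_form_def] K_sym e_in lie_bracket_in by metis

lemma c_antisym:
  assumes "i \<in> I" "j \<in> I" "k \<in> I"
  shows "c i j k = - c i k j"
proof -
  have "lie_bracket G A (e j) (e k) = (\<lambda>f. (-1) * lie_bracket G A (e k) (e j) f + 0 * lie_bracket G A (e k) (e j) f)"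
    by (auto simp: lie_bracket_def)
  then show ?thesis
    using K_lin[OF lie_bracket_in lie_bracket_in e_in, OF e_in e_in e_in e_in, of k j k j i "-1" 0]
      K_sym[OF e_in lie_bracket_in[OF e_in e_in], of i j k] K_sym[OF e_in lie_bracket_in[OF e_in e_in], of i k j] assms
    by (simp add: c_def)
qed

lemma left_commutator:
  assumes i: "i \<in> I" and j: "j \<in> I" and f: "smooth_fun A f"
  shows "e i (\<lambda>h. e j (\<lambda>k. f (g \<otimes> h \<otimes> k))) - e j (\<lambda>h. e i (\<lambda>k. f (g \<otimes> h \<otimes> k)))
       = - (\<Sum>k\<in>I. c k i j * e k (\<lambda>h. f (g \<otimes> h)))"
proof -
  have s: "smooth_fun A (\<lambda>x. f (g \<otimes> x))"
    by (rule smooth_pull[OF f]) (rule smooth_maps)+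
  have "smooth_fun A2 (\<lambda>x. f (g \<otimes> fst x \<otimes> snd x))"
    by (rule smooth_pull[OF f]) (rule smooth_maps)+
  from tangent_commute[OF A A this e_in[OF j] e_in[OF i]]
  show ?thesis
    using lie_bracket_smooth[OF e_in[OF i] e_in[OF j] s] lie_bracket_basis[OF i j] by (simp add: assoc)
qed

lemma right_commutator:
  assumes i: "i \<in> I" and j: "j \<in> I" and f: "smooth_fun A f"
  shows "e i (\<lambda>h. e j (\<lambda>k. f (k \<otimes> (h \<otimes> g)))) - e j (\<lambda>h. e i (\<lambda>k. f (k \<otimes> (h \<otimes> g))))
       = (\<Sum>k\<in>I. c k i j * e k (\<lambda>h. f (h \<otimes> g)))"
proof -
  have s: "smooth_fun A (\<lambda>x. f (x \<otimes> g))"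
    by (rule smooth_pull[OF f]) (rule smooth_maps)+
  have "smooth_fun A2 (\<lambda>x. f (snd x \<otimes> (fst x \<otimes> g)))"
    by (rule smooth_pull[OF f]) (rule smooth_maps)+
  from tangent_commute[OF A A this e_in[OF j] e_in[OF i]]
  show ?thesis
    using lie_bracket_smooth[OF e_in[OF i] e_in[OF j] s] lie_bracket_basis[OF i j] by (simp add: assoc)
qed

text \<open>
  Left-invariant differentiations \<open>L i\<close> have commutators \<open>- (\<Sum>m. c m i j * L m)\<close>. The Jacobi identity of
  operator commutators, evaluated at the unit and compared along the independent \<open>e l\<close>, is the claim.
\<close>

lemma jacobi:
  assumes i: "i \<in> I" and j: "j \<in> I" and k: "k \<in> I" and l: "l \<in> I"
  shows "(\<Sum>m\<in>I. c m i j * c l m k + c m j k * c l m i + c m k i * c l m j) = 0"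
proof -
  define L where "L i f g = e i (\<lambda>h. f (g \<otimes> h))" for i f and g :: 'a
  have sL: "smooth_fun A (L i f)" if "i \<in> I" "smooth_fun A f" for i f
  proof -
    have "smooth_fun A2 (\<lambda>x. f (snd x \<otimes> fst x))"
      by (rule smooth_pull[OF that(2)]) (rule smooth_maps)+
    from smooth_fun_partial[OF A A this e_in[OF that(1)]] show ?thesis by (simp add: L_def[abs_def])
  qed
  have comm: "L i (L j f) g - L j (L i f) g = - (\<Sum>m\<in>I. c m i j * L m f g)"
    if "i \<in> I" "j \<in> I" "smooth_fun A f" for i j f g
    using left_commutator[OF that] by (simp add: L_def assoc)
  have Lin: "L k (\<lambda>x. \<Sum>m\<in>I. d m * L m f x) g = (\<Sum>m\<in>I. d m * L k (L m f) g)" if "k \<in> I" "smooth_fun A f" for k d f g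
  proof -
    have s: "smooth_fun A (\<lambda>h. L m f (g \<otimes> h))" if "m \<in> I" for m
      by (rule smooth_pull[OF sL[OF that \<open>smooth_fun A f\<close>]]) (rule smooth_maps)+
    show ?thesis unfolding L_def[of k]
      by (subst tangent_sum[OF A e_in[OF that(1)]])
        (auto intro!: sum.cong tangent_cmult[OF A e_in[OF that(1)]] smooth_fun_cmult[OF A] s)
  qed
  have Ldiff: "L k (\<lambda>x. p x - q x) g = L k p g - L k q g" if "k \<in> I" "smooth_fun A p" "smooth_fun A q" for k p q g
  proof -
    have s: "smooth_fun A (\<lambda>h. p (g \<otimes> h))" "smooth_fun A (\<lambda>h. q (g \<otimes> h))"
      by (rule smooth_pull[OF that(2)], (rule smooth_maps)+, rule smooth_pull[OF that(3)], (rule smooth_maps)+)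
    have "e k (\<lambda>h. p (g \<otimes> h) + (-1) * q (g \<otimes> h)) = e k (\<lambda>h. p (g \<otimes> h)) + (-1) * e k (\<lambda>h. q (g \<otimes> h))"
      using tangent_add[OF A e_in[OF that(1)] s(1) smooth_fun_mult[OF A smooth_fun_const[OF A] s(2), of "-1"]]
        tangent_cmult[OF A e_in[OF that(1)] s(2), of "-1"] by simp
    then show ?thesis by (simp add: L_def)
  qed
  have comm2: "L i (L j (L k f)) g - L j (L i (L k f)) g - L k (L i (L j f)) g + L k (L j (L i f)) g
      = (\<Sum>m\<in>I. c m i j * (\<Sum>l\<in>I. c l m k * L l f g))"
    if ijk: "i \<in> I" "j \<in> I" "k \<in> I" and f: "smooth_fun A f" for i j k f g
  proof -
    have "L k (L i (L j f)) g - L k (L j (L i f)) g = L k (\<lambda>x. L i (L j f) x - L j (L i f) x) g"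
      using ijk f by (intro Ldiff[symmetric] sL)
    also have "(\<lambda>x. L i (L j f) x - L j (L i f) x) = (\<lambda>x. \<Sum>m\<in>I. - c m i j * L m f x)"
      using comm[OF ijk(1,2) f] by (simp add: sum_negf)
    finally have 1: "L k (L i (L j f)) g - L k (L j (L i f)) g = (\<Sum>m\<in>I. - c m i j * L k (L m f) g)"
      unfolding Lin[OF ijk(3) f] .
    have 2: "L i (L j (L k f)) g - L j (L i (L k f)) g = (\<Sum>m\<in>I. - c m i j * L m (L k f) g)"
      using comm[OF ijk(1,2) sL[OF ijk(3) f]] by (simp add: sum_negf)
    have "L i (L j (L k f)) g - L j (L i (L k f)) g - L k (L i (L j f)) g + L k (L j (L i f)) g
        = (L i (L j (L k f)) g - L j (L i (L k f)) g) - (L k (L i (L j f)) g - L k (L j (L i f)) g)"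
      by simp
    also have "\<dots> = (\<Sum>m\<in>I. - c m i j * (L m (L k f) g - L k (L m f) g))"
      unfolding 1 2 by (simp only: right_diff_distrib sum_subtractf)
    also have "\<dots> = (\<Sum>m\<in>I. c m i j * (\<Sum>l\<in>I. c l m k * L l f g))"
      using comm[OF _ ijk(3) f] by (intro sum.cong) auto
    finally show ?thesis .
  qed
  have "(\<Sum>m\<in>I. c m i j * c l m k + c m j k * c l m i + c m k i * c l m j) = 0"
  proof (rule basis_independent[OF _ l])
    fix f assume f: "smooth_fun A f"
    have "(\<Sum>m\<in>I. c m i j * (\<Sum>l\<in>I. c l m k * L l f \<one>)) + (\<Sum>m\<in>I. c m j k * (\<Sum>l\<in>I. c l m i * L l f \<one>))
        + (\<Sum>m\<in>I. c m k i * (\<Sum>l\<in>I. c l m j * L l f \<one>)) = 0"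
      using comm2[OF i j k f, of \<one>] comm2[OF j k i f, of \<one>] comm2[OF k i j f, of \<one>] by simp
    then have "(\<Sum>m\<in>I. \<Sum>l\<in>I. (c m i j * c l m k + c m j k * c l m i + c m k i * c l m j) * e l f) = 0"
      by (simp add: sum_distrib_left sum.distrib[symmetric] L_def algebra_simps)
    then show "(\<Sum>l\<in>I. (\<Sum>m\<in>I. c m i j * c l m k + c m j k * c l m i + c m k i * c l m j) * e l f) = 0"
      by (subst (asm) sum.swap) (simp add: sum_distrib_right)
  qed
  then show ?thesis .
qed

text \<open>
  Every tangent vector at \<open>p\<close> is the left translate of an element of the Lie algebra.
\<close>

lemma constant_if_left_derivatives_zero:
  assumes f: "smooth_fun A f" and zero: "\<And>g m. m \<in> I \<Longrightarrow> e m (\<lambda>t. f (g \<otimes> t)) = 0"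
  shows "f x = f y"
proof (rule constant_if_tangent_zero[OF A conn f])
  fix p v assume v: "v \<in> tangent_space A p"
  have "push A (\<lambda>x. inv p \<otimes> x) v \<in> lie_alg G A"
    by (rule push_tangent[OF A A _ v]) ((rule smooth_maps)+, simp)
  then obtain d where d: "\<And>h. push A (\<lambda>x. inv p \<otimes> x) v h = (\<Sum>i\<in>I. d i * e i h)"
    using lie_alg_expand by metis
  have "smooth_fun A (\<lambda>t. f (p \<otimes> t))"
    by (rule smooth_pull[OF f]) (rule smooth_maps)+
  then have "v f = push A (\<lambda>x. inv p \<otimes> x) v (\<lambda>t. f (p \<otimes> t))"
    by (simp add: push_def comp_def)
  then show "v f = 0" unfolding d using zero by simp
qed

text \<open>
  The tensor \<open>\<Sum>i. e i \<otimes> e i\<close> inverse to \<open>K\<close> is \<open>Ad\<close>-invariant: the left-hand side is a function of \<open>g\<close> whose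
  derivative along \<open>e m\<close> has the coefficients \<open>- (c k m i + c i m k)\<close>, which are 0 by antisymmetry.
\<close>

lemma Ad_invariant2:
  assumes f: "smooth_fun A f1" "smooth_fun A f2"
  shows "(\<Sum>i\<in>I. e i (\<lambda>h. f1 (g \<otimes> h \<otimes> inv g)) * e i (\<lambda>h. f2 (g \<otimes> h \<otimes> inv g))) = (\<Sum>i\<in>I. e i f1 * e i f2)"
proof -
  let ?\<psi> = "\<lambda>g. \<Sum>i\<in>I. e i (\<lambda>h. f1 (g \<otimes> h \<otimes> inv g)) * e i (\<lambda>h. f2 (g \<otimes> h \<otimes> inv g))"
  have "?\<psi> g = ?\<psi> \<one>"
  proof (rule constant_if_left_derivatives_zero)
    show "smooth_fun A ?\<psi>" by (intro smooth_fun_sum smooth_fun_mult A smooth_Ad e_in f)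
  next
    fix g m assume m: "m \<in> I"
    let ?f1 = "\<lambda>x. f1 (g \<otimes> x \<otimes> inv g)" and ?f2 = "\<lambda>x. f2 (g \<otimes> x \<otimes> inv g)"
    have s: "smooth_fun A ?f1" "smooth_fun A ?f2"
      by (rule smooth_pull[OF f(1)], (rule smooth_maps)+, rule smooth_pull[OF f(2)], (rule smooth_maps)+)
    let ?E = "\<lambda>i f t. e i (\<lambda>h. f (t \<otimes> h \<otimes> inv t))"
    have sE: "smooth_fun A (?E i f)" if "i \<in> I" "smooth_fun A f" for i f
      using smooth_Ad[OF e_in that(2)] that(1) by simp
    have dE: "e m (?E i f) = - (\<Sum>a\<in>I. c a m i * e a f)" if "i \<in> I" "smooth_fun A f" for i f
      using derivative_Ad[OF e_in[OF m] e_in[OF that(1)] that(2)] lie_bracket_basis[OF m that(1)] by simp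
    have "e m (\<lambda>t. ?\<psi> (g \<otimes> t)) = e m (\<lambda>t. \<Sum>i\<in>I. ?E i ?f1 t * ?E i ?f2 t)"
      by (simp add: assoc)
    also have "\<dots> = (\<Sum>i\<in>I. e m (\<lambda>t. ?E i ?f1 t * ?E i ?f2 t))"
      by (rule tangent_sum[OF A e_in[OF m]]) (intro smooth_fun_mult A sE s, assumption+)
    also have "\<dots> = (\<Sum>i\<in>I. e i ?f1 * - (\<Sum>k\<in>I. c k m i * e k ?f2) + - (\<Sum>k\<in>I. c k m i * e k ?f1) * e i ?f2)"
    proof (intro sum.cong refl)
      fix i assume i: "i \<in> I"
      show "e m (\<lambda>t. ?E i ?f1 t * ?E i ?f2 t)
          = e i ?f1 * - (\<Sum>k\<in>I. c k m i * e k ?f2) + - (\<Sum>k\<in>I. c k m i * e k ?f1) * e i ?f2"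
        using tangent_mult[OF A e_in[OF m] sE[OF i s(1)] sE[OF i s(2)]]
        unfolding dE[OF i s(1)] dE[OF i s(2)] by simp
    qed
    also have "\<dots> = - (\<Sum>i\<in>I. \<Sum>k\<in>I. c k m i * (e i ?f1 * e k ?f2)) - (\<Sum>i\<in>I. \<Sum>k\<in>I. c k m i * (e k ?f1 * e i ?f2))"
      by (simp add: sum_distrib_left sum_distrib_right sum_negf sum.distrib sum_subtractf mult_ac)
    also have "(\<Sum>i\<in>I. \<Sum>k\<in>I. c k m i * (e k ?f1 * e i ?f2)) = (\<Sum>i\<in>I. \<Sum>k\<in>I. c i m k * (e i ?f1 * e k ?f2))"
      by (rule sum.swap)
    also have "\<dots> = (\<Sum>i\<in>I. \<Sum>k\<in>I. - (c k m i * (e i ?f1 * e k ?f2)))"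
    proof (intro sum.cong refl)
      fix i k assume "i \<in> I" "k \<in> I"
      then have "c i m k = - c k m i" using m c_cyclic c_antisym by metis
      then show "c i m k * (e i ?f1 * e k ?f2) = - (c k m i * (e i ?f1 * e k ?f2))" by simp
    qed
    finally show "e m (\<lambda>t. ?\<psi> (g \<otimes> t)) = 0" by (simp add: sum_negf)
  qed
  then show ?thesis by simp
qed

text \<open>
  The coefficient of \<open>x i * y j * z k\<close> is the cyclic sum in the Jacobi identity.
\<close>

lemma c_infinitesimal_invariance:
  fixes x y z :: "nat \<Rightarrow> real"
  assumes m: "m \<in> I"
  shows "(\<Sum>i\<in>I. \<Sum>j\<in>I. \<Sum>k\<in>I. c i j k * ((\<Sum>a\<in>I. c a m i * x a) * y j * z k + x i * (\<Sum>a\<in>I. c a m j * y a) * z k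
      + x i * y j * (\<Sum>a\<in>I. c a m k * z a))) = 0"
proof -
  have "(\<Sum>i\<in>I. \<Sum>j\<in>I. \<Sum>k\<in>I. c i j k * ((\<Sum>a\<in>I. c a m i * x a) * y j * z k + x i * (\<Sum>a\<in>I. c a m j * y a) * z k
      + x i * y j * (\<Sum>a\<in>I. c a m k * z a)))
    = (\<Sum>i\<in>I. \<Sum>j\<in>I. \<Sum>k\<in>I. \<Sum>a\<in>I. c i j k * c a m i * (x a * y j * z k))
    + (\<Sum>i\<in>I. \<Sum>j\<in>I. \<Sum>k\<in>I. \<Sum>a\<in>I. c i j k * c a m j * (x i * y a * z k))
    + (\<Sum>i\<in>I. \<Sum>j\<in>I. \<Sum>k\<in>I. \<Sum>a\<in>I. c i j k * c a m k * (x i * y j * z a))"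
    by (simp add: sum_distrib_left sum_distrib_right sum.distrib algebra_simps)
  also have "\<dots> = (\<Sum>i\<in>I. \<Sum>j\<in>I. \<Sum>k\<in>I. \<Sum>a\<in>I. c a j k * c i m a * (x i * y j * z k))
    + (\<Sum>i\<in>I. \<Sum>j\<in>I. \<Sum>k\<in>I. \<Sum>a\<in>I. c i a k * c j m a * (x i * y j * z k))
    + (\<Sum>i\<in>I. \<Sum>j\<in>I. \<Sum>k\<in>I. \<Sum>a\<in>I. c i j a * c k m a * (x i * y j * z k))"
    using sum4_reorder(1)[where I = I and F = "\<lambda>i j k a. c i j k * c a m i * (x a * y j * z k)"]
      sum4_reorder(2)[where I = I and F = "\<lambda>i j k a. c i j k * c a m j * (x i * y a * z k)"]
      sum4_reorder(3)[where I = I and F = "\<lambda>i j k a. c i j k * c a m k * (x i * y j * z a)"] by simp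
  also have "\<dots> = (\<Sum>i\<in>I. \<Sum>j\<in>I. \<Sum>k\<in>I. (\<Sum>a\<in>I. c a j k * c m a i + c a k i * c m a j + c a i j * c m a k) * (x i * y j * z k))"
  proof -
    have "c a j k * c i m a = c a j k * c m a i" "c i a k * c j m a = c a k i * c m a j" "c i j a * c k m a = c a i j * c m a k"
      if "i \<in> I" "j \<in> I" "k \<in> I" "a \<in> I" for i j k a
      using that m c_cyclic[of _ _ a] c_cyclic[of _ _ i] c_cyclic[of m a] c_cyclic[of a k i] by simp_all
    then have "c a j k * c i m a * (x i * y j * z k) + c i a k * c j m a * (x i * y j * z k) + c i j a * c k m a * (x i * y j * z k)
        = (c a j k * c m a i + c a k i * c m a j + c a i j * c m a k) * (x i * y j * z k)"
      if "i \<in> I" "j \<in> I" "k \<in> I" "a \<in> I" for i j k a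
      using that by (simp only: distrib_right)
    then show ?thesis
      unfolding sum.distrib[symmetric] sum_distrib_right by (intro sum.cong refl) blast
  qed
  also have "\<dots> = 0" using jacobi[OF _ _ _ m] by simp
  finally show ?thesis .
qed

text \<open>
  The argument of the quadratic case for the cubic tensor with coefficients \<open>c\<close>; the derivative now vanishes
  by infinitesimal invariance of \<open>c\<close>.
\<close>

lemma Ad_invariant3:
  assumes f: "smooth_fun A f1" "smooth_fun A f2" "smooth_fun A f3"
  shows "cubic (\<lambda>i. e i (\<lambda>h. f1 (g \<otimes> h \<otimes> inv g))) (\<lambda>i. e i (\<lambda>h. f2 (g \<otimes> h \<otimes> inv g))) (\<lambda>i. e i (\<lambda>h. f3 (g \<otimes> h \<otimes> inv g)))
    = cubic (\<lambda>i. e i f1) (\<lambda>i. e i f2) (\<lambda>i. e i f3)"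
proof -
  let ?\<psi> = "\<lambda>g. cubic (\<lambda>i. e i (\<lambda>h. f1 (g \<otimes> h \<otimes> inv g))) (\<lambda>i. e i (\<lambda>h. f2 (g \<otimes> h \<otimes> inv g))) (\<lambda>i. e i (\<lambda>h. f3 (g \<otimes> h \<otimes> inv g)))"
  have "?\<psi> g = ?\<psi> \<one>"
  proof (rule constant_if_left_derivatives_zero)
    show "smooth_fun A ?\<psi>" by (intro smooth_fun_sum[OF A] smooth_fun_cmult[OF A] smooth_fun_mult[OF A] smooth_Ad[OF e_in f(1)]
          smooth_Ad[OF e_in f(2)] smooth_Ad[OF e_in f(3)])
  next
    fix g m assume m: "m \<in> I"
    let ?f1 = "\<lambda>x. f1 (g \<otimes> x \<otimes> inv g)" and ?f2 = "\<lambda>x. f2 (g \<otimes> x \<otimes> inv g)" and ?f3 = "\<lambda>x. f3 (g \<otimes> x \<otimes> inv g)"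
    have s: "smooth_fun A ?f1" "smooth_fun A ?f2" "smooth_fun A ?f3"
      by (rule smooth_pull[OF f(1)], (rule smooth_maps)+, rule smooth_pull[OF f(2)], (rule smooth_maps)+,
          rule smooth_pull[OF f(3)], (rule smooth_maps)+)
    let ?E = "\<lambda>i f t. e i (\<lambda>h. f (t \<otimes> h \<otimes> inv t))"
    have sE: "smooth_fun A (?E i f)" if "i \<in> I" "smooth_fun A f" for i f using smooth_Ad[OF e_in that(2)] that(1) by simp
    have dE: "e m (?E i f) = - (\<Sum>a\<in>I. c a m i * e a f)" if "i \<in> I" "smooth_fun A f" for i f
      using derivative_Ad[OF e_in[OF m] e_in[OF that(1)] that(2)] lie_bracket_basis[OF m that(1)] by simp
    let ?d = "\<lambda>i f. \<Sum>a\<in>I. c a m i * e a f"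
    have "e m (\<lambda>t. ?\<psi> (g \<otimes> t)) = e m (\<lambda>t. \<Sum>i\<in>I. \<Sum>j\<in>I. \<Sum>k\<in>I. c i j k * (?E i ?f1 t * ?E j ?f2 t * ?E k ?f3 t))"
      by (simp add: assoc)
    also have "\<dots> = (\<Sum>i\<in>I. \<Sum>j\<in>I. \<Sum>k\<in>I. e m (\<lambda>t. c i j k * (?E i ?f1 t * ?E j ?f2 t * ?E k ?f3 t)))"
    proof -
      have P: "smooth_fun A (\<lambda>t. c i j k * (?E i ?f1 t * ?E j ?f2 t * ?E k ?f3 t))" if "i \<in> I" "j \<in> I" "k \<in> I" for i j k
        using that by (intro smooth_fun_cmult[OF A] smooth_fun_mult[OF A] sE[OF _ s(1)] sE[OF _ s(2)] sE[OF _ s(3)])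
      show ?thesis
        by (subst tangent_sum[OF A e_in[OF m]]; (intro sum.cong refl smooth_fun_sum[OF A] P)?; assumption?;
          subst tangent_sum[OF A e_in[OF m]]; (intro sum.cong refl smooth_fun_sum[OF A] P)?; assumption?;
          rule tangent_sum[OF A e_in[OF m]]; (intro P)?; assumption?)
    qed
    also have "\<dots> = (\<Sum>i\<in>I. \<Sum>j\<in>I. \<Sum>k\<in>I. - (c i j k * (?d i ?f1 * e j ?f2 * e k ?f3 + e i ?f1 * ?d j ?f2 * e k ?f3 + e i ?f1 * e j ?f2 * ?d k ?f3)))"
    proof (intro sum.cong refl)
      fix i j k assume i: "i \<in> I" and j: "j \<in> I" and k: "k \<in> I"
      have "e m (\<lambda>t. c i j k * (?E i ?f1 t * ?E j ?f2 t * ?E k ?f3 t)) = c i j k * e m (\<lambda>t. ?E i ?f1 t * ?E j ?f2 t * ?E k ?f3 t)"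
        by (intro tangent_cmult[OF A e_in[OF m]] smooth_fun_mult[OF A] sE[OF i s(1)] sE[OF j s(2)] sE[OF k s(3)])
      also have "e m (\<lambda>t. ?E i ?f1 t * ?E j ?f2 t * ?E k ?f3 t)
          = (e i ?f1 * e j ?f2) * e m (?E k ?f3) + e m (\<lambda>t. ?E i ?f1 t * ?E j ?f2 t) * e k ?f3"
        using tangent_mult[OF A e_in[OF m] smooth_fun_mult[OF A sE[OF i s(1)] sE[OF j s(2)]] sE[OF k s(3)]] by simp
      also have "e m (\<lambda>t. ?E i ?f1 t * ?E j ?f2 t) = e i ?f1 * e m (?E j ?f2) + e m (?E i ?f1) * e j ?f2"
        using tangent_mult[OF A e_in[OF m] sE[OF i s(1)] sE[OF j s(2)]] by simp
      finally show "e m (\<lambda>t. c i j k * (?E i ?f1 t * ?E j ?f2 t * ?E k ?f3 t)) = - (c i j k * (?d i ?f1 * e j ?f2 * e k ?f3 + e i ?f1 * ?d j ?f2 * e k ?f3 + e i ?f1 * e j ?f2 * ?d k ?f3))"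
        unfolding dE[OF i s(1)] dE[OF j s(2)] dE[OF k s(3)] by (simp add: algebra_simps)
    qed
    also have "\<dots> = 0"
      using c_infinitesimal_invariance[OF m, of "\<lambda>i. e i ?f1" "\<lambda>i. e i ?f2" "\<lambda>i. e i ?f3"] by (simp only: sum_negf neg_equal_0_iff_equal)
    finally show "e m (\<lambda>t. ?\<psi> (g \<otimes> t)) = 0" .
  qed
  then show ?thesis by simp
qed

end

section \<open>Brackets defined by families of derivations\<close>

definition function_algebra :: "('x \<Rightarrow> real) set \<Rightarrow> bool" where
  "function_algebra S \<longleftrightarrow> (\<lambda>x. 0) \<in> S \<and> (\<forall>f\<in>S. \<forall>g\<in>S. (\<lambda>x. f x + g x) \<in> S) \<and>
     (\<forall>c. \<forall>f\<in>S. (\<lambda>x. c * f x) \<in> S) \<and> (\<forall>f\<in>S. \<forall>g\<in>S. (\<lambda>x. f x * g x) \<in> S)"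

definition derivation_on :: "('x \<Rightarrow> real) set \<Rightarrow> (('x \<Rightarrow> real) \<Rightarrow> 'x \<Rightarrow> real) \<Rightarrow> bool" where
  "derivation_on S D \<longleftrightarrow> (\<forall>f\<in>S. D f \<in> S) \<and>
     (\<forall>f\<in>S. \<forall>g\<in>S. D (\<lambda>x. f x + g x) = (\<lambda>x. D f x + D g x)) \<and>
     (\<forall>c. \<forall>f\<in>S. D (\<lambda>x. c * f x) = (\<lambda>x. c * D f x)) \<and>
     (\<forall>f\<in>S. \<forall>g\<in>S. D (\<lambda>x. f x * g x) = (\<lambda>x. f x * D g x + D f x * g x))"

lemma function_algebraD:
  assumes "function_algebra S"
  shows "(\<lambda>x. 0) \<in> S"
    "f \<in> S \<Longrightarrow> g \<in> S \<Longrightarrow> (\<lambda>x. f x + g x) \<in> S"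
    "f \<in> S \<Longrightarrow> (\<lambda>x. c * f x) \<in> S"
    "f \<in> S \<Longrightarrow> g \<in> S \<Longrightarrow> (\<lambda>x. f x * g x) \<in> S"
  using assms by (simp_all add: function_algebra_def)

lemma derivation_onD:
  assumes "derivation_on S D"
  shows "f \<in> S \<Longrightarrow> D f \<in> S"
    "f \<in> S \<Longrightarrow> g \<in> S \<Longrightarrow> D (\<lambda>x. f x + g x) = (\<lambda>x. D f x + D g x)"
    "f \<in> S \<Longrightarrow> D (\<lambda>x. c * f x) = (\<lambda>x. c * D f x)"
    "f \<in> S \<Longrightarrow> g \<in> S \<Longrightarrow> D (\<lambda>x. f x * g x) = (\<lambda>x. f x * D g x + D f x * g x)"
  using assms by (simp_all add: derivation_on_def)

lemma function_algebra_sum: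
  assumes "function_algebra S" "\<And>a. a \<in> J \<Longrightarrow> F a \<in> S"
  shows "(\<lambda>x. \<Sum>a\<in>J. F a x) \<in> S"
  using assms(2)
proof (induction J rule: infinite_finite_induct)
  case (insert a J)
  then have "(\<lambda>x. F a x + (\<Sum>a\<in>J. F a x)) \<in> S"
    by (intro function_algebraD(2)[OF assms(1)]) auto
  then show ?case using insert by simp
qed (simp_all add: function_algebraD(1)[OF assms(1)])

lemma derivation_on_sum:
  assumes S: "function_algebra S" and D: "derivation_on S D" and F: "\<And>a. a \<in> J \<Longrightarrow> F a \<in> S"
  shows "D (\<lambda>x. \<Sum>a\<in>J. F a x) = (\<lambda>x. \<Sum>a\<in>J. D (F a) x)"
proof -
  have 0: "D (\<lambda>x. 0) = (\<lambda>x. 0)"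
    using derivation_onD(3)[OF D function_algebraD(1)[OF S], of 0] by simp
  show ?thesis using F
  proof (induction J rule: infinite_finite_induct)
    case (insert a J)
    have "(\<lambda>x. \<Sum>a\<in>J. F a x) \<in> S" using insert by (intro function_algebra_sum[OF S]) auto
    then have "D (\<lambda>x. F a x + (\<Sum>a\<in>J. F a x)) = (\<lambda>x. D (F a) x + D (\<lambda>x. \<Sum>a\<in>J. F a x) x)"
      using insert.prems by (intro derivation_onD(2)[OF D]) auto
    then show ?case using insert by simp
  qed (simp_all add: 0)
qed

text \<open>
  The derivations are indexed by a frame \<open>t\<close> and a basis index \<open>i\<close>; only vectors with the same basis index
  are paired, and the antisymmetric coefficients depend on the frames alone. This is the shape of the
  bivector field on the groupoid, whose three frames are summed against the invariant tensor
  \<open>\<Sum>i. e i \<otimes> e i\<close>.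
\<close>

locale derivation_bracket =
  fixes S :: "('x \<Rightarrow> real) set" and I :: "'i set" and T :: "'t set"
    and Z :: "'t \<Rightarrow> 'i \<Rightarrow> ('x \<Rightarrow> real) \<Rightarrow> 'x \<Rightarrow> real" and p :: "'t \<Rightarrow> 't \<Rightarrow> real"
  assumes finite_I: "finite I" and finite_T: "finite T" and S: "function_algebra S"
    and Z: "\<And>t i. t \<in> T \<Longrightarrow> i \<in> I \<Longrightarrow> derivation_on S (Z t i)"
    and p_antisym: "\<And>s t. p s t = - p t s"
begin

abbreviation "M \<equiv> I \<times> T \<times> T"

definition br :: "('x \<Rightarrow> real) \<Rightarrow> ('x \<Rightarrow> real) \<Rightarrow> 'x \<Rightarrow> real" where
  "br f g = (\<lambda>x. \<Sum>(i, t, s)\<in>M. p t s * (Z t i f x * Z s i g x))"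

lemma Z_closed: "t \<in> T \<Longrightarrow> i \<in> I \<Longrightarrow> f \<in> S \<Longrightarrow> Z t i f \<in> S"
  using derivation_onD(1)[OF Z] .

lemma S_mult: "f \<in> S \<Longrightarrow> g \<in> S \<Longrightarrow> (\<lambda>x. f x * g x) \<in> S"
  and S_cmult: "f \<in> S \<Longrightarrow> (\<lambda>x. c * f x) \<in> S"
  using function_algebraD[OF S] by auto

lemma br_closed: "f \<in> S \<Longrightarrow> g \<in> S \<Longrightarrow> br f g \<in> S"
  unfolding br_def case_prod_unfold
  by (rule function_algebra_sum[OF S]) (intro S_cmult S_mult Z_closed; auto)

lemma derivation_br:
  assumes D: "derivation_on S D" and f: "f \<in> S" and g: "g \<in> S"
  shows "D (br f g) x = (\<Sum>(i, t, s)\<in>M. p t s * (Z t i f x * D (Z s i g) x + D (Z t i f) x * Z s i g x))"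
proof -
  let ?t = "\<lambda>m. fst (snd m)" and ?s = "\<lambda>m. snd (snd m)"
  have "D (br f g) = (\<lambda>x. \<Sum>m\<in>M. D (\<lambda>x. p (?t m) (?s m) * (Z (?t m) (fst m) f x * Z (?s m) (fst m) g x)) x)"
    unfolding br_def case_prod_unfold
    by (rule derivation_on_sum[OF S D]) (intro S_cmult S_mult Z_closed f g; auto)
  also have "\<dots> = (\<lambda>x. \<Sum>(i, t, s)\<in>M. p t s * (Z t i f x * D (Z s i g) x + D (Z t i f) x * Z s i g x))"
    unfolding case_prod_unfold
  proof (intro ext sum.cong refl)
    fix x m assume "m \<in> M"
    then have "Z (?t m) (fst m) f \<in> S" "Z (?s m) (fst m) g \<in> S" using Z_closed f g by auto
    then show "D (\<lambda>x. p (?t m) (?s m) * (Z (?t m) (fst m) f x * Z (?s m) (fst m) g x)) x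
        = p (?t m) (?s m) * (Z (?t m) (fst m) f x * D (Z (?s m) (fst m) g) x + D (Z (?t m) (fst m) f) x * Z (?s m) (fst m) g x)"
      by (simp add: derivation_onD(3,4)[OF D] S_mult)
  qed
  finally show ?thesis by simp
qed

text \<open>
  One of the three cyclic parts of the Jacobiator, after its second derivatives have been paired into
  commutators.
\<close>

definition jac :: "('x \<Rightarrow> real) \<Rightarrow> ('x \<Rightarrow> real) \<Rightarrow> ('x \<Rightarrow> real) \<Rightarrow> 'x \<Rightarrow> real" where
  "jac f g h x = (\<Sum>(i, t, t')\<in>M. \<Sum>(j, s, s')\<in>M. p t t' * p s s' * (Z t i f x * Z s j g x *
     (Z t' i (Z s' j h) x - Z s' j (Z t' i h) x)))"

text \<open>
  Expanding \<open>br f (br g h)\<close> gives terms \<open>P\<close> with second derivatives of \<open>g\<close> and terms \<open>R\<close> with second derivatives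
  of \<open>h\<close>. In the cyclic sum, \<open>R f g h\<close> and \<open>P g h f\<close> both differentiate \<open>h\<close> twice; renaming indices and
  antisymmetry of \<open>p\<close> show that they have opposite signs and the opposite order of derivations.
\<close>

lemma jacobiator:
  assumes f: "f \<in> S" and g: "g \<in> S" and h: "h \<in> S"
  shows "br f (br g h) x + br g (br h f) x + br h (br f g) x = jac f g h x + jac g h f x + jac h f g x"
proof -
  define FP where "FP f g h = (\<lambda>((i, t, t'), (j, s, s')). p t t' * p s s' * (Z t i f x * Z t' i (Z s j g) x * Z s' j h x))" for f g h
  define FR where "FR f g h = (\<lambda>((i, t, t'), (j, s, s')). p t t' * p s s' * (Z t i f x * Z s j g x * Z t' i (Z s' j h) x))" for f g h
  define FJ where "FJ f g h = (\<lambda>((i, t, t'), (j, s, s')). p t t' * p s s' * (Z t i f x * Z s j g x *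
      (Z t' i (Z s' j h) x - Z s' j (Z t' i h) x)))" for f g h
  define P where "P f g h = sum (FP f g h) (M \<times> M)" for f g h
  define R where "R f g h = sum (FR f g h) (M \<times> M)" for f g h
  have nested: "(\<Sum>a\<in>M. \<Sum>b\<in>M. F (a, b)) = sum F (M \<times> M)" for F :: "('i \<times> 't \<times> 't) \<times> ('i \<times> 't \<times> 't) \<Rightarrow> real"
    using sum.cartesian_product[of "\<lambda>a b. F (a, b)" M M] by simp
  have split: "br f (br g h) x = P f g h + R f g h" if "f \<in> S" "g \<in> S" "h \<in> S" for f g h
  proof -
    have "br f (br g h) x = (\<Sum>a\<in>M. \<Sum>b\<in>M. FP f g h (a, b) + FR f g h (a, b))"
      unfolding br_def[of f]
    proof (intro sum.cong refl)
      fix a assume a: "a \<in> M"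
      obtain i t t' where a': "a = (i, t, t')" by (cases a)
      have "t' \<in> T" "i \<in> I" using a a' by auto
      from derivation_br[OF Z[OF this] that(2,3)]
      show "(case a of (i, t, t') \<Rightarrow> p t t' * (Z t i f x * Z t' i (br g h) x)) = (\<Sum>b\<in>M. FP f g h (a, b) + FR f g h (a, b))"
        unfolding a' FP_def FR_def by (simp add: sum_distrib_left case_prod_unfold algebra_simps)
    qed
    also have "\<dots> = P f g h + R f g h"
      unfolding P_def R_def nested[symmetric] by (simp only: sum.distrib)
    finally show ?thesis .
  qed
  have "P g h f = (\<Sum>q\<in>M \<times> M. FJ f g h q - FR f g h q)" for f g h
    unfolding P_def
  proof (rule sum.reindex_bij_witness[where i = "\<lambda>((i, t, t'), (j, s, s')). ((j, s, s'), (i, t', t))"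
        and j = "\<lambda>((i, t, t'), (j, s, s')). ((j, s', s), (i, t, t'))"], goal_cases)
    case (5 a)
    obtain i t t' j s s' where a: "a = ((i, t, t'), (j, s, s'))" by (metis surj_pair)
    show ?case unfolding a FP_def FJ_def FR_def using p_antisym[of s s'] by (simp add: algebra_simps)
  qed auto
  then have "P g h f + R f g h = sum (FJ f g h) (M \<times> M)" for f g h
    unfolding R_def by (simp add: sum_subtractf)
  moreover have "jac f g h x = sum (FJ f g h) (M \<times> M)" for f g h
    unfolding nested[symmetric] jac_def FJ_def by (simp add: case_prod_unfold)
  ultimately have "P g h f + R f g h = jac f g h x" for f g h by simp
  then have "P f g h + R f g h + (P g h f + R g h f) + (P h f g + R h f g) = jac f g h x + jac g h f x + jac h f g x"
    by (smt (verit))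
  then show ?thesis using split[OF f g h] split[OF g h f] split[OF h f g] by simp
qed

end

lemma alternating_sum_transpose:
  fixes N :: nat
  assumes "a < N" "b < N" "a \<noteq> b"
  shows "(\<Sum>\<sigma> | \<sigma> permutes {..<N}. of_int (sign \<sigma>) * F (\<sigma> \<circ> Transposition.transpose a b))
       = - (\<Sum>\<sigma> | \<sigma> permutes {..<N}. of_int (sign \<sigma>) * (F \<sigma> :: real))"
proof -
  have tr: "Transposition.transpose a b permutes {..<N}" using assms by (intro permutes_swap_id) auto
  have "(\<Sum>\<sigma> | \<sigma> permutes {..<N}. of_int (sign \<sigma>) * F (\<sigma> \<circ> Transposition.transpose a b))
      = (\<Sum>\<sigma> | \<sigma> permutes {..<N}. of_int (sign (\<sigma> \<circ> Transposition.transpose a b)) * F (\<sigma> \<circ> Transposition.transpose a b \<circ> Transposition.transpose a b))"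
    by (rule sum_permutations_compose_right[OF tr])
  also have "\<dots> = (\<Sum>\<sigma> | \<sigma> permutes {..<N}. - (of_int (sign \<sigma>) * F \<sigma>))"
  proof (intro sum.cong refl)
    fix \<sigma> assume "\<sigma> \<in> {\<sigma>. \<sigma> permutes {..<N}}"
    then have "permutation \<sigma>" using permutes_imp_permutation[of "{..<N}" \<sigma>] by simp
    then have "sign (\<sigma> \<circ> Transposition.transpose a b) = - sign \<sigma>"
      using assms(3) by (simp add: sign_compose permutation_swap_id sign_swap_id)
    then show "of_int (sign (\<sigma> \<circ> Transposition.transpose a b)) * F (\<sigma> \<circ> Transposition.transpose a b \<circ> Transposition.transpose a b) = - (of_int (sign \<sigma>) * F \<sigma>)"
      by (simp add: comp_assoc)
  qed
  finally show ?thesis by (simp add: sum_negf)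
qed

definition alt4 :: "'f list \<Rightarrow> ('f \<Rightarrow> 'f \<Rightarrow> 'f \<Rightarrow> 'f \<Rightarrow> real) \<Rightarrow> real" where
  "alt4 fs \<phi> = (\<Sum>\<sigma> | \<sigma> permutes {..<4}. of_int (sign \<sigma>) *
     \<phi> (fs ! \<sigma> 0) (fs ! \<sigma> 1) (fs ! \<sigma> 2) (fs ! \<sigma> 3))"

lemma alt4_swap:
  "alt4 fs (\<lambda>f g h k. \<phi> g f h k) = - alt4 fs \<phi>"
  "alt4 fs (\<lambda>f g h k. \<phi> f h g k) = - alt4 fs \<phi>"
  "alt4 fs (\<lambda>f g h k. \<phi> f g k h) = - alt4 fs \<phi>"
  using alternating_sum_transpose[of 0 4 1 "\<lambda>\<sigma>. \<phi> (fs ! \<sigma> 0) (fs ! \<sigma> 1) (fs ! \<sigma> 2) (fs ! \<sigma> 3)"]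
    alternating_sum_transpose[of 1 4 2 "\<lambda>\<sigma>. \<phi> (fs ! \<sigma> 0) (fs ! \<sigma> 1) (fs ! \<sigma> 2) (fs ! \<sigma> 3)"]
    alternating_sum_transpose[of 2 4 3 "\<lambda>\<sigma>. \<phi> (fs ! \<sigma> 0) (fs ! \<sigma> 1) (fs ! \<sigma> 2) (fs ! \<sigma> 3)"]
  by (simp_all add: alt4_def Transposition.transpose_def)

lemma alt4_add: "alt4 fs (\<lambda>f g h k. \<phi> f g h k + \<psi> f g h k) = alt4 fs \<phi> + alt4 fs \<psi>"
  by (simp add: alt4_def distrib_left sum.distrib)

lemma alt4_diff: "alt4 fs (\<lambda>f g h k. \<phi> f g h k - \<psi> f g h k) = alt4 fs \<phi> - alt4 fs \<psi>"
  by (simp add: alt4_def right_diff_distrib sum_subtractf)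

lemma alt4_cong:
  assumes "length fs = 4" "set fs \<subseteq> S"
    and "\<And>f g h k. f \<in> S \<Longrightarrow> g \<in> S \<Longrightarrow> h \<in> S \<Longrightarrow> k \<in> S \<Longrightarrow> \<phi> f g h k = \<psi> f g h k"
  shows "alt4 fs \<phi> = alt4 fs \<psi>"
  unfolding alt4_def
proof (intro sum.cong refl)
  fix \<sigma> :: "nat \<Rightarrow> nat" assume "\<sigma> \<in> {\<sigma>. \<sigma> permutes {..<4}}"
  then have \<sigma>: "\<sigma> permutes {..<4}" by simp
  have "fs ! \<sigma> i \<in> S" if "i < 4" for i
    using permutes_in_image[OF \<sigma>, of i] that assms(1,2) by (metis lessThan_iff nth_mem subsetD)
  then show "real_of_int (sign \<sigma>) * \<phi> (fs ! \<sigma> 0) (fs ! \<sigma> 1) (fs ! \<sigma> 2) (fs ! \<sigma> 3) =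
     real_of_int (sign \<sigma>) * \<psi> (fs ! \<sigma> 0) (fs ! \<sigma> 1) (fs ! \<sigma> 2) (fs ! \<sigma> 3)"
    using assms(3) by simp
qed

lemma sum_permutations3:
  "(\<Sum>\<sigma> | \<sigma> permutes {..<3}. of_int (sign \<sigma>) * F (\<sigma> 0) (\<sigma> 1) (\<sigma> 2))
    = F 0 1 2 - F 0 2 1 - F 1 0 2 + F 1 2 0 + F 2 0 1 - (F 2 1 (0::nat) :: real)"
proof -
  have s: "{..<3} = insert 0 (insert 1 (insert 2 ({}::nat set)))" by auto
  show ?thesis
    unfolding s
    apply (subst sum_over_permutations_insert; (simp; fail)?)
    apply (subst sum_over_permutations_insert; (simp; fail)?)
    apply (simp add: sum_over_permutations_insert permutes_sing sign_swap_id permutation_swap_id sign_compose sign_id Transposition.transpose_def)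
    done
qed

lemma sum_permutations2:
  "(\<Sum>\<sigma> | \<sigma> permutes {..<2}. of_int (sign \<sigma>) * F (\<sigma> 0) (\<sigma> 1)) = F 0 1 - (F 1 (0::nat) :: real)"
proof -
  have s: "{..<2} = insert 0 (insert 1 ({}::nat set))" by auto
  show ?thesis
    unfolding s
    apply (subst sum_over_permutations_insert; (simp; fail)?)
    apply (simp add: permutes_sing sign_swap_id permutation_swap_id sign_compose sign_id Transposition.transpose_def)
    done
qed

context derivation_bracket
begin

text \<open>
  The two sides are the two insertions whose difference is the Schouten bracket of the bivector with the
  trivector \<open>Q\<close>. If every derivation preserves \<open>Q\<close>, the Leibniz rules turn both into alternations of
  the single expression \<open>\<psi>\<close>: three copies divided by \<open>3!\<close> and two copies divided by \<open>2! 2!\<close>.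
\<close>

lemma invariant_trivector_commutes:
  assumes fs: "length fs = 4" "set fs \<subseteq> S"
    and Q_closed: "\<And>f g h. f \<in> S \<Longrightarrow> g \<in> S \<Longrightarrow> h \<in> S \<Longrightarrow> Q f g h \<in> S"
    and Q_cyclic: "\<And>f g h. f \<in> S \<Longrightarrow> g \<in> S \<Longrightarrow> h \<in> S \<Longrightarrow> Q f g h = Q g h f"
    and Q_derivation: "\<And>f g. f \<in> S \<Longrightarrow> g \<in> S \<Longrightarrow> derivation_on S (Q f g)"
    and Q_invariant: "\<And>t i f g h. t \<in> T \<Longrightarrow> i \<in> I \<Longrightarrow> f \<in> S \<Longrightarrow> g \<in> S \<Longrightarrow> h \<in> S \<Longrightarrow>
      Z t i (Q f g h) = (\<lambda>x. Q (Z t i f) g h x + Q f (Z t i g) h x + Q f g (Z t i h) x)"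
  shows "alt4 fs (\<lambda>f g h k. br f (Q g h k) x) / 6 = alt4 fs (\<lambda>f g h k. Q f g (br h k) x) / 4"
proof -
  define \<psi> where "\<psi> f g h k = (\<Sum>(i, t, s)\<in>M. p t s * (Z t i f x * Q g h (Z s i k) x))" for f g h k
  have "alt4 fs (\<lambda>f g h k. br f (Q g h k) x) = alt4 fs (\<lambda>f g h k. \<psi> f h k g + \<psi> f k g h + \<psi> f g h k)"
  proof (rule alt4_cong[OF fs])
    fix f g h k assume S4: "f \<in> S" "g \<in> S" "h \<in> S" "k \<in> S"
    have "br f (Q g h k) x = (\<Sum>(i, t, s)\<in>M. p t s * (Z t i f x * Q h k (Z s i g) x) + p t s * (Z t i f x * Q k g (Z s i h) x)
        + p t s * (Z t i f x * Q g h (Z s i k) x))"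
      unfolding br_def
    proof (intro sum.cong refl, clarify)
      fix i t s assume its: "i \<in> I" "t \<in> T" "s \<in> T"
      have "Q (Z s i g) h k = Q h k (Z s i g)" "Q g (Z s i h) k = Q k g (Z s i h)"
        using Q_cyclic[OF _ S4(3,4)] Q_cyclic[OF S4(4,2)] Z_closed its S4 by metis+
      then show "p t s * (Z t i f x * Z s i (Q g h k) x) = p t s * (Z t i f x * Q h k (Z s i g) x) + p t s * (Z t i f x * Q k g (Z s i h) x)
        + p t s * (Z t i f x * Q g h (Z s i k) x)"
        using Q_invariant[OF its(3,1) S4(2-4)] by (simp add: algebra_simps)
    qed
    then show "br f (Q g h k) x = \<psi> f h k g + \<psi> f k g h + \<psi> f g h k"
      by (simp add: \<psi>_def sum.distrib case_prod_unfold)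
  qed
  also have "\<dots> = 3 * alt4 fs \<psi>"
    using alt4_swap(2)[of fs "\<lambda>f g h k. \<psi> f g k h"] alt4_swap(3)[of fs \<psi>]
      alt4_swap(3)[of fs "\<lambda>f g h k. \<psi> f h g k"] alt4_swap(2)[of fs \<psi>]
    by (simp add: alt4_add)
  finally have 1: "alt4 fs (\<lambda>f g h k. br f (Q g h k) x) = 3 * alt4 fs \<psi>" .
  have "alt4 fs (\<lambda>f g h k. Q f g (br h k) x) = alt4 fs (\<lambda>f g h k. \<psi> h f g k - \<psi> k f g h)"
  proof (rule alt4_cong[OF fs])
    fix f g h k assume S4: "f \<in> S" "g \<in> S" "h \<in> S" "k \<in> S"
    have "(\<Sum>(i, t, s)\<in>M. p t s * (Q f g (Z t i h) x * Z s i k x)) = (\<Sum>(i, t, s)\<in>M. - (p t s * (Z t i k x * Q f g (Z s i h) x)))"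
    proof (rule sum.reindex_bij_witness[where i = "\<lambda>(i, t, s). (i, s, t)" and j = "\<lambda>(i, t, s). (i, s, t)"], goal_cases)
      case (5 a)
      obtain i t s where a: "a = (i, t, s)" by (cases a)
      show ?case unfolding a using p_antisym[of s t] by simp
    qed auto
    then show "Q f g (br h k) x = \<psi> h f g k - \<psi> k f g h"
      unfolding derivation_br[OF Q_derivation[OF S4(1,2)] S4(3,4)] \<psi>_def
      by (simp add: case_prod_unfold distrib_left sum.distrib sum_negf)
  qed
  also have "\<dots> = 2 * alt4 fs \<psi>"
    using alt4_swap(2)[of fs "\<lambda>f g h k. \<psi> g f h k"] alt4_swap(1)[of fs \<psi>]
      alt4_swap(3)[of fs "\<lambda>f g h k. \<psi> h f g k"]
    by (simp add: alt4_diff)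
  finally show ?thesis using 1 by simp
qed

end

lemma sum3_rotate:
  "(\<Sum>i\<in>I. \<Sum>j\<in>I. \<Sum>k\<in>I. F i j k) = (\<Sum>i\<in>I. \<Sum>j\<in>I. \<Sum>k\<in>I. F j k i)"
proof -
  have "(\<Sum>i\<in>I. \<Sum>j\<in>I. \<Sum>k\<in>I. F j k i) = (\<Sum>j\<in>I. \<Sum>i\<in>I. \<Sum>k\<in>I. F j k i)" by (rule sum.swap)
  also have "\<dots> = (\<Sum>j\<in>I. \<Sum>k\<in>I. \<Sum>i\<in>I. F j k i)" by (intro sum.cong refl sum.swap)
  finally show ?thesis by simp
qed

text \<open>
  Frames 0 and 1 have the bracket relations of left-invariant fields, frame 2 those of right-invariant
  fields; this is the sign \<open>\<epsilon>\<close>. Different frames commute.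
\<close>

locale three_frames = derivation_bracket S I "{0, 1, 2::nat}" Z p
  for S :: "('a \<Rightarrow> real) set" and I :: "'b set" and Z p +
  fixes c :: "'b \<Rightarrow> 'b \<Rightarrow> 'b \<Rightarrow> real" and \<epsilon> :: "nat \<Rightarrow> real"
  assumes p_values: "p 0 1 = 1 / 2" "p 0 2 = 1 / 2" "p 1 2 = 1 / 2"
    and \<epsilon>_values: "\<epsilon> 0 = - 1" "\<epsilon> 1 = - 1" "\<epsilon> 2 = 1"
    and c_cyc: "\<And>i j k. i \<in> I \<Longrightarrow> j \<in> I \<Longrightarrow> k \<in> I \<Longrightarrow> c i j k = c k i j"
    and Z_commutator: "\<And>s t i j f x. s \<in> {0, 1, 2} \<Longrightarrow> t \<in> {0, 1, 2} \<Longrightarrow> i \<in> I \<Longrightarrow> j \<in> I \<Longrightarrow> f \<in> S \<Longrightarrow>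
      Z s i (Z t j f) x - Z t j (Z s i f) x = (if s = t then \<epsilon> s * (\<Sum>k\<in>I. c k i j * Z s k f x) else 0)"
begin

lemma jac_value:
  assumes "f \<in> S" "g \<in> S" "h \<in> S"
  shows "jac f g h x = (\<Sum>i\<in>I. \<Sum>j\<in>I. \<Sum>k\<in>I. 1 / 4 * c i j k *
     (- (Z 1 i f x + Z 2 i f x) * (Z 1 j g x + Z 2 j g x) * Z 0 k h x
      - (Z 0 i f x - Z 2 i f x) * (Z 0 j g x - Z 2 j g x) * Z 1 k h x
      + (Z 0 i f x + Z 1 i f x) * (Z 0 j g x + Z 1 j g x) * Z 2 k h x))"
proof -
  let ?T = "{0, 1, 2::nat}"
  let ?J = "\<lambda>i j t t' s s'. p t t' * p s s' * (Z t i f x * Z s j g x * (Z t' i (Z s' j h) x - Z s' j (Z t' i h) x))"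
  have pv: "p 0 0 = 0" "p 1 1 = 0" "p 2 2 = 0" "p 1 0 = - 1 / 2" "p 2 0 = - 1 / 2" "p 2 1 = - 1 / 2"
    using p_antisym[of 0 0] p_antisym[of 1 1] p_antisym[of 2 2] p_antisym[of 1 0] p_antisym[of 2 0] p_antisym[of 2 1]
      p_values by simp_all
  have "jac f g h x = (\<Sum>i\<in>I. \<Sum>t\<in>?T. \<Sum>t'\<in>?T. \<Sum>j\<in>I. \<Sum>s\<in>?T. \<Sum>s'\<in>?T. ?J i j t t' s s')"
    unfolding jac_def by (simp only: sum.cartesian_product[symmetric])
  also have "\<dots> = (\<Sum>i\<in>I. \<Sum>t\<in>?T. \<Sum>j\<in>I. \<Sum>t'\<in>?T. \<Sum>s\<in>?T. \<Sum>s'\<in>?T. ?J i j t t' s s')"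
    by (intro sum.cong[OF refl] sum.swap)
  also have "\<dots> = (\<Sum>i\<in>I. \<Sum>j\<in>I. \<Sum>t\<in>?T. \<Sum>t'\<in>?T. \<Sum>s\<in>?T. \<Sum>s'\<in>?T. ?J i j t t' s s')"
    by (intro sum.cong[OF refl] sum.swap)
  also have "\<dots> = (\<Sum>i\<in>I. \<Sum>j\<in>I. \<Sum>k\<in>I. 1 / 4 * c i j k *
     (- (Z 1 i f x + Z 2 i f x) * (Z 1 j g x + Z 2 j g x) * Z 0 k h x
      - (Z 0 i f x - Z 2 i f x) * (Z 0 j g x - Z 2 j g x) * Z 1 k h x
      + (Z 0 i f x + Z 1 i f x) * (Z 0 j g x + Z 1 j g x) * Z 2 k h x))"
  proof (rule sum.cong[OF refl], rule sum.cong[OF refl])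
    fix i j assume ij: "i \<in> I" "j \<in> I"
    let ?C = "\<lambda>t. \<Sum>k\<in>I. c i j k * Z t k h x"
    have comm: "Z s i (Z t j h) x - Z t j (Z s i h) x = (if s = t then \<epsilon> s * ?C s else 0)"
      if "s \<in> ?T" "t \<in> ?T" for s t
    proof -
      have "(\<Sum>k\<in>I. c k i j * Z s k h x) = ?C s"
        using c_cyc ij by (intro sum.cong refl) auto
      then show ?thesis unfolding Z_commutator[OF that ij assms(3)] by (simp only:)
    qed
    have "(\<Sum>t\<in>?T. \<Sum>t'\<in>?T. \<Sum>s\<in>?T. \<Sum>s'\<in>?T. ?J i j t t' s s')
      = (\<Sum>t\<in>?T. \<Sum>t'\<in>?T. \<Sum>s\<in>?T. \<Sum>s'\<in>?T. p t t' * p s s' * (Z t i f x * Z s j g x *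
        (if t' = s' then \<epsilon> t' * ?C t' else 0)))"
      by (intro sum.cong refl) (simp only: comm)
    also have "\<dots> = 1 / 4 *
     (- (Z 1 i f x + Z 2 i f x) * (Z 1 j g x + Z 2 j g x) * ?C 0
      - (Z 0 i f x - Z 2 i f x) * (Z 0 j g x - Z 2 j g x) * ?C 1
      + (Z 0 i f x + Z 1 i f x) * (Z 0 j g x + Z 1 j g x) * ?C 2)"
      by (simp add: pv p_values \<epsilon>_values algebra_simps del: One_nat_def)
    also have "\<dots> = (\<Sum>k\<in>I. 1 / 4 * c i j k *
     (- (Z 1 i f x + Z 2 i f x) * (Z 1 j g x + Z 2 j g x) * Z 0 k h x
      - (Z 0 i f x - Z 2 i f x) * (Z 0 j g x - Z 2 j g x) * Z 1 k h x
      + (Z 0 i f x + Z 1 i f x) * (Z 0 j g x + Z 1 j g x) * Z 2 k h x))"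
      unfolding sum_distrib_left sum_subtractf[symmetric] sum.distrib[symmetric]
      by (intro sum.cong refl) (simp add: algebra_simps)
    finally show "(\<Sum>t\<in>?T. \<Sum>t'\<in>?T. \<Sum>s\<in>?T. \<Sum>s'\<in>?T. ?J i j t t' s s') = (\<Sum>k\<in>I. 1 / 4 * c i j k *
     (- (Z 1 i f x + Z 2 i f x) * (Z 1 j g x + Z 2 j g x) * Z 0 k h x
      - (Z 0 i f x - Z 2 i f x) * (Z 0 j g x - Z 2 j g x) * Z 1 k h x
      + (Z 0 i f x + Z 1 i f x) * (Z 0 j g x + Z 1 j g x) * Z 2 k h x))" .
  qed
  finally show ?thesis .
qed

text \<open>
  With \<open>a, b, r\<close> for the frames 0, 1, 2, the sum of the three cyclic contributions consists of the mixed
  terms of \<open>- (a + b - r)\<^sup>3\<close>. Adding and subtracting the pure cubes completes the cube.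
\<close>

lemma jacobiator_value:
  fixes x :: 'a
  assumes f: "f \<in> S" and g: "g \<in> S" and h: "h \<in> S"
  defines "l \<equiv> \<lambda>i f. Z 0 i f x + Z 1 i f x - Z 2 i f x"
  shows "br f (br g h) x + br g (br h f) x + br h (br f g) x = (\<Sum>i\<in>I. \<Sum>j\<in>I. \<Sum>k\<in>I. 1 / 4 * c i j k *
     (Z 0 i f x * Z 0 j g x * Z 0 k h x - l i f * l j g * l k h
      + Z 1 i f x * Z 1 j g x * Z 1 k h x - Z 2 i f x * Z 2 j g x * Z 2 k h x))"
proof -
  let ?P = "\<lambda>f g h i j k. - (Z 1 i f x + Z 2 i f x) * (Z 1 j g x + Z 2 j g x) * Z 0 k h x
      - (Z 0 i f x - Z 2 i f x) * (Z 0 j g x - Z 2 j g x) * Z 1 k h x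
      + (Z 0 i f x + Z 1 i f x) * (Z 0 j g x + Z 1 j g x) * Z 2 k h x"
  have "jac g h f x = (\<Sum>i\<in>I. \<Sum>j\<in>I. \<Sum>k\<in>I. 1 / 4 * c j k i * ?P g h f j k i)"
    unfolding jac_value[OF g h f] by (rule sum3_rotate)
  then have 2: "jac g h f x = (\<Sum>i\<in>I. \<Sum>j\<in>I. \<Sum>k\<in>I. 1 / 4 * c i j k * ?P g h f j k i)"
    using c_cyc by simp
  have "jac h f g x = (\<Sum>i\<in>I. \<Sum>j\<in>I. \<Sum>k\<in>I. 1 / 4 * c k i j * ?P h f g k i j)"
    unfolding jac_value[OF h f g] by (subst sum3_rotate, rule sum3_rotate)
  then have 3: "jac h f g x = (\<Sum>i\<in>I. \<Sum>j\<in>I. \<Sum>k\<in>I. 1 / 4 * c i j k * ?P h f g k i j)"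
    using c_cyc by simp
  have "?P f g h i j k + ?P g h f j k i + ?P h f g k i j = Z 0 i f x * Z 0 j g x * Z 0 k h x - l i f * l j g * l k h
      + Z 1 i f x * Z 1 j g x * Z 1 k h x - Z 2 i f x * Z 2 j g x * Z 2 k h x" for i j k
    unfolding l_def by (simp add: algebra_simps)
  then show ?thesis
    unfolding jacobiator[OF f g h] 2 3 jac_value[OF f g h] sum.distrib[symmetric] distrib_left[symmetric] by simp
qed

end

section \<open>The frames on the conjugation groupoid\<close>

lemma wedge2: "wedge [u, v] [f, g] = u f * v g - u g * v f"
  using sum_permutations2[of "\<lambda>a b. u ([f, g] ! a) * v ([f, g] ! b)"]
  by (simp add: wedge_def numeral_2_eq_2 lessThan_Suc mult.commute)

lemma wedge3: "wedge [u, v, w] [f, g, h] = u f * v g * w h - u f * v h * w g - u g * v f * w h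
    + u g * v h * w f + u h * v f * w g - u h * v g * w f"
  using sum_permutations3[of "\<lambda>a b c. u ([f, g, h] ! a) * v ([f, g, h] ! b) * w ([f, g, h] ! c)"]
  by (simp add: wedge_def numeral_3_eq_3 numeral_2_eq_2 lessThan_Suc mult_ac)

lemma ext_power_wedge:
  assumes "length vs = p" "set vs \<subseteq> V"
  shows "wedge vs \<in> ext_power A p V"
proof -
  have "map ((!) vs) [0..<p] = vs" using assms(1) by (metis map_nth)
  then show ?thesis
    unfolding ext_power_def using assms nth_mem
    by (intro CollectI exI[of _ "1::nat"] exI[of _ "\<lambda>_. 1::real"] exI[of _ "\<lambda>_ i. vs ! i"]) (auto simp: subset_iff)
qed

lemma ext_power_cmult:
  assumes "P \<in> ext_power A p V"
  shows "(\<lambda>fs. a * P fs) \<in> ext_power A p V"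
proof -
  obtain m :: nat and c v where "\<forall>k<m. \<forall>i<p. v k i \<in> V"
    "\<forall>fs\<in>smooth_args A p. P fs = (\<Sum>k<m. c k * wedge (map (v k) [0..<p]) fs)" 
    using assms unfolding ext_power_def by (elim CollectE exE conjE) (rule that; assumption)
  then show ?thesis
    unfolding ext_power_def
    by (intro CollectI exI[of _ m] exI[of _ "\<lambda>k. a * c k"] exI[of _ v]) (auto simp: sum_distrib_left mult_ac)
qed

lemma sum_lessThan_add: "(\<Sum>k<m + (l::nat). F k) = (\<Sum>k<m. F k) + (\<Sum>k<l. F (m + k) :: real)"
  by (induction l) auto

lemma ext_power_add:
  assumes "P \<in> ext_power A p V" "Q \<in> ext_power A p V"
  shows "(\<lambda>fs. P fs + Q fs) \<in> ext_power A p V"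
proof -
  obtain m :: nat and c v where 1: "\<forall>k<m. \<forall>i<p. v k i \<in> V"
    "\<forall>fs\<in>smooth_args A p. P fs = (\<Sum>k<m. c k * wedge (map (v k) [0..<p]) fs)" 
    using assms(1) unfolding ext_power_def by (elim CollectE exE conjE) (rule that; assumption)
  obtain m' :: nat and c' v' where 2: "\<forall>k<m'. \<forall>i<p. v' k i \<in> V"
    "\<forall>fs\<in>smooth_args A p. Q fs = (\<Sum>k<m'. c' k * wedge (map (v' k) [0..<p]) fs)" 
    using assms(2) unfolding ext_power_def by (elim CollectE exE conjE) (rule that; assumption)
  show ?thesis
    unfolding ext_power_def using 1 2
    by (intro CollectI exI[of _ "m + m'"] exI[of _ "\<lambda>k. if k < m then c k else c' (k - m)"]
        exI[of _ "\<lambda>k. if k < m then v k else v' (k - m)"]) (auto simp: sum_lessThan_add)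
qed

lemma ext_power_diff:
  assumes "P \<in> ext_power A p V" "Q \<in> ext_power A p V"
  shows "(\<lambda>fs. P fs - Q fs) \<in> ext_power A p V"
  using ext_power_add[OF assms(1) ext_power_cmult[OF assms(2), of "-1"]] by simp

lemma ext_power_zero: "(\<lambda>fs. 0) \<in> ext_power A p V"
  unfolding ext_power_def by (intro CollectI exI[of _ "0::nat"]) auto

lemma ext_power_sum:
  assumes "\<And>i. i \<in> J \<Longrightarrow> P i \<in> ext_power A p V"
  shows "(\<lambda>fs. \<Sum>i\<in>J. P i fs) \<in> ext_power A p V"
  using assms by (induction J rule: infinite_finite_induct) (auto intro: ext_power_zero ext_power_add)

lemma smooth_args2: "fs \<in> smooth_args A 2 \<Longrightarrow> \<exists>f g. fs = [f, g] \<and> smooth_fun A f \<and> smooth_fun A g"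
  unfolding smooth_args_def numeral_2_eq_2 by (auto simp: length_Suc_conv)

lemma smooth_args3: "fs \<in> smooth_args A 3 \<Longrightarrow> \<exists>f g h. fs = [f, g, h] \<and> smooth_fun A f \<and> smooth_fun A g \<and> smooth_fun A h"
  unfolding smooth_args_def numeral_3_eq_3 by (auto simp: length_Suc_conv)

lemma submersionI:
  fixes A :: "('a::{second_countable_topology,t2_space}, 'e::real_inner) atlas"
    and B :: "('b::{second_countable_topology,t2_space}, 'f::real_inner) atlas"
  assumes A: "smooth_manifold A" and B: "smooth_manifold B" and \<Phi>: "smooth_map A B \<Phi>"
    and sec: "\<And>p. \<exists>\<sigma>. smooth_map B A \<sigma> \<and> \<sigma> (\<Phi> p) = p \<and> (\<forall>y. \<Phi> (\<sigma> y) = y)"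
  shows "submersion A B \<Phi>"
  unfolding submersion_def
proof (intro conjI allI \<Phi> equalityI subsetI)
  fix p v assume "v \<in> push B \<Phi> ` tangent_space A p"
  then show "v \<in> tangent_space B (\<Phi> p)" using push_tangent[OF A B \<Phi>] by auto
next
  fix p v assume v: "v \<in> tangent_space B (\<Phi> p)"
  obtain \<sigma> where \<sigma>: "smooth_map B A \<sigma>" "\<sigma> (\<Phi> p) = p" "\<And>y. \<Phi> (\<sigma> y) = y" using sec by metis
  have "v f = push B \<Phi> (push A \<sigma> v) f" for f
    using smooth_fun_compose[OF A B _ \<Phi>, of f] tangent_not_smooth[OF v, of f]
    by (auto simp: push_def comp_def \<sigma>(3))
  then have "v = push B \<Phi> (push A \<sigma> v)" by (rule ext)
  then show "v \<in> push B \<Phi> ` tangent_space A p"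
    using push_tangent[OF B A \<sigma>(1) v \<sigma>(2)] by blast
qed

context orthonormal_lie_group
begin

abbreviation "\<Gamma> \<equiv> conj_groupoid G A"
abbreviation "\<B> \<equiv> conj_bivector G A n e"
abbreviation "\<Omega> \<equiv> cartan_section G A K n e"

text \<open>
  The flows of the three frames on \<open>G \<times> G\<close>: left-invariant fields on the first factor (0), left-invariant
  fields on the second factor (1), right-invariant fields on the second factor (2).
\<close>

definition move :: "nat \<Rightarrow> 'a \<Rightarrow> 'a \<times> 'a \<Rightarrow> 'a \<times> 'a" where
  "move t h x = (if t = 0 then (fst x \<otimes> h, snd x) else if t = 1 then (fst x, snd x \<otimes> h) else (fst x, h \<otimes> snd x))"

definition Z :: "nat \<Rightarrow> nat \<Rightarrow> ('a \<times> 'a \<Rightarrow> real) \<Rightarrow> 'a \<times> 'a \<Rightarrow> real" where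
  "Z t i F x = e i (\<lambda>h. F (move t h x))"

definition pcoeff :: "nat \<Rightarrow> nat \<Rightarrow> real" where
  "pcoeff s t = (if s < t then 1 / 2 else if t < s then - 1 / 2 else 0)"

definition eps :: "nat \<Rightarrow> real" where
  "eps t = (if t = 2 then 1 else - 1)"

abbreviation "SS \<equiv> {F. smooth_fun A2 F}"

lemma move_one [simp]: "move t \<one> x = x"
  by (simp add: move_def)

lemma smooth_move2: "smooth_map (prod_atlas A A2) A2 (\<lambda>y. move t (fst y) (snd y))"
proof -
  have "smooth_map (prod_atlas A A2) A2 (\<lambda>y. (fst (snd y) \<otimes> fst y, snd (snd y)))"
    "smooth_map (prod_atlas A A2) A2 (\<lambda>y. (fst (snd y), snd (snd y) \<otimes> fst y))"
    "smooth_map (prod_atlas A A2) A2 (\<lambda>y. (fst (snd y), fst y \<otimes> snd (snd y)))"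
    by (rule smooth_maps)+
  then show ?thesis unfolding move_def by (cases "t = 0"; cases "t = 1") simp_all
qed

lemma smooth_move:
  fixes B :: "('c::{second_countable_topology,t2_space}, 'f::real_inner) atlas"
  assumes "smooth_manifold B" "smooth_map B A u" "smooth_map B A2 v"
  shows "smooth_map B A2 (\<lambda>y. move t (u y) (v y))"
  using smooth_map_compose[OF assms(1) smooth_manifold_prod[OF A A2] A2 smooth_move2 smooth_map_Pair[OF assms(1) A A2 assms(2,3)]]
  by simp

lemma smooth_move_fun:
  assumes "F \<in> SS"
  shows "smooth_fun A (\<lambda>h. F (move t h x))"
  using smooth_pull[OF _ smooth_move[OF A smooth_map_id[OF A] smooth_map_const] A A2] assms by simp

lemma Z_derivation:
  assumes i: "i \<in> I"
  shows "derivation_on SS (Z t i)"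
proof -
  have closed: "Z t i F \<in> SS" if "F \<in> SS" for F
  proof -
    have "smooth_fun (prod_atlas A A2) (\<lambda>y. F (move t (fst y) (snd y)))"
      using smooth_pull[OF _ smooth_move2 smooth_manifold_prod[OF A A2] A2] that by simp
    from smooth_fun_partial[OF A A2 this e_in[OF i]] show ?thesis by (simp add: Z_def[abs_def])
  qed
  show ?thesis
    unfolding derivation_on_def
  proof (intro conjI ballI allI ext)
    fix F H x assume F: "F \<in> SS" and H: "H \<in> SS"
    show "Z t i (\<lambda>x. F x + H x) x = Z t i F x + Z t i H x"
      unfolding Z_def by (rule tangent_add[OF A e_in[OF i] smooth_move_fun[OF F] smooth_move_fun[OF H]])
    show "Z t i (\<lambda>x. F x * H x) x = F x * Z t i H x + Z t i F x * H x"
      unfolding Z_def using tangent_mult[OF A e_in[OF i] smooth_move_fun[OF F] smooth_move_fun[OF H]] by simp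
  next
    fix a F x assume F: "F \<in> SS"
    show "Z t i (\<lambda>x. a * F x) x = a * Z t i F x"
      unfolding Z_def by (rule tangent_cmult[OF A e_in[OF i] smooth_move_fun[OF F]])
  qed (rule closed)
qed

lemma SS_algebra: "function_algebra SS"
  unfolding function_algebra_def
  using smooth_fun_const[OF A2] smooth_fun_add[OF A2] smooth_fun_mult[OF A2] smooth_fun_cmult[OF A2] by simp

lemma Z_commutator:
  assumes st: "s \<in> {0, 1, 2}" "t \<in> {0, 1, 2}" and i: "i \<in> I" and j: "j \<in> I" and F: "F \<in> SS"
  shows "Z s i (Z t j F) x - Z t j (Z s i F) x = (if s = t then eps s * (\<Sum>k\<in>I. c k i j * Z s k F x) else 0)"
proof (cases "s = t")
  case True
  have sl: "smooth_fun A (\<lambda>g. F (g, snd x))" "smooth_fun A (\<lambda>h. F (fst x, h))"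
    using smooth_fun_slice1[OF A A] smooth_fun_slice2[OF A A] F by auto
  consider "s = 0" | "s = 1" | "s = 2" using st by auto
  then show ?thesis
  proof cases
    case 1
    then show ?thesis using True left_commutator[OF i j sl(1), of "fst x"]
      by (simp add: Z_def move_def eps_def)
  next
    case 2
    then show ?thesis using True left_commutator[OF i j sl(2), of "snd x"]
      by (simp add: Z_def move_def eps_def)
  next
    case 3
    then show ?thesis using True right_commutator[OF i j sl(2), of "snd x"]
      by (simp add: Z_def move_def eps_def)
  qed
next
  case False
  have mm: "move t k (move s h x) = move s h (move t k x)" for h k
    using False st by (auto simp: move_def assoc)
  have "smooth_map A2 A2 (\<lambda>y. move t (snd y) (move s (fst y) x))"
    by (rule smooth_move[OF A2 _ smooth_move[OF A2]]) (rule smooth_maps)+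
  from smooth_pull[OF _ this A2 A2] F
  have "smooth_fun A2 (\<lambda>y. F (move t (snd y) (move s (fst y) x)))" by simp
  from tangent_commute[OF A A this e_in[OF i] e_in[OF j]]
  have "Z s i (Z t j F) x = Z t j (Z s i F) x" unfolding Z_def by (simp add: mm)
  then show ?thesis using False by simp
qed

sublocale frames: three_frames SS I Z pcoeff c eps
proof
  show "function_algebra SS" by (rule SS_algebra)
  show "derivation_on SS (Z t i)" if "t \<in> {0, 1, 2}" "i \<in> I" for t i
    using Z_derivation[OF that(2)] .
  show "pcoeff s t = - pcoeff t s" for s t by (simp add: pcoeff_def)
  show "pcoeff 0 1 = 1 / 2" "pcoeff 0 2 = 1 / 2" "pcoeff 1 2 = 1 / 2" "eps 0 = - 1" "eps 1 = - 1" "eps 2 = 1"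
    by (simp_all add: pcoeff_def eps_def)
  show "c i j k = c k i j" if "i \<in> I" "j \<in> I" "k \<in> I" for i j k by (rule c_cyclic[OF that])
  show "Z s i (Z t j f) x - Z t j (Z s i f) x = (if s = t then eps s * (\<Sum>k\<in>I. c k i j * Z s k f x) else 0)"
    if "s \<in> {0, 1, 2}" "t \<in> {0, 1, 2}" "i \<in> I" "j \<in> I" "f \<in> SS" for s t i j f x
    by (rule Z_commutator[OF that])
qed simp_all

lemma comp1_smooth: "smooth_fun A2 F \<Longrightarrow> comp1 A s v F = v (\<lambda>h. F (h, s))"
  by (simp add: comp1_def push_def comp_def)

lemma comp2_smooth: "smooth_fun A2 F \<Longrightarrow> comp2 A g v F = v (\<lambda>h. F (g, h))"
  by (simp add: comp2_def push_def comp_def)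

lemma field_smooth:
  assumes "smooth_fun A f"
  shows "left_field G A v g f = v (\<lambda>h. f (g \<otimes> h))" "right_field G A v g f = v (\<lambda>h. f (h \<otimes> g))"
    "Ad G A g v f = v (\<lambda>h. f (g \<otimes> h \<otimes> inv g))"
  using assms by (simp_all add: left_field_def right_field_def Ad_def push_def comp_def)

lemma field_in:
  assumes "v \<in> lie_alg G A"
  shows "left_field G A v g \<in> tangent_space A g" "right_field G A v g \<in> tangent_space A g"
    "Ad G A g v \<in> lie_alg G A"
proof -
  show "left_field G A v g \<in> tangent_space A g" unfolding left_field_def
    by (rule push_tangent[OF A A _ assms]) ((rule smooth_maps)+, simp)
  show "right_field G A v g \<in> tangent_space A g" unfolding right_field_def
    by (rule push_tangent[OF A A _ assms]) ((rule smooth_maps)+, simp)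
  show "Ad G A g v \<in> lie_alg G A" unfolding Ad_def by (rule Ad_in[OF assms])
qed

lemma comp_in:
  shows "v \<in> tangent_space A g \<Longrightarrow> comp1 A s v \<in> tangent_space A2 (g, s)"
    "w \<in> tangent_space A s \<Longrightarrow> comp2 A g w \<in> tangent_space A2 (g, s)"
  unfolding comp1_def comp2_def
  by (rule push_tangent[OF A A2]; (assumption | rule refl | (rule smooth_maps)+))+

lemma br_expand:
  "frames.br F H x = 1 / 2 * ((\<Sum>i\<in>I. Z 0 i F x * Z 1 i H x) - (\<Sum>i\<in>I. Z 1 i F x * Z 0 i H x)
     + (\<Sum>i\<in>I. Z 0 i F x * Z 2 i H x) - (\<Sum>i\<in>I. Z 2 i F x * Z 0 i H x)
     + (\<Sum>i\<in>I. Z 1 i F x * Z 2 i H x) - (\<Sum>i\<in>I. Z 2 i F x * Z 1 i H x))"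
proof -
  have "frames.br F H x = (\<Sum>i\<in>I. \<Sum>t\<in>{0,1,2}. \<Sum>s\<in>{0,1,2}. pcoeff t s * (Z t i F x * Z s i H x))"
    unfolding frames.br_def by (simp only: sum.cartesian_product[symmetric])
  also have "\<dots> = (\<Sum>i\<in>I. 1 / 2 * (Z 0 i F x * Z 1 i H x - Z 1 i F x * Z 0 i H x + Z 0 i F x * Z 2 i H x
      - Z 2 i F x * Z 0 i H x + Z 1 i F x * Z 2 i H x - Z 2 i F x * Z 1 i H x))"
    by (intro sum.cong refl) (simp add: pcoeff_def algebra_simps)
  also have "\<dots> = 1 / 2 * ((\<Sum>i\<in>I. Z 0 i F x * Z 1 i H x) - (\<Sum>i\<in>I. Z 1 i F x * Z 0 i H x)
     + (\<Sum>i\<in>I. Z 0 i F x * Z 2 i H x) - (\<Sum>i\<in>I. Z 2 i F x * Z 0 i H x)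
     + (\<Sum>i\<in>I. Z 1 i F x * Z 2 i H x) - (\<Sum>i\<in>I. Z 2 i F x * Z 1 i H x))"
    by (simp only: sum_distrib_left[symmetric] sum_subtractf sum.distrib)
  finally show ?thesis .
qed

text \<open>
  In the third term of the bivector field, \<open>e i\<close> acts on the first factor by \<open>h \<otimes> g = g \<otimes> (inv g \<otimes> h \<otimes> g)\<close> and on the second
  factor through \<open>Ad (inv g)\<close>. Both arguments are thus conjugated by \<open>inv g\<close>, and \<open>Ad\<close>-invariance
  replaces this pair by frames 2 and 0.
\<close>

lemma conj_bivector_eq_br:
  assumes F: "F \<in> SS" and H: "H \<in> SS"
  shows "\<B> x [F, H] = frames.br F H x"
proof -
  obtain g s where x: "x = (g, s)" by (cases x)
  have sl: "smooth_fun A (\<lambda>k. L (k, s'))" "smooth_fun A (\<lambda>k. L (g', k))" if "L \<in> SS" for L g' s'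
    using smooth_fun_slice1[OF A A] smooth_fun_slice2[OF A A] that by auto
  have V: "comp2 A g (left_field G A (e i) s) L = Z 1 i L x" "comp2 A g (right_field G A (e i) s) L = Z 2 i L x"
    "comp1 A s (left_field G A (e i) g) L = Z 0 i L x"
    "comp1 A s (right_field G A (e i) g) L = e i (\<lambda>h. L (h \<otimes> g, s))"
    if "L \<in> SS" for i L
    using that sl[OF that] by (simp_all add: comp1_smooth comp2_smooth field_smooth Z_def move_def x)
  have V4: "comp2 A g (right_field G A (Ad G A (inv g) (e i)) s) L = e i (\<lambda>h. L (g, inv g \<otimes> h \<otimes> g \<otimes> s))"
    if "L \<in> SS" for i L
  proof -
    have "smooth_fun A (\<lambda>h. L (g, h \<otimes> s))"
      by (rule smooth_pull[OF sl(2)[OF that]]) (rule smooth_maps)+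
    then show ?thesis using that sl[OF that] by (simp add: comp2_smooth field_smooth)
  qed
  have Adj: "(\<Sum>i\<in>I. e i (\<lambda>h. L1 (g, inv g \<otimes> h \<otimes> g \<otimes> s)) * e i (\<lambda>h. L2 (h \<otimes> g, s))) = (\<Sum>i\<in>I. Z 2 i L1 x * Z 0 i L2 x)"
    if "L1 \<in> SS" "L2 \<in> SS" for L1 L2
  proof -
    have "smooth_fun A (\<lambda>h. L1 (g, h \<otimes> s))" "smooth_fun A (\<lambda>h. L2 (g \<otimes> h, s))"
      by (rule smooth_pull[OF sl(2)[OF that(1)]], (rule smooth_maps)+, rule smooth_pull[OF sl(1)[OF that(2)]], (rule smooth_maps)+)
    from Ad_invariant2[OF this, of "inv g"] show ?thesis by (simp add: Z_def move_def x assoc)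
  qed
  have "\<B> x [F, H] = 1 / 2 * (\<Sum>i\<in>I.
     (Z 1 i F x * Z 2 i H x - Z 1 i H x * Z 2 i F x) - (Z 1 i F x * Z 0 i H x - Z 1 i H x * Z 0 i F x)
     - (e i (\<lambda>h. F (g, inv g \<otimes> h \<otimes> g \<otimes> s)) * e i (\<lambda>h. H (h \<otimes> g, s))
       - e i (\<lambda>h. H (g, inv g \<otimes> h \<otimes> g \<otimes> s)) * e i (\<lambda>h. F (h \<otimes> g, s))))"
    by (simp only: conj_bivector_def x prod.case wedge2 V[OF F, unfolded x] V[OF H, unfolded x] V4[OF F] V4[OF H])
  also have "\<dots> = frames.br F H x"
    unfolding br_expand sum_subtractf Adj[OF F H] Adj[OF H F] by (simp add: mult.commute)
  finally show ?thesis .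
qed

lemma br_in: "F \<in> SS \<Longrightarrow> H \<in> SS \<Longrightarrow> frames.br F H \<in> SS"
  by (rule frames.br_closed)

lemma multivector_conj_bivector: "multivector_field A2 2 \<B>"
  unfolding multivector_field_def
proof (intro conjI allI ballI)
  fix x :: "'a \<times> 'a"
  obtain g s where x: "x = (g, s)" by (cases x)
  show "\<B> x \<in> ext_power A2 2 (tangent_space A2 x)"
    unfolding conj_bivector_def x prod.case
    by (intro ext_power_cmult ext_power_sum ext_power_diff ext_power_wedge)
      (auto intro!: comp_in field_in e_in)
next
  fix fs assume "fs \<in> smooth_args A2 2"
  then obtain F H where fs: "fs = [F, H]" "F \<in> SS" "H \<in> SS" using smooth_args2 by blast
  have "(\<lambda>x. \<B> x fs) = frames.br F H"
    using conj_bivector_eq_br[OF fs(2,3)] fs(1) by auto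
  then show "smooth_fun A2 (\<lambda>x. \<B> x fs)"
    using br_in[OF fs(2,3)] by simp
qed

definition Q :: "('a \<times> 'a \<Rightarrow> real) \<Rightarrow> ('a \<times> 'a \<Rightarrow> real) \<Rightarrow> ('a \<times> 'a \<Rightarrow> real) \<Rightarrow> 'a \<times> 'a \<Rightarrow> real" where
  "Q F1 F2 F3 = (\<lambda>x. \<Sum>i\<in>I. \<Sum>j\<in>I. \<Sum>k\<in>I. 1 / 4 * c i j k * (Z 0 i F1 x * Z 0 j F2 x * Z 0 k F3 x))"

lemma cubic_quarter:
  "(\<Sum>i\<in>I. \<Sum>j\<in>I. \<Sum>k\<in>I. 1 / 4 * c i j k * F i j k) = 1 / 4 * (\<Sum>i\<in>I. \<Sum>j\<in>I. \<Sum>k\<in>I. c i j k * F i j k)"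
  by (simp only: sum_distrib_left mult.assoc)

lemma cubic_rotate:
  fixes x y z :: "nat \<Rightarrow> real"
  shows "cubic y z x = cubic x y z"
proof -
  have "cubic y z x = (\<Sum>i\<in>I. \<Sum>j\<in>I. \<Sum>k\<in>I. c j k i * (y j * z k * x i))"
    by (rule sum3_rotate)
  then show ?thesis using c_cyclic by (simp add: mult_ac)
qed

lemma cubic_swap:
  fixes x y z :: "nat \<Rightarrow> real"
  shows "cubic x z y = - cubic x y z"
proof -
  have "cubic x z y = (\<Sum>i\<in>I. \<Sum>j\<in>I. \<Sum>k\<in>I. c i k j * (x i * z k * y j))"
    by (intro sum.cong[OF refl] sum.swap)
  also have "\<dots> = (\<Sum>i\<in>I. \<Sum>j\<in>I. \<Sum>k\<in>I. - (c i j k * (x i * y j * z k)))"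
  proof (intro sum.cong refl)
    fix i j k assume "i \<in> I" "j \<in> I" "k \<in> I"
    then show "c i k j * (x i * z k * y j) = - (c i j k * (x i * y j * z k))" using c_antisym[of i k j] by simp
  qed
  finally show ?thesis by (simp add: sum_negf)
qed

text \<open>
  By total antisymmetry of \<open>c\<close>, the six terms of the determinant contribute equally.
\<close>

lemma cartan_section_value:
  assumes F: "F1 \<in> SS" "F2 \<in> SS" "F3 \<in> SS"
  shows "\<Omega> s [F1, F2, F3] = (\<Sum>i\<in>I. \<Sum>j\<in>I. \<Sum>k\<in>I. 1 / 4 * c i j k *
    (e i (\<lambda>h. F1 (h, s)) * e j (\<lambda>h. F2 (h, s)) * e k (\<lambda>h. F3 (h, s))))"
proof -
  let ?x = "\<lambda>i. e i (\<lambda>h. F1 (h, s))" and ?y = "\<lambda>i. e i (\<lambda>h. F2 (h, s))" and ?z = "\<lambda>i. e i (\<lambda>h. F3 (h, s))"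
  have sm: "smooth_fun A2 F1" "smooth_fun A2 F2" "smooth_fun A2 F3"
    using F by auto
  have "\<Omega> s [F1, F2, F3] = 1 / 6 * (\<Sum>i\<in>I. \<Sum>j\<in>I. \<Sum>k\<in>I. 1 / 4 * c i j k *
     (?x i * ?y j * ?z k - ?x i * ?z j * ?y k - ?y i * ?x j * ?z k + ?y i * ?z j * ?x k + ?z i * ?x j * ?y k - ?z i * ?y j * ?x k))"
    by (simp only: cartan_section_def wedge3 comp1_smooth[OF sm(1)] comp1_smooth[OF sm(2)] comp1_smooth[OF sm(3)] c_def)
  also have "\<dots> = 1 / 24 * (cubic ?x ?y ?z - cubic ?x ?z ?y - cubic ?y ?x ?z + cubic ?y ?z ?x + cubic ?z ?x ?y - cubic ?z ?y ?x)"
    unfolding sum.distrib[symmetric] sum_subtractf[symmetric] sum_distrib_left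
    by (intro sum.cong refl) (simp add: algebra_simps)
  also have "\<dots> = 1 / 4 * cubic ?x ?y ?z"
    using cubic_swap[of ?x ?z ?y] cubic_rotate[of ?y ?z ?x] cubic_rotate[of ?z ?x ?y] cubic_swap[of ?y ?x ?z]
      cubic_swap[of ?z ?y ?x] by simp
  finally show ?thesis by (simp add: sum_distrib_left mult.assoc)
qed

lemma algebroid_cartan_section: "algebroid_section \<Gamma> 3 \<Omega>"
  unfolding algebroid_section_def
proof (intro conjI allI ballI)
  fix s
  have "comp1 A s (e i) \<in> algebroid_fibre \<Gamma> s" if i: "i \<in> I" for i
  proof -
    have "comp1 A s (e i) (\<lambda>x. f (snd x)) = 0" if f: "smooth_fun A f" for f
    proof -
      have "smooth_fun A2 (\<lambda>x. f (snd x))"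
        by (rule smooth_pull[OF f]) (rule smooth_maps)+
      then show ?thesis using comp1_smooth tangent_const[OF A e_in[OF i]] by simp
    qed
    then show ?thesis
      using comp_in(1)[OF e_in[OF i], of s]
      by (auto simp: algebroid_fibre_def conj_groupoid_def push_def comp_def case_prod_unfold)
  qed
  then show "\<Omega> s \<in> ext_power (arr_atlas \<Gamma>) 3 (algebroid_fibre \<Gamma> s)"
    unfolding cartan_section_def[abs_def]
    by (intro ext_power_cmult ext_power_sum ext_power_wedge) auto
next
  fix fs assume "fs \<in> smooth_args (arr_atlas \<Gamma>) 3"
  then obtain F1 F2 F3 where fs: "fs = [F1, F2, F3]" and F: "F1 \<in> SS" "F2 \<in> SS" "F3 \<in> SS"
    using smooth_args3[of fs "A2"] unfolding conj_groupoid_def by auto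
  have sm: "smooth_fun A (\<lambda>s. e i (\<lambda>h. L (h, s)))" if "i \<in> I" "L \<in> SS" for i L
    using smooth_fun_partial[OF A A _ e_in[OF that(1)]] that(2) by simp
  have "smooth_fun A (\<lambda>s. \<Omega> s fs)"
    unfolding fs cartan_section_value[OF F]
    by (intro smooth_fun_sum[OF A] smooth_fun_cmult[OF A] smooth_fun_mult[OF A] sm[OF _ F(1)] sm[OF _ F(2)] sm[OF _ F(3)])
  then show "smooth_fun (obj_atlas \<Gamma>) (\<lambda>s. \<Omega> s fs)"
    by (simp add: conj_groupoid_def)
qed

text \<open>
  The function \<open>h \<mapsto> F (fst h \<otimes> g, s)\<close> on all of \<open>G \<times> G\<close> is an admissible extension, so the chosen one is
  admissible as well. It agrees with \<open>F (h \<otimes> g, s)\<close> on the fibre near the unit, and \<open>v\<close> is tangent to the fibre.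
\<close>

lemma fibre_pullback_smooth:
  assumes F: "F \<in> SS"
  shows "fibre_pullback \<Gamma> (g, s) F \<in> SS"
    and "v \<in> lie_alg G A \<Longrightarrow> v (\<lambda>h. fibre_pullback \<Gamma> (g, s) F (h, g \<otimes> s \<otimes> inv g)) = v (\<lambda>h. F (h \<otimes> g, s))"
proof -
  let ?t = "g \<otimes> s \<otimes> inv g"
  let ?P = "\<lambda>F'. smooth_fun A2 F' \<and> (\<exists>W. open W \<and> (\<one>, ?t) \<in> W \<and> (\<forall>h\<in>W. snd h = ?t \<longrightarrow> F' h = F (fst h \<otimes> g, s)))"
  have eq: "fibre_pullback \<Gamma> (g, s) F = (SOME F'. ?P F')"
    by (simp add: fibre_pullback_def conj_groupoid_def case_prod_unfold)
  have F': "smooth_fun A2 F" using F by simp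
  have "smooth_fun A2 (\<lambda>h. F (fst h \<otimes> g, s))"
    by (rule smooth_pull[OF F']) (rule smooth_maps)+
  then have "?P (\<lambda>h. F (fst h \<otimes> g, s))" by (intro conjI exI[of _ UNIV]) auto
  then have P: "?P (fibre_pullback \<Gamma> (g, s) F)" unfolding eq by (rule someI[of ?P])
  then show 1: "fibre_pullback \<Gamma> (g, s) F \<in> SS" by simp
  assume v: "v \<in> lie_alg G A"
  from P obtain W where W: "open W" "(\<one>, ?t) \<in> W"
    "\<And>h. h \<in> W \<Longrightarrow> snd h = ?t \<Longrightarrow> fibre_pullback \<Gamma> (g, s) F h = F (fst h \<otimes> g, s)" by blast
  show "v (\<lambda>h. fibre_pullback \<Gamma> (g, s) F (h, ?t)) = v (\<lambda>h. F (h \<otimes> g, s))"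
  proof (rule tangent_local[OF A v, where W = "(\<lambda>h. (h, ?t)) -` W"])
    show "smooth_fun A (\<lambda>h. fibre_pullback \<Gamma> (g, s) F (h, ?t))"
      using smooth_fun_slice1[OF A A] 1 by simp
    show "smooth_fun A (\<lambda>h. F (h \<otimes> g, s))"
      by (rule smooth_pull[OF F']) (rule smooth_maps)+
    show "open ((\<lambda>h. (h, ?t)) -` W)" by (rule open_vimage[OF W(1)]) (intro continuous_intros)
  qed (use W in auto)
qed

lemma right_mv_value:
  assumes F: "F1 \<in> SS" "F2 \<in> SS" "F3 \<in> SS"
  shows "right_mv \<Gamma> \<Omega> (g, s) [F1, F2, F3]
    = (\<Sum>i\<in>I. \<Sum>j\<in>I. \<Sum>k\<in>I. 1 / 4 * c i j k *
      (e i (\<lambda>h. F1 (h \<otimes> g, s)) * e j (\<lambda>h. F2 (h \<otimes> g, s)) * e k (\<lambda>h. F3 (h \<otimes> g, s))))"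
proof -
  have src: "src \<Gamma> (g, s) = g \<otimes> s \<otimes> inv g" by (simp add: conj_groupoid_def)
  show ?thesis
    unfolding right_mv_def src list.map
      cartan_section_value[OF fibre_pullback_smooth(1)[OF F(1)] fibre_pullback_smooth(1)[OF F(2)] fibre_pullback_smooth(1)[OF F(3)]]
    by (intro sum.cong refl) (simp only: fibre_pullback_smooth(2)[OF F(1) e_in] fibre_pullback_smooth(2)[OF F(2) e_in] fibre_pullback_smooth(2)[OF F(3) e_in])
qed

lemma right_mv_eq_Q:
  assumes F: "F1 \<in> SS" "F2 \<in> SS" "F3 \<in> SS"
  shows "right_mv \<Gamma> \<Omega> x [F1, F2, F3] = Q F1 F2 F3 x"
proof -
  obtain g s where x: "x = (g, s)" by (cases x)
  have "smooth_fun A (\<lambda>h. L (g \<otimes> h, s))" if "L \<in> SS" for L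
  proof -
    have "smooth_fun A2 L" using that by simp
    then show ?thesis by (rule smooth_pull) (rule smooth_maps)+
  qed
  from Ad_invariant3[OF this[OF F(1)] this[OF F(2)] this[OF F(3)], of "inv g"]
  have "cubic (\<lambda>i. e i (\<lambda>h. F1 (h \<otimes> g, s))) (\<lambda>i. e i (\<lambda>h. F2 (h \<otimes> g, s))) (\<lambda>i. e i (\<lambda>h. F3 (h \<otimes> g, s)))
      = cubic (\<lambda>i. Z 0 i F1 x) (\<lambda>i. Z 0 i F2 x) (\<lambda>i. Z 0 i F3 x)"
    by (simp add: Z_def move_def assoc x)
  then show ?thesis
    unfolding x right_mv_value[OF F] Q_def cubic_quarter by (simp only:)
qed

text \<open>
  The inverse of the arrow \<open>(h \<otimes> inv g, g \<otimes> s \<otimes> inv g)\<close> is \<open>(g \<otimes> inv h, h \<otimes> s \<otimes> inv h)\<close>, where \<open>h\<close> occurs three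
  times. Hence left-invariant fields of the groupoid are built from the frame \<open>a + b - r\<close>.
\<close>

lemma Z_inverse_arrow:
  assumes i: "i \<in> I" and F: "F \<in> SS"
  shows "e i (\<lambda>h. F (g \<otimes> inv h, h \<otimes> s \<otimes> inv h)) = - (Z 0 i F (g, s) + Z 1 i F (g, s) - Z 2 i F (g, s))"
proof -
  have F': "smooth_fun A2 F" using F by simp
  have s1: "smooth_fun A2 (\<lambda>y. F (g \<otimes> inv (fst y), snd y \<otimes> s \<otimes> inv (snd y)))"
    by (rule smooth_pull[OF F']) (rule smooth_maps)+
  have s2: "smooth_fun A2 (\<lambda>y. F (g, fst y \<otimes> s \<otimes> inv (snd y)))"
    by (rule smooth_pull[OF F']) (rule smooth_maps)+
  have s3: "smooth_fun A (\<lambda>h. F (g \<otimes> h, s))" "smooth_fun A (\<lambda>h. F (g, s \<otimes> h))"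
    by (rule smooth_pull[OF F'], (rule smooth_maps)+)+
  show ?thesis
    using tangent_diagonal[OF A s1 e_in[OF i]] tangent_diagonal[OF A s2 e_in[OF i]]
      tangent_inverse[OF e_in[OF i] s3(1)] tangent_inverse[OF e_in[OF i] s3(2)]
    by (simp add: Z_def move_def)
qed

lemma left_mv_value:
  assumes F: "F1 \<in> SS" "F2 \<in> SS" "F3 \<in> SS"
  defines "l \<equiv> \<lambda>i F x. Z 0 i F x + Z 1 i F x - Z 2 i F x"
  shows "left_mv \<Gamma> 3 \<Omega> x [F1, F2, F3]
    = (\<Sum>i\<in>I. \<Sum>j\<in>I. \<Sum>k\<in>I. 1 / 4 * c i j k * (l i F1 x * l j F2 x * l k F3 x))"
proof -
  obtain g s where x: "x = (g, s)" by (cases x)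
  let ?inv = "\<lambda>y. (inv (fst y), fst y \<otimes> snd y \<otimes> inv (fst y))"
  have ginv: "ginv \<Gamma> = ?inv" by (auto simp: conj_groupoid_def)
  have S: "(\<lambda>y. L (?inv y)) \<in> SS" if "L \<in> SS" for L
  proof -
    have "smooth_fun A2 L" using that by simp
    then have "smooth_fun A2 (\<lambda>y. L (?inv y))"
      by (rule smooth_pull) (rule smooth_maps)+
    then show ?thesis by simp
  qed
  have E: "e i (\<lambda>h. L (?inv (h \<otimes> inv g, g \<otimes> s \<otimes> inv g))) = - l i L x" if "i \<in> I" "L \<in> SS" for i L
    using Z_inverse_arrow[OF that, of g s] by (simp add: x l_def assoc)
  have "left_mv \<Gamma> 3 \<Omega> x [F1, F2, F3]
      = - right_mv \<Gamma> \<Omega> (inv g, g \<otimes> s \<otimes> inv g)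
          [\<lambda>y. F1 (?inv y), \<lambda>y. F2 (?inv y), \<lambda>y. F3 (?inv y)]"
    by (simp add: left_mv_def ginv x comp_def)
  also have "\<dots> = - (\<Sum>i\<in>I. \<Sum>j\<in>I. \<Sum>k\<in>I. 1 / 4 * c i j k * (- l i F1 x * - l j F2 x * - l k F3 x))"
    unfolding right_mv_value[OF S[OF F(1)] S[OF F(2)] S[OF F(3)]]
    by (intro arg_cong[of _ _ uminus] sum.cong refl) (simp only: E[OF _ F(1)] E[OF _ F(2)] E[OF _ F(3)])
  also have "\<dots> = (\<Sum>i\<in>I. \<Sum>j\<in>I. \<Sum>k\<in>I. 1 / 4 * c i j k * (l i F1 x * l j F2 x * l k F3 x))"
    by (simp add: sum_negf)
  finally show ?thesis .
qed

end

context orthonormal_lie_group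
begin

section \<open>The quasi-Poisson conditions\<close>

lemma tangent_three_slots:
  assumes f: "smooth_fun (prod_atlas A2 (prod_atlas A2 A2)) f"
    and u: "smooth_map A A2 u" "smooth_map A A2 v" "smooth_map A A2 w"
    and d: "d \<in> lie_alg G A"
  shows "d (\<lambda>x. f (u x, v x, w x)) = d (\<lambda>x. f (u x, v \<one>, w \<one>)) + d (\<lambda>x. f (u \<one>, v x, w \<one>)) + d (\<lambda>x. f (u \<one>, v \<one>, w x))"
proof -
  have fst2: "smooth_map A2 A2 (\<lambda>y. t (fst y))"
    "smooth_map A2 A2 (\<lambda>y. t (snd y))" if "smooth_map A A2 t" for t
    by (rule smooth_map_compose[OF A2 A A2 that], (rule smooth_maps)+)+
  note AAA = smooth_manifold_prod[OF A2 A2] smooth_manifold_prod[OF A2 smooth_manifold_prod[OF A2 A2]]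
  have s1: "smooth_fun A2 (\<lambda>y. f (u (fst y), v (snd y), w (snd y)))"
    by (rule smooth_fun_compose[OF A2 AAA(2) f]) (intro smooth_map_Pair fst2 u A2 AAA)
  have s2: "smooth_fun A2 (\<lambda>y. f (u \<one>, v (fst y), w (snd y)))"
    by (rule smooth_fun_compose[OF A2 AAA(2) f]) (intro smooth_map_Pair smooth_map_const fst2 u A2 AAA)
  show ?thesis
    using tangent_diagonal[OF A s1 d] tangent_diagonal[OF A s2 d] by simp
qed

text \<open>
  The image of \<open>d\<close> is the velocity of a family of points of \<open>S\<close>, hence tangent to \<open>S\<close>.
\<close>

lemma conormal_curve:
  assumes S: "smooth_manifold B" and con: "conormal B S q f" and \<gamma>: "smooth_map A B \<gamma>" "\<gamma> \<one> = q" "\<And>x. \<gamma> x \<in> S"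
    and d: "d \<in> lie_alg G A"
  shows "d (\<lambda>x. f (\<gamma> x)) = 0"
proof -
  have "push B \<gamma> d \<in> sub_tangent_space B S q"
    unfolding sub_tangent_space_def
    using push_tangent[OF A S \<gamma>(1) d \<gamma>(2)] \<gamma>(3) tangent_const[OF A d] by (auto simp: push_def comp_def)
  then show ?thesis using con by (auto simp: conormal_def push_def comp_def)
qed

abbreviation "triple_atlas \<equiv> prod_atlas A2 (prod_atlas A2 A2)"

lemma triple_manifold: "smooth_manifold triple_atlas"
  by (intro smooth_manifold_prod A)

lemma mul_graph_iff: "((g, t), (h, s), z) \<in> mul_graph \<Gamma> \<longleftrightarrow> t = h \<otimes> s \<otimes> inv h \<and> z = (g \<otimes> h, s)"
  by (auto simp: mul_graph_def conj_groupoid_def)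

text \<open>
  The graph is parametrised by \<open>g\<close>, \<open>h\<close> and \<open>s\<close>. The relations come from moving, in this order, \<open>g\<close> on the
  right, \<open>s\<close> on the right, \<open>s\<close> on the left, and \<open>h\<close> on the right. In the first slot the moving group
  element is conjugated by \<open>h\<close>, so that all slots are compared along the same \<open>e i\<close>.
\<close>

lemma conormal_relations:
  fixes g h s t :: 'a and f :: "('a \<times> 'a) \<times> ('a \<times> 'a) \<times> 'a \<times> 'a \<Rightarrow> real"
  assumes con: "conormal triple_atlas (mul_graph \<Gamma>) ((g, t), (h, s), (g \<otimes> h, s)) f"
    and t: "t = h \<otimes> s \<otimes> inv h" and i: "i \<in> I"
  defines "f1 \<equiv> \<lambda>x. f (x, (h, s), (g \<otimes> h, s))" and "f2 \<equiv> \<lambda>x. f ((g, t), x, (g \<otimes> h, s))"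
    and "f3 \<equiv> \<lambda>x. f ((g, t), (h, s), x)"
  defines "a1 \<equiv> e i (\<lambda>x. f1 (g \<otimes> (h \<otimes> x \<otimes> inv h), t))"
    and "b1 \<equiv> e i (\<lambda>x. f1 (g, t \<otimes> (h \<otimes> x \<otimes> inv h)))"
    and "r1 \<equiv> e i (\<lambda>x. f1 (g, (h \<otimes> x \<otimes> inv h) \<otimes> t))"
  shows "a1 = - Z 0 i f3 (g \<otimes> h, s)"
    and "b1 = - Z 1 i f2 (h, s) - Z 1 i f3 (g \<otimes> h, s)"
    and "r1 = - Z 2 i f2 (h, s) - Z 2 i f3 (g \<otimes> h, s)"
    and "Z 0 i f2 (h, s) = - Z 0 i f3 (g \<otimes> h, s) + b1 - r1"
proof -
  have f: "smooth_fun triple_atlas f" using con by (simp add: conormal_def)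
  note slots = tangent_three_slots[OF f _ _ _ e_in[OF i]]
  note curve = conormal_curve[OF triple_manifold con _ _ _ e_in[OF i]]
  have sm3: "smooth_map A triple_atlas (\<lambda>x. (u x, v x, w x))"
    if "smooth_map A A2 u" "smooth_map A A2 v" "smooth_map A A2 w" for u v w
    by (intro smooth_map_Pair that smooth_manifold_prod A)
  have vanish: "e i (\<lambda>x. f (u x, v \<one>, w \<one>)) + e i (\<lambda>x. f (u \<one>, v x, w \<one>)) + e i (\<lambda>x. f (u \<one>, v \<one>, w x)) = 0"
    if "smooth_map A A2 u" "smooth_map A A2 v" "smooth_map A A2 w"
      "u \<one> = (g, t)" "v \<one> = (h, s)" "w \<one> = (g \<otimes> h, s)" "\<And>x. (u x, v x, w x) \<in> mul_graph \<Gamma>" for u v w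
    using slots[OF that(1-3)] curve[OF sm3[OF that(1-3)]] that(4-7) by simp
  have const: "e i (\<lambda>x. k) = 0" for k by (rule tangent_const[OF A e_in[OF i]])
  show "a1 = - Z 0 i f3 (g \<otimes> h, s)"
  proof -
    have "e i (\<lambda>x. f ((g \<otimes> (h \<otimes> x \<otimes> inv h), t), (h, s), (g \<otimes> h \<otimes> \<one>, s))) + e i (\<lambda>x. f ((g \<otimes> (h \<otimes> \<one> \<otimes> inv h), t), (h, s), (g \<otimes> h \<otimes> \<one>, s)))
        + e i (\<lambda>x. f ((g \<otimes> (h \<otimes> \<one> \<otimes> inv h), t), (h, s), (g \<otimes> h \<otimes> x, s))) = 0"
      by (rule vanish; (simp add: mul_graph_iff t assoc; fail)?; (rule smooth_maps)+)
    then show ?thesis by (simp add: const a1_def f1_def f3_def Z_def move_def)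
  qed
  show "b1 = - Z 1 i f2 (h, s) - Z 1 i f3 (g \<otimes> h, s)"
  proof -
    have "e i (\<lambda>x. f ((g, t \<otimes> (h \<otimes> x \<otimes> inv h)), (h, s \<otimes> \<one>), (g \<otimes> h, s \<otimes> \<one>))) + e i (\<lambda>x. f ((g, t \<otimes> (h \<otimes> \<one> \<otimes> inv h)), (h, s \<otimes> x), (g \<otimes> h, s \<otimes> \<one>)))
        + e i (\<lambda>x. f ((g, t \<otimes> (h \<otimes> \<one> \<otimes> inv h)), (h, s \<otimes> \<one>), (g \<otimes> h, s \<otimes> x))) = 0"
      by (rule vanish; (simp add: mul_graph_iff t assoc; fail)?; (rule smooth_maps)+)
    then show ?thesis by (simp add: b1_def f1_def f2_def f3_def Z_def move_def)
  qed
  show r1: "r1 = - Z 2 i f2 (h, s) - Z 2 i f3 (g \<otimes> h, s)"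
  proof -
    have "e i (\<lambda>x. f ((g, (h \<otimes> x \<otimes> inv h) \<otimes> t), (h, \<one> \<otimes> s), (g \<otimes> h, \<one> \<otimes> s))) + e i (\<lambda>x. f ((g, (h \<otimes> \<one> \<otimes> inv h) \<otimes> t), (h, x \<otimes> s), (g \<otimes> h, \<one> \<otimes> s)))
        + e i (\<lambda>x. f ((g, (h \<otimes> \<one> \<otimes> inv h) \<otimes> t), (h, \<one> \<otimes> s), (g \<otimes> h, x \<otimes> s))) = 0"
      by (rule vanish; (simp add: mul_graph_iff t assoc; fail)?; (rule smooth_maps)+)
    then show ?thesis by (simp add: r1_def f1_def f2_def f3_def Z_def move_def)
  qed
  show "Z 0 i f2 (h, s) = - Z 0 i f3 (g \<otimes> h, s) + b1 - r1"
  proof -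
    let ?w = "\<lambda>x. h \<otimes> x \<otimes> s \<otimes> inv x \<otimes> inv h"
    have "e i (\<lambda>x. f ((g, ?w x), (h \<otimes> \<one>, s), (g \<otimes> h \<otimes> \<one>, s))) + e i (\<lambda>x. f ((g, ?w \<one>), (h \<otimes> x, s), (g \<otimes> h \<otimes> \<one>, s)))
        + e i (\<lambda>x. f ((g, ?w \<one>), (h \<otimes> \<one>, s), (g \<otimes> h \<otimes> x, s))) = 0"
      by (rule vanish; (simp add: mul_graph_iff t assoc; fail)?; (rule smooth_maps)+)
    then have 1: "e i (\<lambda>x. f1 (g, ?w x)) + Z 0 i f2 (h, s) + Z 0 i f3 (g \<otimes> h, s) = 0"
      by (simp add: f1_def f2_def f3_def Z_def move_def t)
    have f1: "smooth_fun A2 f1"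
      unfolding f1_def by (rule smooth_fun_compose[OF A2 triple_manifold f])
        (intro smooth_map_Pair smooth_map_id smooth_map_const smooth_manifold_prod A)
    have s1: "smooth_fun A2 (\<lambda>y. f1 (g, h \<otimes> fst y \<otimes> s \<otimes> inv (snd y) \<otimes> inv h))"
      by (rule smooth_pull[OF f1]) (rule smooth_maps)+
    have s2: "smooth_fun A (\<lambda>y. f1 (g, h \<otimes> s \<otimes> y \<otimes> inv h))"
      by (rule smooth_pull[OF f1]) (rule smooth_maps)+
    have "e i (\<lambda>x. f1 (g, ?w x)) = r1 - b1"
      using tangent_diagonal[OF A s1 e_in[OF i]] tangent_inverse[OF e_in[OF i] s2]
      by (simp add: r1_def b1_def t assoc)
    with 1 show ?thesis by simp
  qed
qed

lemma Z12_invariant: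
  assumes F: "F \<in> SS" and H: "H \<in> SS"
  shows "(\<Sum>i\<in>I. Z 2 i F (x, s) * Z 2 i H (y, s)) = (\<Sum>i\<in>I. Z 1 i F (x, s) * Z 1 i H (y, s))"
proof -
  have "smooth_fun A (\<lambda>h. F (x, s \<otimes> h))" "smooth_fun A (\<lambda>h. H (y, s \<otimes> h))"
    using smooth_move_fun[OF F, of 1 "(x, s)"] smooth_move_fun[OF H, of 1 "(y, s)"] by (simp_all add: move_def)
  from Ad_invariant2[OF this, of "inv s"] show ?thesis by (simp add: Z_def move_def assoc)
qed

lemma Z12_invariant3:
  assumes F: "F1 \<in> SS" "F2 \<in> SS" "F3 \<in> SS"
  shows "cubic (\<lambda>i. Z 2 i F1 x) (\<lambda>i. Z 2 i F2 x) (\<lambda>i. Z 2 i F3 x)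
    = cubic (\<lambda>i. Z 1 i F1 x) (\<lambda>i. Z 1 i F2 x) (\<lambda>i. Z 1 i F3 x)"
proof -
  have "smooth_fun A (\<lambda>h. L (fst x, snd x \<otimes> h))" if "L \<in> SS" for L
    using smooth_move_fun[OF that, of 1 x] by (simp add: move_def)
  from Ad_invariant3[OF this[OF F(1)] this[OF F(2)] this[OF F(3)], of "inv (snd x)"]
  show ?thesis by (simp add: Z_def move_def assoc)
qed

text \<open>
  Twice the contribution of one basis index to the bracket of two functions whose derivatives along the
  three frames are \<open>a, b, r\<close> and \<open>a', b', r'\<close>.
\<close>

definition w :: "real \<Rightarrow> real \<Rightarrow> real \<Rightarrow> real \<Rightarrow> real \<Rightarrow> real \<Rightarrow> real" where
  "w a b r a' b' r' = a * b' - b * a' + a * r' - r * a' + b * r' - r * b'"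

lemma br_w:
  "frames.br F H x = 1 / 2 * (\<Sum>i\<in>I. w (Z 0 i F x) (Z 1 i F x) (Z 2 i F x) (Z 0 i H x) (Z 1 i H x) (Z 2 i H x))"
  unfolding br_expand w_def by (simp only: sum_subtractf sum.distrib)

lemma br_w_conj:
  fixes h :: 'a and x :: "'a \<times> 'a"
  assumes F: "F \<in> SS" and H: "H \<in> SS"
  defines "W \<equiv> \<lambda>t i F. e i (\<lambda>y. F (move t (h \<otimes> y \<otimes> inv h) x))"
  shows "frames.br F H x = 1 / 2 * (\<Sum>i\<in>I. w (W 0 i F) (W 1 i F) (W 2 i F) (W 0 i H) (W 1 i H) (W 2 i H))"
proof -
  have "(\<Sum>i\<in>I. Z t i F x * Z t' i H x) = (\<Sum>i\<in>I. W t i F * W t' i H)" for t t'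
    unfolding W_def Z_def by (rule Ad_invariant2[OF smooth_move_fun[OF F] smooth_move_fun[OF H], symmetric])
  then show ?thesis unfolding br_expand w_def by (simp only: sum_subtractf sum.distrib)
qed

text \<open>
  \<open>Ad\<close>-invariance allows the derivatives in the first slot to be conjugated by \<open>h\<close>. The conormal relations
  then express everything by the remaining two slots, and all terms cancel except the pairings of slot two
  with slot three within the frames 1 and 2. These agree because both slots lie over the same \<open>s\<close>, and
  conjugation by \<open>s\<close> exchanges left and right translations.
\<close>

lemma multiplicative_conj_bivector: "multiplicative \<Gamma> \<B>"
  unfolding multiplicative_def coisotropic_def
proof (intro ballI allI impI, elim conjE)
  fix q f k
  assume "q \<in> mul_graph \<Gamma>"
    and "conormal (prod_atlas (arr_atlas \<Gamma>) (prod_atlas (arr_atlas \<Gamma>) (arr_atlas \<Gamma>)))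
      (mul_graph \<Gamma>) q f"
    and "conormal (prod_atlas (arr_atlas \<Gamma>) (prod_atlas (arr_atlas \<Gamma>) (arr_atlas \<Gamma>)))
      (mul_graph \<Gamma>) q k"
  moreover obtain g t h s z where "q = ((g, t), (h, s), z)" by (metis surj_pair)
  moreover have "arr_atlas \<Gamma> = A2" by (simp add: conj_groupoid_def)
  ultimately have t: "t = h \<otimes> s \<otimes> inv h" and q: "q = ((g, t), (h, s), (g \<otimes> h, s))"
    and con: "conormal triple_atlas (mul_graph \<Gamma>) ((g, t), (h, s), (g \<otimes> h, s)) f"
      "conormal triple_atlas (mul_graph \<Gamma>) ((g, t), (h, s), (g \<otimes> h, s)) k"
    by (simp_all add: mul_graph_iff)
  let ?con = "conormal triple_atlas (mul_graph \<Gamma>) ((g, t), (h, s), (g \<otimes> h, s))"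
  let ?f1 = "\<lambda>f x. f (x, (h, s), (g \<otimes> h, s))" and ?f2 = "\<lambda>f x. f ((g, t), x, (g \<otimes> h, s))" and ?f3 = "\<lambda>f x. f ((g, t), (h, s), x)"
  have SS3: "?f1 L \<in> SS" "?f2 L \<in> SS" "?f3 L \<in> SS"
    if "?con L" for L
  proof -
    have L: "smooth_fun triple_atlas L" using that by (simp add: conormal_def)
    show "?f1 L \<in> SS" "?f2 L \<in> SS" "?f3 L \<in> SS"
      by (rule CollectI, rule smooth_fun_compose[OF A2 triple_manifold L],
          (intro smooth_map_Pair smooth_map_id smooth_map_const smooth_manifold_prod A))+
  qed
  let ?W = "\<lambda>t' i F. e i (\<lambda>y. F (move t' (h \<otimes> y \<otimes> inv h) (g, t)))"
  let ?w1 = "\<lambda>i. w (?W 0 i (?f1 f)) (?W 1 i (?f1 f)) (?W 2 i (?f1 f)) (?W 0 i (?f1 k)) (?W 1 i (?f1 k)) (?W 2 i (?f1 k))"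
  let ?w2 = "\<lambda>i. w (Z 0 i (?f2 f) (h, s)) (Z 1 i (?f2 f) (h, s)) (Z 2 i (?f2 f) (h, s)) (Z 0 i (?f2 k) (h, s)) (Z 1 i (?f2 k) (h, s)) (Z 2 i (?f2 k) (h, s))"
  let ?w3 = "\<lambda>i. w (Z 0 i (?f3 f) (g \<otimes> h, s)) (Z 1 i (?f3 f) (g \<otimes> h, s)) (Z 2 i (?f3 f) (g \<otimes> h, s)) (Z 0 i (?f3 k) (g \<otimes> h, s)) (Z 1 i (?f3 k) (g \<otimes> h, s)) (Z 2 i (?f3 k) (g \<otimes> h, s))"
  let ?r = "\<lambda>i. Z 1 i (?f2 f) (h, s) * Z 1 i (?f3 k) (g \<otimes> h, s) - Z 1 i (?f3 f) (g \<otimes> h, s) * Z 1 i (?f2 k) (h, s)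
      - (Z 2 i (?f2 f) (h, s) * Z 2 i (?f3 k) (g \<otimes> h, s) - Z 2 i (?f3 f) (g \<otimes> h, s) * Z 2 i (?f2 k) (h, s))"
  have point: "?w1 i + ?w2 i - ?w3 i = ?r i"
    if i: "i \<in> I" for i
  proof -
    have rel: "?W 0 i (?f1 L) = - Z 0 i (?f3 L) (g \<otimes> h, s)"
      "?W 1 i (?f1 L) = - Z 1 i (?f2 L) (h, s) - Z 1 i (?f3 L) (g \<otimes> h, s)"
      "?W 2 i (?f1 L) = - Z 2 i (?f2 L) (h, s) - Z 2 i (?f3 L) (g \<otimes> h, s)"
      "Z 0 i (?f2 L) (h, s) = - Z 0 i (?f3 L) (g \<otimes> h, s) + (- Z 1 i (?f2 L) (h, s) - Z 1 i (?f3 L) (g \<otimes> h, s))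
        - (- Z 2 i (?f2 L) (h, s) - Z 2 i (?f3 L) (g \<otimes> h, s))"
      if "?con L" for L
    proof -
      note r = conormal_relations[OF that t i]
      show "?W 0 i (?f1 L) = - Z 0 i (?f3 L) (g \<otimes> h, s)"
        using r(1) by (simp add: move_def)
      show "?W 1 i (?f1 L) = - Z 1 i (?f2 L) (h, s) - Z 1 i (?f3 L) (g \<otimes> h, s)"
        using r(2) by (simp add: move_def)
      show "?W 2 i (?f1 L) = - Z 2 i (?f2 L) (h, s) - Z 2 i (?f3 L) (g \<otimes> h, s)"
        using r(3) by (simp add: move_def)
      show "Z 0 i (?f2 L) (h, s) = - Z 0 i (?f3 L) (g \<otimes> h, s) + (- Z 1 i (?f2 L) (h, s) - Z 1 i (?f3 L) (g \<otimes> h, s))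
        - (- Z 2 i (?f2 L) (h, s) - Z 2 i (?f3 L) (g \<otimes> h, s))"
        using r(4) unfolding r(2) r(3) .
    qed
    show ?thesis
      unfolding rel(4)[OF con(1)] rel(4)[OF con(2)] unfolding rel(1-3)[OF con(1)] rel(1-3)[OF con(2)] w_def
      by (simp add: algebra_simps)
  qed
  have "triple_bivector \<B> q [f, k]
      = frames.br (?f1 f) (?f1 k) (g, t) + frames.br (?f2 f) (?f2 k) (h, s) - frames.br (?f3 f) (?f3 k) (g \<otimes> h, s)"
    unfolding q triple_bivector_def using SS3[OF con(1)] SS3[OF con(2)] by (simp add: conj_bivector_eq_br)
  also have "\<dots> = 1 / 2 * (\<Sum>i\<in>I. ?w1 i + ?w2 i - ?w3 i)"
    unfolding br_w_conj[OF SS3(1)[OF con(1)] SS3(1)[OF con(2)], of "(g, t)" h]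
      br_w[of "?f2 f" "?f2 k" "(h, s)"] br_w[of "?f3 f" "?f3 k" "(g \<otimes> h, s)"] sum.distrib sum_subtractf
    by (simp only: distrib_left right_diff_distrib)
  also have "\<dots> = 1 / 2 * (\<Sum>i\<in>I. ?r i)"
    by (intro arg_cong[where f = "(*) (1 / 2)"] sum.cong refl point)
  also have "\<dots> = 0"
    unfolding sum_subtractf Z12_invariant[OF SS3(2)[OF con(1)] SS3(3)[OF con(2)]] Z12_invariant[OF SS3(3)[OF con(1)] SS3(2)[OF con(2)]]
    by simp
  finally show "triple_bivector \<B> q [f, k] = 0" .
qed

lemma lie_groupoid_conj: "lie_groupoid \<Gamma>"
proof -
  have sub_src: "submersion A2 A (\<lambda>x. fst x \<otimes> snd x \<otimes> inv (fst x))"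
  proof (rule submersionI[OF A2 A])
    show "smooth_map A2 A (\<lambda>x. fst x \<otimes> snd x \<otimes> inv (fst x))" by (rule smooth_maps)+
    fix q :: "'a \<times> 'a"
    have "smooth_map A A2 (\<lambda>y. (fst q, inv (fst q) \<otimes> y \<otimes> fst q))" by (rule smooth_maps)+
    then show "\<exists>\<sigma>. smooth_map A A2 \<sigma> \<and> \<sigma> (fst q \<otimes> snd q \<otimes> inv (fst q)) = q \<and>
        (\<forall>y. fst (\<sigma> y) \<otimes> snd (\<sigma> y) \<otimes> inv (fst (\<sigma> y)) = y)"
      by (intro exI[of _ "\<lambda>y. (fst q, inv (fst q) \<otimes> y \<otimes> fst q)"]) (simp add: assoc)
  qed
  have sub_tgt: "submersion A2 A snd"
  proof (rule submersionI[OF A2 A])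
    show "smooth_map A2 A snd" by (rule smooth_map_snd'[OF A A])
    fix q :: "'a \<times> 'a"
    have "smooth_map A A2 (\<lambda>y. (fst q, y))" by (rule smooth_maps)+
    then show "\<exists>\<sigma>. smooth_map A A2 \<sigma> \<and> \<sigma> (snd q) = q \<and> (\<forall>y. snd (\<sigma> y) = y)"
      by (intro exI[of _ "\<lambda>y. (fst q, y)"]) simp
  qed
  have ident: "smooth_map A A2 (\<lambda>s. (\<one>, s))" by (rule smooth_maps)+
  have inverse: "smooth_map A2 A2 (\<lambda>x. (inv (fst x), fst x \<otimes> snd x \<otimes> inv (fst x)))"
    by (rule smooth_maps)+
  have mult: "smooth_map (prod_atlas A2 A2) A2
      (\<lambda>x. (fst (fst x) \<otimes> fst (snd x), snd (snd x)))"
    by (rule smooth_maps)+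
  have "smooth_map_on_subset (prod_atlas A2 A2) A2 S
      (\<lambda>x. (fst (fst x) \<otimes> fst (snd x), snd (snd x)))" for S
    unfolding smooth_map_on_subset_def
    using mult unfolding smooth_map_def
    by (intro ballI exI[of _ UNIV] exI[of _ "\<lambda>x. (fst (fst x) \<otimes> fst (snd x), snd (snd x))"]) simp
  then show ?thesis
    using sub_src sub_tgt ident inverse A A2
    by (simp add: lie_groupoid_def conj_groupoid_def case_prod_unfold assoc)
qed

lemma Z_minus:
  assumes "i \<in> I" "F \<in> SS"
  shows "Z t i (\<lambda>x. - F x) x = - Z t i F x"
  using fun_cong[OF derivation_onD(3)[OF Z_derivation[OF assms(1)] assms(2), of t "-1"], of x] by simp

lemma br_antisym: "frames.br H F = (\<lambda>x. - frames.br F H x)"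
  unfolding br_expand[abs_def] by (rule ext) (simp add: mult.commute field_simps)

lemma br_minus:
  assumes "H \<in> SS"
  shows "frames.br F (\<lambda>x. - H x) x = - frames.br F H x"
  unfolding br_expand using Z_minus[OF _ assms] by (simp add: sum_negf field_simps)

lemma conj_bivector_br_fun: "F \<in> SS \<Longrightarrow> H \<in> SS \<Longrightarrow> (\<lambda>y. \<B> y [F, H]) = frames.br F H"
  using conj_bivector_eq_br by auto

text \<open>
  The insertion runs over all six permutations; antisymmetry of the bracket pairs them.
\<close>

lemma half_schouten_square:
  assumes F: "F1 \<in> SS" "F2 \<in> SS" "F3 \<in> SS"
  shows "1 / 2 * schouten 2 2 \<B> \<B> x [F1, F2, F3]
    = frames.br F1 (frames.br F2 F3) x + frames.br F2 (frames.br F3 F1) x + frames.br F3 (frames.br F1 F2) x"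
proof -
  let ?B = "\<B>" and ?fs = "[F1, F2, F3]"
  have l: "[0..<2 - 1] = [0]" "[2 - 1..<3] = [1, 2]" "2 + 2 - 1 = (3::nat)"
    by (simp_all add: upt_rec numeral_2_eq_2)
  have "schouten 2 2 ?B ?B x ?fs = 2 * mv_insert 2 2 ?B ?B x ?fs"
    by (simp add: schouten_def)
  also have "mv_insert 2 2 ?B ?B x ?fs = (\<Sum>\<sigma> | \<sigma> permutes {..<3}. of_int (sign \<sigma>) *
      ?B x [?fs ! \<sigma> 0, \<lambda>y. ?B y [?fs ! \<sigma> 1, ?fs ! \<sigma> 2]]) / 2"
    unfolding mv_insert_def l by simp
  also have "\<dots> = (?B x [F1, \<lambda>y. ?B y [F2, F3]] - ?B x [F1, \<lambda>y. ?B y [F3, F2]] - ?B x [F2, \<lambda>y. ?B y [F1, F3]]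
      + ?B x [F2, \<lambda>y. ?B y [F3, F1]] + ?B x [F3, \<lambda>y. ?B y [F1, F2]] - ?B x [F3, \<lambda>y. ?B y [F2, F1]]) / 2"
    using sum_permutations3[of "\<lambda>a b c. ?B x [?fs ! a, \<lambda>y. ?B y [?fs ! b, ?fs ! c]]"] by simp
  also have "\<dots> = frames.br F1 (frames.br F2 F3) x + frames.br F2 (frames.br F3 F1) x + frames.br F3 (frames.br F1 F2) x"
    unfolding conj_bivector_br_fun[OF F(1,2)] conj_bivector_br_fun[OF F(2,1)] conj_bivector_br_fun[OF F(1,3)]
      conj_bivector_br_fun[OF F(3,1)] conj_bivector_br_fun[OF F(2,3)] conj_bivector_br_fun[OF F(3,2)]
      conj_bivector_eq_br[OF F(1) br_in[OF F(2,3)]] conj_bivector_eq_br[OF F(1) br_in[OF F(3,2)]]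
      conj_bivector_eq_br[OF F(2) br_in[OF F(1,3)]] conj_bivector_eq_br[OF F(2) br_in[OF F(3,1)]]
      conj_bivector_eq_br[OF F(3) br_in[OF F(1,2)]] conj_bivector_eq_br[OF F(3) br_in[OF F(2,1)]]
    unfolding br_antisym[of F3 F2] br_antisym[of F1 F3] br_antisym[of F2 F1]
      br_minus[OF br_in[OF F(2,3)]] br_minus[OF br_in[OF F(3,1)]] br_minus[OF br_in[OF F(1,2)]]
    by simp
  finally show ?thesis by simp
qed

text \<open>
  The Jacobiator is the cubic form of the frames \<open>a\<close> and \<open>b\<close> minus those of \<open>a + b - r\<close> and \<open>r\<close>. The forms of
  \<open>b\<close> and \<open>r\<close> cancel by \<open>Ad\<close>-invariance; the other two are the right- and the left-invariant trivector.
\<close>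

lemma square_condition:
  "mv_eq (arr_atlas \<Gamma>) 3 (\<lambda>x fs. 1 / 2 * schouten 2 2 \<B> \<B> x fs)
     (\<lambda>x fs. right_mv \<Gamma> \<Omega> x fs
        - left_mv \<Gamma> 3 \<Omega> x fs)"
  unfolding mv_eq_def
proof (intro allI ballI)
  fix x :: "'a \<times> 'a" and fs assume "fs \<in> smooth_args (arr_atlas \<Gamma>) 3"
  then obtain F1 F2 F3 where fs: "fs = [F1, F2, F3]" and F: "F1 \<in> SS" "F2 \<in> SS" "F3 \<in> SS"
    using smooth_args3[of fs "A2"] unfolding conj_groupoid_def by auto
  let ?l = "\<lambda>i F x. Z 0 i F x + Z 1 i F x - Z 2 i F x"
  let ?T = "\<lambda>u. cubic (\<lambda>i. u i F1 x) (\<lambda>i. u i F2 x) (\<lambda>i. u i F3 x)"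
  have "1 / 2 * schouten 2 2 \<B> \<B> x fs
      = 1 / 4 * (\<Sum>i\<in>I. \<Sum>j\<in>I. \<Sum>k\<in>I. c i j k * (Z 0 i F1 x * Z 0 j F2 x * Z 0 k F3 x - ?l i F1 x * ?l j F2 x * ?l k F3 x
        + Z 1 i F1 x * Z 1 j F2 x * Z 1 k F3 x - Z 2 i F1 x * Z 2 j F2 x * Z 2 k F3 x))"
    unfolding fs half_schouten_square[OF F] frames.jacobiator_value[OF F] cubic_quarter ..
  also have "\<dots> = 1 / 4 * (?T (Z 0) - ?T ?l + ?T (Z 1) - ?T (Z 2))"
    by (simp only: right_diff_distrib distrib_left sum_subtractf sum.distrib)
  also have "\<dots> = 1 / 4 * ?T (Z 0) - 1 / 4 * ?T ?l"
    unfolding Z12_invariant3[OF F] by simp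
  finally show "1 / 2 * schouten 2 2 \<B> \<B> x fs
      = right_mv \<Gamma> \<Omega> x fs
        - left_mv \<Gamma> 3 \<Omega> x fs"
    unfolding fs right_mv_eq_Q[OF F] left_mv_value[OF F] Q_def cubic_quarter .
qed

lemma Q_closed: "F1 \<in> SS \<Longrightarrow> F2 \<in> SS \<Longrightarrow> F3 \<in> SS \<Longrightarrow> Q F1 F2 F3 \<in> SS"
  unfolding Q_def
  by (intro function_algebra_sum[OF SS_algebra] function_algebraD(3,4)[OF SS_algebra] derivation_onD(1)[OF Z_derivation])

lemma Q_cyclic: "Q F1 F2 F3 = Q F2 F3 F1"
  unfolding Q_def cubic_quarter by (intro ext arg_cong[where f = "(*) (1 / 4)"] cubic_rotate[symmetric])

lemma Q_derivation:
  assumes F: "F1 \<in> SS" "F2 \<in> SS"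
  shows "derivation_on SS (Q F1 F2)"
  unfolding derivation_on_def
proof (intro conjI ballI allI ext)
  fix L x assume L: "L \<in> SS"
  show "Q F1 F2 L \<in> SS" by (rule Q_closed[OF F L])
  show "Q F1 F2 (\<lambda>x. a * L x) x = a * Q F1 F2 L x" for a
    unfolding Q_def sum_distrib_left
    by (intro sum.cong refl) (simp add: derivation_onD(3)[OF Z_derivation L] mult_ac)
  fix M assume M: "M \<in> SS"
  show "Q F1 F2 (\<lambda>x. L x + M x) x = Q F1 F2 L x + Q F1 F2 M x"
    unfolding Q_def sum.distrib[symmetric]
    by (intro sum.cong refl) (simp add: derivation_onD(2)[OF Z_derivation L M] algebra_simps)
  show "Q F1 F2 (\<lambda>x. L x * M x) x = L x * Q F1 F2 M x + Q F1 F2 L x * M x"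
    unfolding Q_def sum.distrib[symmetric] sum_distrib_left sum_distrib_right
    by (intro sum.cong refl) (simp add: derivation_onD(4)[OF Z_derivation L M] algebra_simps)
qed

text \<open>
  Frames 1 and 2 commute with frame 0, in which \<open>Q\<close> is written; along frame 0 the claim is the
  infinitesimal invariance of \<open>c\<close>.
\<close>

lemma Q_invariant:
  assumes t: "t \<in> {0, 1, 2}" and m: "m \<in> I" and F: "F1 \<in> SS" "F2 \<in> SS" "F3 \<in> SS"
  shows "Z t m (Q F1 F2 F3) = (\<lambda>x. Q (Z t m F1) F2 F3 x + Q F1 (Z t m F2) F3 x + Q F1 F2 (Z t m F3) x)"
proof
  fix x
  let ?P = "\<lambda>i j k x. 1 / 4 * c i j k * (Z 0 i F1 x * Z 0 j F2 x * Z 0 k F3 x)"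
  let ?L = "\<lambda>i j k. 1 / 4 * c i j k * (Z t m (Z 0 i F1) x * Z 0 j F2 x * Z 0 k F3 x
      + Z 0 i F1 x * Z t m (Z 0 j F2) x * Z 0 k F3 x + Z 0 i F1 x * Z 0 j F2 x * Z t m (Z 0 k F3) x)"
  let ?D = "\<lambda>i j k. 1 / 4 * c i j k *
         ((Z t m (Z 0 i F1) x - Z 0 i (Z t m F1) x) * Z 0 j F2 x * Z 0 k F3 x
        + Z 0 i F1 x * (Z t m (Z 0 j F2) x - Z 0 j (Z t m F2) x) * Z 0 k F3 x
        + Z 0 i F1 x * Z 0 j F2 x * (Z t m (Z 0 k F3) x - Z 0 k (Z t m F3) x))"
  let ?E = "\<lambda>i j k. - 1 / 4 * (c i j k * ((\<Sum>a\<in>I. c a m i * Z 0 a F1 x) * Z 0 j F2 x * Z 0 k F3 x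
        + Z 0 i F1 x * (\<Sum>a\<in>I. c a m j * Z 0 a F2 x) * Z 0 k F3 x + Z 0 i F1 x * Z 0 j F2 x * (\<Sum>a\<in>I. c a m k * Z 0 a F3 x)))"
  note D = Z_derivation[OF m, of t]
  note cl = derivation_onD(1)[OF Z_derivation]
  note fa = function_algebraD(3,4)[OF SS_algebra]
  have LQ: "Z t m (Q F1 F2 F3) x = (\<Sum>i\<in>I. \<Sum>j\<in>I. \<Sum>k\<in>I. ?L i j k)"
  proof -
    have P: "(\<lambda>x. ?P i j k x) \<in> SS" if "i \<in> I" "j \<in> I" "k \<in> I" for i j k
      using that F by (intro fa cl)
    have P2: "(\<lambda>x. \<Sum>k\<in>I. ?P i j k x) \<in> SS" if "i \<in> I" "j \<in> I" for i j
      using that by (intro function_algebra_sum[OF SS_algebra] P)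
    have P1: "(\<lambda>x. \<Sum>j\<in>I. \<Sum>k\<in>I. ?P i j k x) \<in> SS" if "i \<in> I" for i
      using that by (intro function_algebra_sum[OF SS_algebra] P2)
    have Z_sum: "Z t m (\<lambda>x. \<Sum>i\<in>I. R i x) x = (\<Sum>i\<in>I. Z t m (R i) x)" if "\<And>i. i \<in> I \<Longrightarrow> R i \<in> SS" for R
      using fun_cong[OF derivation_on_sum[OF SS_algebra D, of I R], of x] that by simp
    have "Z t m (Q F1 F2 F3) x = (\<Sum>i\<in>I. Z t m (\<lambda>x. \<Sum>j\<in>I. \<Sum>k\<in>I. ?P i j k x) x)"
      unfolding Q_def by (rule Z_sum[OF P1])
    also have "\<dots> = (\<Sum>i\<in>I. \<Sum>j\<in>I. Z t m (\<lambda>x. \<Sum>k\<in>I. ?P i j k x) x)"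
      by (intro sum.cong refl Z_sum[OF P2])
    also have "\<dots> = (\<Sum>i\<in>I. \<Sum>j\<in>I. \<Sum>k\<in>I. Z t m (\<lambda>x. ?P i j k x) x)"
      by (intro sum.cong refl Z_sum[OF P])
    also have "\<dots> = (\<Sum>i\<in>I. \<Sum>j\<in>I. \<Sum>k\<in>I. ?L i j k)"
    proof (intro sum.cong refl)
      fix i j k assume i: "i \<in> I" and j: "j \<in> I" and k: "k \<in> I"
      note i' = cl[OF i F(1), of 0] and j' = cl[OF j F(2), of 0] and k' = cl[OF k F(3), of 0]
      show "Z t m (\<lambda>x. ?P i j k x) x = 1 / 4 * c i j k * (Z t m (Z 0 i F1) x * Z 0 j F2 x * Z 0 k F3 x
        + Z 0 i F1 x * Z t m (Z 0 j F2) x * Z 0 k F3 x + Z 0 i F1 x * Z 0 j F2 x * Z t m (Z 0 k F3) x)"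
        unfolding derivation_onD(3)[OF D fa(2)[OF fa(2)[OF i' j'] k']] derivation_onD(4)[OF D fa(2)[OF i' j'] k']
          derivation_onD(4)[OF D i' j'] by (simp add: algebra_simps)
    qed
    finally show ?thesis .
  qed
  have "Z t m (Q F1 F2 F3) x - (Q (Z t m F1) F2 F3 x + Q F1 (Z t m F2) F3 x + Q F1 F2 (Z t m F3) x)
      = (\<Sum>i\<in>I. \<Sum>j\<in>I. \<Sum>k\<in>I. ?D i j k)"
    unfolding LQ unfolding Q_def sum.distrib[symmetric] sum_subtractf[symmetric]
    by (intro sum.cong refl) (simp add: algebra_simps)
  also have "\<dots> = 0"
  proof (cases "t = 0")
    case False
    have 0: "Z t m (Z 0 i L) x - Z 0 i (Z t m L) x = 0" if "i \<in> I" "L \<in> SS" for i L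
      using Z_commutator[OF t _ m that(1) that(2), of 0 x] False by simp
    show ?thesis
      by (intro sum.neutral ballI)
        (simp only: 0[OF _ F(1)] 0[OF _ F(2)] 0[OF _ F(3)] mult_zero_left mult_zero_right add_0_left)
  next
    case True
    have comm: "Z t m (Z 0 i L) x - Z 0 i (Z t m L) x = - (\<Sum>a\<in>I. c a m i * Z 0 a L x)" if "i \<in> I" "L \<in> SS" for i L
      using Z_commutator[OF t _ m that(1) that(2), of 0 x] True by (simp add: eps_def)
    have "(\<Sum>i\<in>I. \<Sum>j\<in>I. \<Sum>k\<in>I. ?D i j k)
      = (\<Sum>i\<in>I. \<Sum>j\<in>I. \<Sum>k\<in>I. ?E i j k)"
    proof (intro sum.cong refl)
      fix i j k assume i: "i \<in> I" and j: "j \<in> I" and k: "k \<in> I"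
      show "?D i j k
        = ?E i j k"
        unfolding comm[OF i F(1)] comm[OF j F(2)] comm[OF k F(3)] by (simp add: algebra_simps)
    qed
    also have "\<dots> = 0"
      unfolding sum_distrib_left[symmetric] c_infinitesimal_invariance[OF m] by simp
    finally show ?thesis .
  qed
  finally show "Z t m (Q F1 F2 F3) x = Q (Z t m F1) F2 F3 x + Q F1 (Z t m F2) F3 x + Q F1 F2 (Z t m F3) x" by simp
qed

lemma bracket_condition:
  "mv_eq (arr_atlas \<Gamma>) 4 (schouten 2 3 \<B> (right_mv \<Gamma> \<Omega>)) (\<lambda>x fs. 0)"
  unfolding mv_eq_def
proof (intro allI ballI)
  fix x fs assume "fs \<in> smooth_args (arr_atlas \<Gamma>) 4"
  then have fs: "length fs = 4" "set fs \<subseteq> SS" by (auto simp: smooth_args_def conj_groupoid_def)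
  let ?B = "\<B>" and ?R = "right_mv \<Gamma> \<Omega>"
  have l: "[0..<2 - 1] = [0]" "[2 - 1..<4] = [1, 2, 3]" "2 + 3 - 1 = (4::nat)"
    "[0..<3 - 1] = [0, 1]" "[3 - 1..<4] = [2, 3]" "3 + 2 - 1 = (4::nat)"
    by (simp_all add: upt_rec numeral_2_eq_2 numeral_3_eq_3)
  have Rfun: "(\<lambda>y. ?R y [F1, F2, F3]) = Q F1 F2 F3" if "F1 \<in> SS" "F2 \<in> SS" "F3 \<in> SS" for F1 F2 F3
    using right_mv_eq_Q[OF that] by (rule ext)
  have "mv_insert 2 3 ?B ?R x fs = alt4 fs (\<lambda>f g h k. ?B x [f, \<lambda>y. ?R y [g, h, k]]) / 6"
    unfolding mv_insert_def l alt4_def by (simp add: fact_numeral)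
  also have "alt4 fs (\<lambda>f g h k. ?B x [f, \<lambda>y. ?R y [g, h, k]]) = alt4 fs (\<lambda>f g h k. frames.br f (Q g h k) x)"
    by (rule alt4_cong[OF fs]) (simp only: Rfun conj_bivector_eq_br Q_closed)
  finally have 1: "mv_insert 2 3 ?B ?R x fs = alt4 fs (\<lambda>f g h k. frames.br f (Q g h k) x) / 6" .
  have "mv_insert 3 2 ?R ?B x fs = alt4 fs (\<lambda>f g h k. ?R x [f, g, \<lambda>y. ?B y [h, k]]) / 4"
    unfolding mv_insert_def l alt4_def by (simp add: fact_numeral)
  also have "alt4 fs (\<lambda>f g h k. ?R x [f, g, \<lambda>y. ?B y [h, k]]) = alt4 fs (\<lambda>f g h k. Q f g (frames.br h k) x)"
    by (rule alt4_cong[OF fs]) (simp only: conj_bivector_br_fun right_mv_eq_Q br_in)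
  finally have 2: "mv_insert 3 2 ?R ?B x fs = alt4 fs (\<lambda>f g h k. Q f g (frames.br h k) x) / 4" .
  have "alt4 fs (\<lambda>f g h k. frames.br f (Q g h k) x) / 6 = alt4 fs (\<lambda>f g h k. Q f g (frames.br h k) x) / 4"
    by (rule frames.invariant_trivector_commutes[OF fs Q_closed Q_cyclic Q_derivation Q_invariant])
  then show "schouten 2 3 ?B ?R x fs = 0"
    unfolding schouten_def 1 2 by simp
qed

theorem quasi_poisson: "quasi_poisson_groupoid \<Gamma> \<B> \<Omega>"
  unfolding quasi_poisson_groupoid_def
  using lie_groupoid_conj multivector_conj_bivector multiplicative_conj_bivector algebroid_cartan_section
    square_condition bracket_condition
  by (simp add: conj_groupoid_def)

end

theorem corollary4p23:
  fixes G :: "('a::{second_countable_topology,t2_space}, 'b) monoid_scheme"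
    and A :: "('a, 'e::real_inner) atlas"
    and K :: "'a tvec \<Rightarrow> 'a tvec \<Rightarrow> real"
    and n :: nat
    and e :: "nat \<Rightarrow> 'a tvec"
  assumes "lie_group G A"
    and "connected (UNIV :: 'a set)"
    and "simply_connected (UNIV :: 'a set)"
    and "sym_bilinear_form (lie_alg G A) K"
    and "nondegenerate_form (lie_alg G A) K"
    and "invariant_form G A K"
    and "orthonormal_basis_of (lie_alg G A) K n e"
  shows "quasi_poisson_groupoid (conj_groupoid G A)
           (conj_bivector G A n e) (cartan_section G A K n e)"
proof -
  interpret orthonormal_lie_group G A K n e
    using assms by unfold_locales
  show ?thesis by (rule quasi_poisson)
qed

end
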